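(* Let $a\in C[0,\infty)$ satisfy $a(0)=0$, $a(u)>0$ for $u>0$, and, with $$I(u)=\int_u^\infty\frac{dv}{v\,a(v)},$$ suppose $I(u)<\infty$ for all $u>0$ and $\limsup_{u\to\infty}a(u)I(u)<\infty$. Suppose moreover that $$\limsup_{u\to0}a(u)I(u)<\infty,$$ and that there exist $c,\mu>0$ such that $$a(u)I^\mu(u)\ge c\,a(v)I^\mu(v)\qquad\text{for all }0<u<v.$$ Choose $\Lambda$ with $$0<\Lambda<\frac{1}{\bigl(\sup_{u>0}a(u)I(u)\bigr)_+},$$ and define, for $s>0$, $$H(s)=\bigl[\Lambda I(s)\bigr]^{-1/\Lambda},\qquad F(s)=\frac1s H^{\Lambda+1}(s)=\Bigl(\Lambda s^{\frac{\Lambda}{1+\Lambda}}I(s)\Bigr)^{-\frac1\Lambda-1},$$ with $H(0)=F(0)=0$. Let $\Omega\subset\mathbb{R}^N$ be a domain, $T>0$, $\Omega_T=\Omega\times(0,T)$, and let $u$ be a positive bounded weak solution in $\Omega_T$ of the inequality $u_t\le a(u)\Delta u$ (in the sense defined in the context, with these $H$ and $F$). Then $u$ enjoys a finite propagation speed in $t$: for every open ball $B\subset\Omega$ and every $\epsilon\in(0,1)$ there exists $s\in(0,T]$ (which may depend on $B$, $\epsilon$ and $u$) such that, if $u(x,0)=0$ for all $x\in B$, then $u(x,t)=0$ for all $(x,t)\in\epsilon B\times[0,s]$.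
   Context: Notation: $(y)_+=\max\{y,0\}$; for an open ball $B$, $\epsilon B$ denotes the ball with the same centre and with radius multiplied by $\epsilon$; $Lip_c(E)$ is the set of Lipschitz continuous functions with compact support in $E$; $L^0_{loc}(\Omega)$ is the space of (a.e. classes of) measurable functions on $\Omega$ with the topology of local convergence in measure. Weak solution. A positive bounded weak solution $u$ to $u_t\le a(u)\Delta u$ in $\Omega_T$ is a function $u\in L^\infty(\Omega_T)$, $u\ge0$, such that $\nabla u\in L^2_{loc}(\Omega_T)$ (spatial gradient), the map $[0,T]\ni t\mapsto u(t)\in L^0_{loc}(\Omega)$ is continuous, and $$\int_{\Omega_T}\nabla u\cdot\nabla\bigl(F(u)\phi\bigr)\,dx\,dt\le\int_{\Omega_T}\phi_t\,H(u)\,dx\,dt\qquad\text{for all }\phi\in Lip_c(\Omega_T),\ \phi\ge0.$$ Here $\nabla u\cdot\nabla(F(u)\phi)$ means $\phi F'(u)|\nabla u|^2+F(u)\nabla u\cdot\nabla\phi$, where the first term is taken to be $0$ where $u=0$ (there $\nabla u=0$ a.e.). The equalities $u(x,0)=0$ on $B$ and $u(x,t)=0$ on $\epsilon B\times[0,s]$ are understood for almost every $x$ (for each $t\in[0,s]$), since $u(t)$ is an element of $L^0_{loc}(\Omega)$. *)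

theory Defs
  imports "HOL-Analysis.Analysis"
begin

text \<open>The functions \<open>I\<close>, \<open>H\<close>, \<open>F\<close>. Only arguments \<open>s \<ge> 0\<close> matter; the value of
  \<open>tailI\<close> is meaningful when the integrand is integrable, which the theorem assumes.\<close>

definition tailI :: "(real \<Rightarrow> real) \<Rightarrow> real \<Rightarrow> real" where
  "tailI a s = (LBINT v:{s..}. 1 / (v * a v))"

definition Hfun :: "(real \<Rightarrow> real) \<Rightarrow> real \<Rightarrow> real \<Rightarrow> real" where
  "Hfun a \<Lambda> s = (if s = 0 then 0 else (\<Lambda> * tailI a s) powr (- 1 / \<Lambda>))"

definition Ffun :: "(real \<Rightarrow> real) \<Rightarrow> real \<Rightarrow> real \<Rightarrow> real" where
  "Ffun a \<Lambda> s = (if s = 0 then 0 else 1 / s * Hfun a \<Lambda> s powr (\<Lambda> + 1))"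

lemma Ffun_alt:
  assumes "s > 0" "\<Lambda> > 0" "tailI a s > 0"
  shows "Ffun a \<Lambda> s = (\<Lambda> * s powr (\<Lambda> / (1 + \<Lambda>)) * tailI a s) powr (- 1 / \<Lambda> - 1)"
proof -
  have e: "(- 1 / \<Lambda>) * (\<Lambda> + 1) = - 1 / \<Lambda> - 1"
    and e2: "(\<Lambda> / (1 + \<Lambda>)) * (- 1 / \<Lambda> - 1) = - 1"
    using assms by (auto simp: divide_simps)
  have "(\<Lambda> * s powr (\<Lambda> / (1 + \<Lambda>)) * tailI a s) powr (- 1 / \<Lambda> - 1)
      = (s powr (\<Lambda> / (1 + \<Lambda>))) powr (- 1 / \<Lambda> - 1) * (\<Lambda> * tailI a s) powr (- 1 / \<Lambda> - 1)"
    using assms by (subst powr_mult [symmetric]) (auto simp: mult_ac)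
  also have "\<dots> = 1 / s * (\<Lambda> * tailI a s) powr (- 1 / \<Lambda> - 1)"
    using assms unfolding powr_powr e2 by (simp add: powr_minus_divide)
  finally show ?thesis
    using assms(1) unfolding Ffun_def Hfun_def by (auto simp only: powr_powr e split: if_splits)
qed

text \<open>Points of space-time are pairs \<open>(x, t)\<close>. For Lipschitz functions the partial derivatives
  below exist almost everywhere; on the remaining null set \<open>deriv\<close> is an arbitrary value.\<close>

definition space_grad :: "('a::euclidean_space \<times> real \<Rightarrow> real) \<Rightarrow> 'a \<times> real \<Rightarrow> 'a" where
  "space_grad \<phi> z = (\<Sum>b\<in>Basis. deriv (\<lambda>h. \<phi> (fst z + h *\<^sub>R b, snd z)) 0 *\<^sub>R b)"

definition time_deriv :: "('a \<times> real \<Rightarrow> real) \<Rightarrow> 'a \<times> real \<Rightarrow> real" where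
  "time_deriv \<phi> z = deriv (\<lambda>t. \<phi> (fst z, t)) (snd z)"

text \<open>Functions with compact support in \<open>E\<close> are represented by their extension by zero to the
  whole space; for open \<open>E\<close> this extension is again Lipschitz (respectively \<open>C\<^sup>1\<close>).\<close>

definition compact_supp_in :: "'b::topological_space set \<Rightarrow> ('b \<Rightarrow> real) \<Rightarrow> bool" where
  "compact_supp_in E \<phi> \<longleftrightarrow> (\<exists>K. compact K \<and> K \<subseteq> E \<and> (\<forall>z. z \<notin> K \<longrightarrow> \<phi> z = 0))"

definition Lip_c :: "'b::metric_space set \<Rightarrow> ('b \<Rightarrow> real) set" where
  "Lip_c E = {\<phi>. (\<exists>L. L-lipschitz_on UNIV \<phi>) \<and> compact_supp_in E \<phi>}"

definition C1_c :: "'b::real_normed_vector set \<Rightarrow> ('b \<Rightarrow> real) set" where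
  "C1_c E = {\<phi>. (\<exists>\<phi>' :: 'b \<Rightarrow> 'b \<Rightarrow>\<^sub>L real.
      (\<forall>z. (\<phi> has_derivative blinfun_apply (\<phi>' z)) (at z)) \<and> continuous_on UNIV \<phi>') \<and>
    compact_supp_in E \<phi>}"

text \<open>\<open>g\<close> is the weak (distributional) spatial gradient of \<open>u\<close> on the open set \<open>E\<close> of space-time,
  and \<open>g\<close> lies in \<open>L\<^sup>2\<^sub>l\<^sub>o\<^sub>c(E)\<close>.\<close>

definition weak_space_grad_L2loc ::
  "('a::euclidean_space \<times> real) set \<Rightarrow> ('a \<times> real \<Rightarrow> real) \<Rightarrow> ('a \<times> real \<Rightarrow> 'a) \<Rightarrow> bool" where
  "weak_space_grad_L2loc E u g \<longleftrightarrow>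
    g \<in> borel_measurable (lebesgue_on E) \<and>
    (\<forall>K. compact K \<and> K \<subseteq> E \<longrightarrow> set_integrable lebesgue K (\<lambda>z. (norm (g z))\<^sup>2)) \<and>
    (\<forall>\<phi> \<in> C1_c E. (LINT z:E|lebesgue. u z *\<^sub>R space_grad \<phi> z) = - (LINT z:E|lebesgue. \<phi> z *\<^sub>R g z))"

text \<open>Continuity of \<open>[0,T] \<ni> t \<mapsto> u(\<cdot>,t) \<in> L\<^sup>0\<^sub>l\<^sub>o\<^sub>c(\<Omega>)\<close>, i.e. for local convergence in measure.\<close>

definition continuous_L0_loc ::
  "'a::euclidean_space set \<Rightarrow> real \<Rightarrow> ('a \<times> real \<Rightarrow> real) \<Rightarrow> bool" where
  "continuous_L0_loc \<Omega> T u \<longleftrightarrow>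
    (\<forall>t\<in>{0..T}. (\<lambda>x. u (x, t)) \<in> borel_measurable (lebesgue_on \<Omega>)) \<and>
    (\<forall>t\<in>{0..T}. \<forall>K \<delta>. compact K \<and> K \<subseteq> \<Omega> \<and> \<delta> > 0 \<longrightarrow>
      ((\<lambda>s. measure lebesgue {x\<in>K. \<bar>u (x, s) - u (x, t)\<bar> > \<delta>}) \<longlongrightarrow> 0) (at t within {0..T}))"

text \<open>The function \<open>\<nabla>u \<cdot> \<nabla>(F(u)\<phi>) = \<phi> F'(u) |\<nabla>u|\<^sup>2 + F(u) \<nabla>u \<cdot> \<nabla>\<phi>\<close>, with \<open>g = \<nabla>u\<close>.\<close>

definition diffusion_term ::
  "(real \<Rightarrow> real) \<Rightarrow> ('a::euclidean_space \<times> real \<Rightarrow> real) \<Rightarrow> ('a \<times> real \<Rightarrow> 'a) \<Rightarrow>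
   ('a \<times> real \<Rightarrow> real) \<Rightarrow> 'a \<times> real \<Rightarrow> real" where
  "diffusion_term F u g \<phi> z =
    (if u z = 0 then 0 else \<phi> z * deriv F (u z) * (norm (g z))\<^sup>2) +
    F (u z) * (g z \<bullet> space_grad \<phi> z)"

text \<open>Positive bounded weak solutions of \<open>u\<^sub>t \<le> a(u) \<Delta>u\<close> in \<open>\<Omega> \<times> (0,T)\<close>. The function \<open>u\<close> is a
  representative whose slice \<open>u(\<cdot>,t)\<close> represents the element \<open>u(t)\<close> of \<open>L\<^sup>0\<^sub>l\<^sub>o\<^sub>c(\<Omega>)\<close> for every
  \<open>t \<in> [0,T]\<close>. Finiteness of the left-hand integral is part of the integral inequality and is
  stated separately because the Bochner integral of a non-integrable function is \<open>0\<close>.\<close>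

definition pos_bdd_weak_solution ::
  "(real \<Rightarrow> real) \<Rightarrow> (real \<Rightarrow> real) \<Rightarrow> 'a::euclidean_space set \<Rightarrow> real \<Rightarrow> ('a \<times> real \<Rightarrow> real) \<Rightarrow> bool"
  where
  "pos_bdd_weak_solution F H \<Omega> T u \<longleftrightarrow>
    (let E = \<Omega> \<times> {0<..<T} in
      u \<in> borel_measurable (lebesgue_on E) \<and>
      (\<exists>M. AE z in lebesgue_on E. \<bar>u z\<bar> \<le> M) \<and>
      (AE z in lebesgue_on E. u z \<ge> 0) \<and>
      continuous_L0_loc \<Omega> T u \<and>
      (\<exists>g. weak_space_grad_L2loc E u g \<and>
        (\<forall>\<phi> \<in> Lip_c E. (\<forall>z. \<phi> z \<ge> 0) \<longrightarrow>
          set_integrable lebesgue E (diffusion_term F u g \<phi>) \<and>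
          (LINT z:E|lebesgue. diffusion_term F u g \<phi> z)
            \<le> (LINT z:E|lebesgue. time_deriv \<phi> z * H (u z)))))"

end

theory Submission
  imports Defs
begin

text \<open>
  Since \<open>H' = F / a\<close>, testing the inequality with \<open>\<phi> = m\<^sup>2 \<theta>(t)\<close>, where \<open>m = (\<rho>\<^sup>2 - |x - x\<^sub>0|\<^sup>2)\<^sub>+\<close>,
  bounds both \<open>sup\<^sub>t \<integral> m\<^sup>2 H(u)\<close> and \<open>\<integral>\<integral> m\<^sup>2 F'(u) |\<nabla>u|\<^sup>2\<close> by a multiple of \<open>\<rho>\<^sup>2 Z(\<rho>)\<close>, with
  \<open>Z(\<rho>) = \<integral>\<integral> H(u)\<^sup>1\<^sup>+\<^sup>\<Lambda>\<close> over \<open>B\<^sub>\<rho> \<times> (0,s)\<close>; here \<open>F\<^sup>2 \<le> A H\<^sup>1\<^sup>+\<^sup>\<Lambda> F'\<close> with \<open>A = sup a I\<close>. The condition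
  on \<open>a I\<^sup>\<mu>\<close> gives \<open>a \<ge> c H\<^bsup>\<Lambda>\<mu>\<^esup>\<close> for bounded arguments, so a high power \<open>w = H(u)\<^sup>p\<close> has
  \<open>|\<nabla>w|\<^sup>2 \<le> C F'(u) |\<nabla>u|\<^sup>2\<close>. A Nash inequality for \<open>w\<close>, obtained by averaging
  \<open>w(x)\<^sup>2 \<le> (w(x+y) - w(x))\<^sup>2 + 2 w(x) w(x+y)\<close> over small \<open>y\<close>, and interpolation of the exponent
  \<open>1 + \<Lambda>\<close> between \<open>1\<close> and \<open>2 p\<close> give \<open>Z(\<rho>) \<le> C (\<rho>' - \<rho>)\<^bsup>-\<gamma>\<^esup> Z(\<rho>')\<^bsup>1+\<kappa>\<^esup>\<close>. As \<open>Z \<le> C s\<close> initially,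
  iterating over shrinking balls yields \<open>Z = 0\<close> on the smaller ball once \<open>s\<close> is small.
\<close>

section \<open>The nonlinearity\<close>

text \<open>The bound \<open>\<Lambda> a I < 1\<close> acts twice: it gives
  \<open>F' \<ge> F / (s a I)\<close>, so that the mixed term
  \<open>F(u) \<nabla>u \<nabla>\<phi>\<close> can be absorbed, and it makes \<open>H(s) / s\<close>
  nondecreasing, so that \<open>H\<close> is at most linear at 0. The gain
  \<open>\<kappa> > 0\<close> has its origin in a mismatch of powers: the energy controls
  \<open>H(u)\<close> to the first power, while its right-hand side integrates
  \<open>H(u)^(1+\<Lambda>)\<close>. Cutting at a level \<open>\<eta>\<close> leaves a surplus
  factor \<open>\<eta>^\<Lambda>\<close> on small values; large values are left to the Nash
  inequality. The obstacle is the degeneracy at \<open>u = 0\<close>. Only \<open>u\<close> has a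
  weak gradient, and \<open>1 / a\<close> may blow up there. The power \<open>p\<close> is taken so
  high that \<open>H^p\<close> is C^1 up to 0 with \<open>(H^p)'^2 \<le> C F'\<close>. Weak
  differentiability of \<open>w\<close> is never established: only its increments are estimated, by
  a one-dimensional chain rule along segments. The initial condition enters once, as the vanishing
  of the energy at time 0. Continuity of \<open>t \<mapsto> u(t)\<close> in measure is what gives
  meaning to that value, and at the end it carries the vanishing from almost every time to every
  time.\<close>

lemma tailI_has_derivative:
  assumes cont: "continuous_on {0..} a" and pos: "\<forall>s>0. a s > 0"
    and int: "\<forall>s>0. set_integrable lborel {s..} (\<lambda>v. 1 / (v * a v))" and s: "s > 0"
  shows "(tailI a has_real_derivative - (1 / (s * a s))) (at s)"
proof -
  define k where "k v = 1 / (v * a v)" for v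
  define b where "b = s / 2"
  have b: "0 < b" "b < s" using s by (auto simp: b_def)
  have kc: "continuous_on {b..s+1} k"
  proof -
    have "v * a v \<noteq> 0" if "v \<in> {b..s+1}" for v
      using that b pos[rule_format, of v] by auto
    moreover have "continuous_on {b..s+1} a" by (rule continuous_on_subset[OF cont]) (use b in auto)
    ultimately show ?thesis unfolding k_def by (intro continuous_intros) auto
  qed
  \<comment> \<open>Near \<open>s\<close> the tail is a constant minus a proper integral from the
    base point \<open>b = s / 2\<close>, so the fundamental theorem of calculus applies.\<close>
  have eq: "tailI a t = tailI a b - integral {b..t} k" if "t \<in> {b<..<s+1}" for t
  proof -
    have 1: "set_integrable lborel {b..} k" using int b unfolding k_def by auto
    have A: "set_integrable lborel {b..t} k" "set_integrable lborel {t<..} k"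
      by (rule set_integrable_subset[OF 1]; use that in auto)+
    have "tailI a b = (LBINT v:{b..t} \<union> {t<..}. k v)"
      unfolding tailI_def k_def using that by (intro arg_cong2[where f="\<lambda>X. set_lebesgue_integral lborel X"]) auto
    also have "\<dots> = (LBINT v:{b..t}. k v) + (LBINT v:{t<..}. k v)"
      using A by (intro set_integral_Un) auto
    also have "(LBINT v:{t<..}. k v) = tailI a t"
      unfolding tailI_def k_def set_lebesgue_integral_def
    proof (rule integral_cong_AE)
      show "AE x in lborel. indicat_real {t<..} x *\<^sub>R (1 / (x * a x)) = indicat_real {t..} x *\<^sub>R (1 / (x * a x))"
        using AE_lborel_singleton[of t] by eventually_elim (auto simp: indicator_def)
      show "(\<lambda>x. indicat_real {t<..} x *\<^sub>R (1 / (x * a x))) \<in> borel_measurable lborel"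
        using A(2) unfolding set_integrable_def k_def by auto
      have "t > 0" using that b by auto
      then show "(\<lambda>x. indicat_real {t..} x *\<^sub>R (1 / (x * a x))) \<in> borel_measurable lborel"
        using int unfolding set_integrable_def by (auto dest: spec[of _ t])
    qed
    also have "(LBINT v:{b..t}. k v) = integral {b..t} k"
      by (rule set_borel_integral_eq_integral(2)[OF A(1)])
    finally show ?thesis by simp
  qed
  have "((\<lambda>x. integral {b..x} k) has_real_derivative k s) (at s within {b..s+1})"
    by (rule integral_has_real_derivative[OF kc]) (use b in auto)
  then have "((\<lambda>x. integral {b..x} k) has_real_derivative k s) (at s)"
    using b by (simp add: at_within_Icc_at)
  then have "((\<lambda>x. tailI a b - integral {b..x} k) has_real_derivative - k s) (at s)"
    by (auto intro!: derivative_eq_intros)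
  then have "(tailI a has_real_derivative - k s) (at s)"
    by (rule has_field_derivative_transform_within_open[where S="{b<..<s+1}"]) (use b eq in \<open>simp_all\<close>)
  then show ?thesis by (simp add: k_def)
qed

lemma tailI_pos:
  assumes pos: "\<forall>s>0. a s > 0"
    and int: "\<forall>s>0. set_integrable lborel {s..} (\<lambda>v. 1 / (v * a v))" and s: "s > 0"
  shows "tailI a s > 0"
proof -
  have i: "integrable lborel (\<lambda>v. indicator {s..} v *\<^sub>R (1 / (v * a v)))"
    using int s unfolding set_integrable_def by auto
  have nn: "0 \<le> indicator {s..} v *\<^sub>R (1 / (v * a v))" for v
    using pos s by (auto simp: indicator_def less_imp_le)
  have "tailI a s \<noteq> 0"
  proof
    assume "tailI a s = 0"
    then have "AE v in lborel. indicator {s..} v *\<^sub>R (1 / (v * a v)) = 0"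
      using integral_nonneg_eq_0_iff_AE[OF i] nn unfolding tailI_def set_lebesgue_integral_def by auto
    \<comment> \<open>The integrand is strictly positive on this interval, so a vanishing integral
      would make an interval of length 1 a null set.\<close>
    then have "AE v in lborel. v \<notin> {s..s+1}"
    proof eventually_elim
      case (elim v)
      then show ?case using pos[rule_format, of v] s by (auto simp: indicator_def split: if_splits)
    qed
    then have "{s..s+1} \<in> null_sets lborel"
      by (subst AE_iff_null_sets) simp_all
    then have "emeasure lborel {s..s+1} = 0" by (rule null_setsD1)
    then show False by simp
  qed
  moreover have "tailI a s \<ge> 0"
    unfolding tailI_def set_lebesgue_integral_def using nn by (intro integral_nonneg_AE) auto
  ultimately show ?thesis by simp
qed

text \<open>\<open>A\<close> is any upper bound of \<open>a I\<close>. The choice of \<Lambda> below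
  the reciprocal of the supremum is used only in the form \<open>A * \<Lambda> < 1\<close>.\<close>

locale degenerate_coefficient =
  fixes a :: "real \<Rightarrow> real" and \<Lambda> A c \<mu> :: real
  assumes a_cont: "continuous_on {0..} a"
    and a_pos: "s > 0 \<Longrightarrow> a s > 0"
    and I_finite: "\<forall>s>0. set_integrable lborel {s..} (\<lambda>v. 1 / (v * a v))"
    and aI_le: "s > 0 \<Longrightarrow> a s * tailI a s \<le> A"
    and \<Lambda>_pos: "\<Lambda> > 0" and A\<Lambda>: "A * \<Lambda> < 1"
    and c_pos: "c > 0" and \<mu>_pos: "\<mu> > 0"
    and almost_decreasing: "0 < s \<Longrightarrow> s < v \<Longrightarrow>
          a s * tailI a s powr \<mu> \<ge> c * (a v * tailI a v powr \<mu>)"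
begin

abbreviation "I \<equiv> tailI a"
abbreviation "H \<equiv> Hfun a \<Lambda>"
abbreviation "F \<equiv> Ffun a \<Lambda>"

lemma I_pos: "s > 0 \<Longrightarrow> I s > 0"
  using tailI_pos[of a s] a_pos I_finite by auto

lemma I_deriv: "s > 0 \<Longrightarrow> (I has_real_derivative - (1 / (s * a s))) (at s)"
  using tailI_has_derivative[of a s] a_pos I_finite a_cont by auto

lemma A_pos: "A > 0"
  using aI_le[of 1] mult_pos_pos[OF a_pos[of 1] I_pos[of 1]] by simp

lemma H_eq: "s > 0 \<Longrightarrow> H s = (\<Lambda> * I s) powr (- 1 / \<Lambda>)"
  by (simp add: Hfun_def)

lemma H_pos: "s > 0 \<Longrightarrow> H s > 0"
  using I_pos[of s] \<Lambda>_pos by (simp add: H_eq)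

lemma H_powr: "s > 0 \<Longrightarrow> H s powr r = (\<Lambda> * I s) powr (- r / \<Lambda>)"
  by (simp add: H_eq powr_powr)

lemma H_powr_\<Lambda>: "s > 0 \<Longrightarrow> H s powr \<Lambda> = 1 / (\<Lambda> * I s)"
  using I_pos[of s] \<Lambda>_pos by (simp add: H_powr powr_minus_divide)

lemma H_deriv:
  assumes s: "s > 0"
  shows "(H has_real_derivative H s powr (1 + \<Lambda>) / (s * a s)) (at s)"
proof -
  have X: "\<Lambda> * I s > 0" using I_pos[OF s] \<Lambda>_pos by simp
  have e: "(- 1 - \<Lambda>) / \<Lambda> = - (1 / \<Lambda>) - 1" using \<Lambda>_pos by (simp add: field_simps)
  have "((\<lambda>s. (\<Lambda> * I s) powr (- 1 / \<Lambda>)) has_real_derivative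
      ((- 1 / \<Lambda>) * (\<Lambda> * I s) powr (- 1 / \<Lambda> - 1)) * (\<Lambda> * - (1 / (s * a s)))) (at s)"
    by (rule DERIV_chain2[where f = "\<lambda>z. z powr (- 1 / \<Lambda>)" and g = "\<lambda>s. \<Lambda> * I s" and x = s, OF has_real_derivative_powr[OF X]])
       (auto intro!: derivative_eq_intros I_deriv[OF s])
  also have "((- 1 / \<Lambda>) * (\<Lambda> * I s) powr (- 1 / \<Lambda> - 1)) * (\<Lambda> * - (1 / (s * a s)))
      = H s powr (1 + \<Lambda>) / (s * a s)"
    using \<Lambda>_pos by (simp add: H_powr[OF s] e)
  finally show ?thesis
    by (rule has_field_derivative_transform_within_open[where S="{0<..}"]) (use s in \<open>auto simp: H_eq\<close>)
qed

text \<open>This is \<open>a \<le> H^\<Lambda>\<close> in disguise, because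
  \<open>H^\<Lambda> = 1 / (\<Lambda> I)\<close> and \<open>\<Lambda> a I < 1\<close>. In this form
  it compares the logarithmic derivative of \<open>H\<close> with that of the identity.\<close>

lemma inverse_a_le:
  assumes s: "s > 0"
  shows "1 / s \<le> H s powr \<Lambda> / (s * a s)"
proof -
  have "\<Lambda> * (a s * I s) \<le> \<Lambda> * A" using aI_le[OF s] \<Lambda>_pos by simp
  also have "\<dots> < 1" using A\<Lambda> by (simp add: mult.commute)
  finally show ?thesis
    using s a_pos[OF s] I_pos[OF s] \<Lambda>_pos by (simp add: H_powr_\<Lambda> field_simps)
qed

text \<open>The logarithmic derivative \<open>H^\<Lambda> / (s a)\<close> of \<open>H\<close> is at
  least \<open>1 / s\<close>. Hence \<open>H\<close> is at most linear near 0, and quotients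
  \<open>H / s\<close> stay bounded in the estimates at 0.\<close>

lemma H_over_id_mono:
  assumes "0 < s" "s \<le> t"
  shows "H s / s \<le> H t / t"
proof (rule DERIV_nonneg_imp_nondecreasing[OF assms(2)])
  fix x assume x: "s \<le> x" "x \<le> t"
  then have x0: "x > 0" using assms by auto
  have "((\<lambda>x. H x / x) has_real_derivative
      (H x powr (1 + \<Lambda>) / (x * a x) * x - H x * 1) / (x * x)) (at x)"
    using x0 by (auto intro!: derivative_eq_intros H_deriv)
  moreover have "H x * 1 \<le> H x powr (1 + \<Lambda>) / (x * a x) * x"
    using mult_left_mono[OF inverse_a_le[OF x0], of "H x * x"] H_pos[OF x0] x0
    by (simp add: powr_add field_simps)
  ultimately show "\<exists>y. ((\<lambda>x. H x / x) has_real_derivative y) (at x) \<and> 0 \<le> y"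
    by (intro exI conjI) auto
qed

lemma H_le_linear: "0 \<le> s \<Longrightarrow> s \<le> M \<Longrightarrow> H s \<le> H M / M * s"
  using H_over_id_mono[of s M] by (cases "s = 0") (simp_all add: Hfun_def pos_divide_le_eq)

lemma H_mono:
  assumes "0 \<le> s" "s \<le> M"
  shows "H s \<le> H M"
proof (cases "s = 0")
  case True
  then show ?thesis using H_pos[of M] assms by (cases "M = 0") (auto simp: Hfun_def)
next
  case False
  then have "H s \<le> H M / M * s" using assms by (intro H_le_linear)
  also have "\<dots> \<le> H M / M * M"
    using False assms H_pos[of M] by (intro mult_left_mono) auto
  finally show ?thesis using False assms by simp
qed

lemma H_0: "H 0 = 0" by (simp add: Hfun_def)

lemma H_nonneg: "s \<ge> 0 \<Longrightarrow> H s \<ge> 0"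
  using H_pos[of s] by (cases "s = 0") (auto simp: H_0)

lemma H_continuous_on: "continuous_on {0..M} H"
  unfolding continuous_on
proof
  fix s assume s: "s \<in> {0..M}"
  show "(H \<longlongrightarrow> H s) (at s within {0..M})"
  proof (cases "s = 0")
    case True
    have ev: "\<forall>\<^sub>F t in at 0 within {0..M}. t \<in> {0..M}"
      by (simp add: eventually_at_filter)
    have "((\<lambda>s. H M / M * s) \<longlongrightarrow> H M / M * 0) (at 0 within {0..M})"
      by (intro tendsto_mult tendsto_const tendsto_ident_at)
    then have "(H \<longlongrightarrow> 0) (at 0 within {0..M})"
      by (rule tendsto_0_le[where K = 1, OF tendsto_eq_rhs])
        (use ev H_nonneg H_le_linear[of _ M] in
          \<open>auto elim!: eventually_mono simp: abs_mult simp flip: times_divide_eq_left\<close>)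
    then show ?thesis using True by (simp add: H_0)
  next
    case False
    then have "isCont H s" using s H_deriv[of s] by (auto dest: DERIV_isCont)
    then show ?thesis by (auto simp: isCont_def intro: tendsto_within_subset)
  qed
qed

lemma F_0: "F 0 = 0" by (simp add: Ffun_def)

text \<open>Logarithmic differentiation of \<open>H^(1+\<Lambda>) / s\<close>: the power contributes
  \<open>(1 + \<Lambda>) H^\<Lambda> / (s a) = (1 + 1/\<Lambda>) / (s a I)\<close>, the factor
  \<open>1 / s\<close> contributes \<open>- 1 / s\<close>.\<close>

lemma F_deriv:
  assumes s: "s > 0"
  shows "(F has_real_derivative F s / s * ((1 + 1 / \<Lambda>) / (a s * I s) - 1)) (at s)"
proof -
  have "((\<lambda>s. 1 / s * H s powr (\<Lambda> + 1)) has_real_derivative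
     (- 1 / (s * s)) * H s powr (\<Lambda> + 1) + (((\<Lambda> + 1) * H s powr (\<Lambda> + 1 - 1)) * (H s powr (1 + \<Lambda>) / (s * a s))) * (1 / s)) (at s)"
    using s by (intro DERIV_mult DERIV_chain2[where f = "\<lambda>z. z powr (\<Lambda> + 1)" and g = H and x = s,
        OF has_real_derivative_powr[OF H_pos[OF s]] H_deriv[OF s]])
      (auto intro!: derivative_eq_intros simp: power2_eq_square)
  also have "(- 1 / (s * s)) * H s powr (\<Lambda> + 1) + (((\<Lambda> + 1) * H s powr (\<Lambda> + 1 - 1)) * (H s powr (1 + \<Lambda>) / (s * a s))) * (1 / s)
     = F s / s * ((1 + 1 / \<Lambda>) / (a s * I s) - 1)"
    using s a_pos[OF s] I_pos[OF s] \<Lambda>_pos unfolding Ffun_def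
    by (simp add: H_powr_\<Lambda> add.commute[of \<Lambda> 1]) (simp add: field_simps)
  finally show ?thesis
    by (rule has_field_derivative_transform_within_open[where S="{0<..}"]) (use s in \<open>auto simp: Ffun_def\<close>)
qed

lemma F_pos: "s > 0 \<Longrightarrow> F s > 0"
  using H_pos[of s] by (simp add: Ffun_def)

lemma deriv_F: "s > 0 \<Longrightarrow> deriv F s = F s / s * ((1 + 1 / \<Lambda>) / (a s * I s) - 1)"
  using F_deriv[of s] by (rule DERIV_imp_deriv)

text \<open>Since \<open>a I < 1 / \<Lambda>\<close>, the share
  \<open>(1 / \<Lambda>) / (a I)\<close> of the first term exceeds 1 and pays for the negative term;
  the share \<open>1 / (a I)\<close> is what survives.\<close>

lemma deriv_F_ge:
  assumes s: "s > 0"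
  shows "deriv F s \<ge> F s / (s * (a s * I s))"
proof -
  have p: "a s * I s > 0" using a_pos[OF s] I_pos[OF s] by simp
  have "a s * I s < 1 / \<Lambda>"
  proof -
    have "(a s * I s) * \<Lambda> \<le> A * \<Lambda>" using aI_le[OF s] \<Lambda>_pos by (intro mult_right_mono) auto
    also have "\<dots> < 1" by (rule A\<Lambda>)
    finally show ?thesis using \<Lambda>_pos by (simp add: pos_less_divide_eq)
  qed
  then have "(1 + 1 / \<Lambda>) / (a s * I s) - 1 \<ge> 1 / (a s * I s)"
    using p by (simp add: field_simps)
  then have "F s / s * ((1 + 1 / \<Lambda>) / (a s * I s) - 1) \<ge> F s / s * (1 / (a s * I s))"
    using F_pos[OF s] s by (intro mult_left_mono) auto
  then show ?thesis using s by (simp add: deriv_F)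
qed

lemma continuous_on_deriv_F: "continuous_on {0<..} (deriv F)"
proof -
  have "continuous_on {0<..} F" "continuous_on {0<..} I"
    using F_deriv I_deriv by (auto intro!: continuous_at_imp_continuous_on dest: DERIV_isCont)
  moreover have "continuous_on {0<..} a" by (rule continuous_on_subset[OF a_cont]) auto
  ultimately have "continuous_on {0<..} (\<lambda>s. F s / s * ((1 + 1 / \<Lambda>) / (a s * I s) - 1))"
    using I_pos a_pos by (intro continuous_intros) (simp_all add: less_imp_neq[symmetric])
  then show ?thesis by (rule continuous_on_eq) (simp add: deriv_F)
qed

text \<open>By \<open>deriv_F_ge\<close>, \<open>F^2 / F'\<close> is at most
  \<open>a I * s F\<close>, and \<open>s F = H^(1+\<Lambda>)\<close>. This is the remainder left
  when the mixed term of the diffusion is absorbed by Young's inequality.\<close>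

lemma F_sq_le:
  assumes s: "s > 0"
  shows "(F s)\<^sup>2 \<le> A * H s powr (1 + \<Lambda>) * deriv F s"
proof -
  have p: "a s * I s > 0" using a_pos[OF s] I_pos[OF s] by simp
  have "(F s)\<^sup>2 = (a s * I s) * H s powr (1 + \<Lambda>) * (F s / (s * (a s * I s)))"
    using s a_pos[OF s] I_pos[OF s] by (simp add: Ffun_def power2_eq_square add.commute field_simps)
  also have "\<dots> \<le> A * H s powr (1 + \<Lambda>) * deriv F s"
    using aI_le[OF s] deriv_F_ge[OF s] F_pos[OF s] s p A_pos by (intro mult_mono) auto
  finally show ?thesis .
qed

lemma a_ge_powr:
  assumes M: "M > 0"
  obtains c0 where "c0 > 0" "\<And>s. 0 < s \<Longrightarrow> s \<le> M \<Longrightarrow> a s \<ge> c0 * H s powr (\<Lambda> * \<mu>)"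
proof
  \<comment> \<open>A fixed comparison point beyond \<open>M\<close> keeps the inequality
    \<open>s < v\<close> strict up to \<open>s = M\<close>. The factor \<open>I^(-\<mu>)\<close>
    becomes \<open>\<Lambda>^\<mu> H^(\<Lambda>\<mu>)\<close>, whence the constant below.\<close>
  let ?v = "M + 1"
  let ?k = "c * (a ?v * I ?v powr \<mu>) * \<Lambda> powr \<mu>"
  show "?k > 0" using c_pos a_pos[of ?v] I_pos[of ?v] M \<Lambda>_pos by auto
  fix s assume s: "0 < s" "s \<le> M"
  have e: "H s powr (\<Lambda> * \<mu>) = 1 / (\<Lambda> powr \<mu> * I s powr \<mu>)"
    using s I_pos[OF s(1)] \<Lambda>_pos by (simp add: H_powr powr_minus_divide powr_mult)
  have "a s * I s powr \<mu> \<ge> c * (a ?v * I ?v powr \<mu>)" using almost_decreasing[of s ?v] s by auto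
  then show "a s \<ge> ?k * H s powr (\<Lambda> * \<mu>)"
    unfolding e using I_pos[OF s(1)] \<Lambda>_pos by (simp add: field_simps)
qed

end

text \<open>The properties of the nonlinearities on a bounded range \<open>[0, M]\<close> that the
  energy and iteration arguments use, with \<open>a\<close> and \<open>I\<close> eliminated.
  \<open>W1\<close> is the derivative of \<open>H^p\<close> including the endpoint 0, so that the
  chain rule remains available where the solution vanishes.\<close>

locale entropy_structure =
  fixes H F W1 :: "real \<Rightarrow> real" and M \<Lambda> p C1 C2 :: real
  assumes M_pos: "M > 0" and \<Lambda>_pos: "\<Lambda> > 0" and p_ge: "p > 1 + \<Lambda>"
    and H_0: "H 0 = 0" and H_pos: "0 < s \<Longrightarrow> s \<le> M \<Longrightarrow> H s > 0"
    and H_continuous: "continuous_on {0..M} H"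
    and F_0: "F 0 = 0"
    and F'_nonneg: "0 < s \<Longrightarrow> s \<le> M \<Longrightarrow> deriv F s \<ge> 0"
    and F'_continuous: "continuous_on {0<..M} (deriv F)"
    and C1_pos: "C1 > 0" and C2_pos: "C2 > 0"
    and F_sq_le: "0 < s \<Longrightarrow> s \<le> M \<Longrightarrow> (F s)\<^sup>2 \<le> C1 * H s powr (1 + \<Lambda>) * deriv F s"
    and W1_0: "W1 0 = 0"
    and W1_continuous: "continuous_on {0..M} W1"
    and W_deriv: "0 \<le> s \<Longrightarrow> s \<le> M \<Longrightarrow>
          ((\<lambda>s. H s powr p) has_real_derivative W1 s) (at s within {0..M})"
    and W1_sq_le: "0 < s \<Longrightarrow> s \<le> M \<Longrightarrow> (W1 s)\<^sup>2 \<le> C2 * deriv F s"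

context degenerate_coefficient
begin

lemma entropy_structure_exists:
  assumes M: "M > 0"
  obtains W1 p C2 where "entropy_structure H F W1 M \<Lambda> p A C2"
proof -
  define q where "q = \<Lambda> * \<mu>"
  have q: "q > 0" using \<Lambda>_pos \<mu>_pos by (simp add: q_def)
  obtain c0 where c0: "c0 > 0" and age: "\<And>s. 0 < s \<Longrightarrow> s \<le> M \<Longrightarrow> a s \<ge> c0 * H s powr q"
    using a_ge_powr[OF M] unfolding q_def by auto
  \<comment> \<open>With \<open>1 / a \<le> H^(-q) / c0\<close>, the derivative \<open>W1\<close> is
    at most a multiple of \<open>H^(p+\<Lambda>-q) / s\<close>. This choice turns the numerator into
    \<open>H * H^(2\<Lambda>)\<close>; as \<open>H / s\<close> is bounded, \<open>W1\<close> tends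
    to 0 at 0.\<close>
  define p where "p = 1 + q + \<Lambda>"
  have p: "p > 0" using q \<Lambda>_pos by (simp add: p_def)
  define W1 where "W1 s = (if s = 0 then 0 else p * H s powr (p - 1) * (H s powr (1 + \<Lambda>) / (s * a s)))" for s
  \<comment> \<open>The quotient of the bound for \<open>W1^2\<close> by the lower bound
    \<open>\<Lambda> H^(1+2\<Lambda>) / (s^2 a)\<close> of \<open>F'\<close>. The remaining exponent
    \<open>2 p - 1 - q = 1 + q + 2 \<Lambda>\<close> is positive, so the power of \<open>H\<close>
    is largest at \<open>M\<close>.\<close>
  define C2 where "C2 = p\<^sup>2 / (\<Lambda> * c0) * H M powr (2 * p - 1 - q)"
  have inv_a: "1 / a s \<le> H s powr (- q) / c0" if "0 < s" "s \<le> M" for s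
    using age[OF that] a_pos[of s] that c0 H_pos[of s] by (simp add: powr_minus field_simps)
  have W_der: "((\<lambda>s. H s powr p) has_real_derivative W1 s) (at s)" if s: "s > 0" for s
    using DERIV_chain2[where f = "\<lambda>z. z powr p" and g = H and x = s,
        OF has_real_derivative_powr[OF H_pos[OF s]] H_deriv[OF s]] s
    by (simp add: W1_def)
  have W1_nn: "W1 s \<ge> 0" if "s \<ge> 0" for s
    using a_pos[of s] that p unfolding W1_def by auto
  have W1_le: "W1 s \<le> p / c0 * (H M / M) * H s powr (2 * \<Lambda>)" if s: "0 \<le> s" "s \<le> M" for s
  proof (cases "s = 0")
    case False
    with s have s0: "s > 0" by simp
    have "W1 s = p * H s powr (p + \<Lambda>) / s * (1 / a s)"
      using s0 by (simp add: W1_def powr_add[symmetric] field_simps)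
    also have "\<dots> \<le> p * H s powr (p + \<Lambda>) / s * (H s powr (- q) / c0)"
      using inv_a[OF s0 s(2)] p s0 by (intro mult_left_mono) auto
    also have "\<dots> = p / c0 * (H s / s) * H s powr (2 * \<Lambda>)"
    proof -
      have "H s powr (p + \<Lambda>) * H s powr (- q) = H s powr (1 + 2 * \<Lambda>)"
        by (simp add: powr_add[symmetric] p_def add.commute)
      also have "\<dots> = H s * H s powr (2 * \<Lambda>)"
        using H_pos[OF s0] by (simp add: powr_add)
      finally have "H s powr (p + \<Lambda>) * H s powr (- q) = H s * H s powr (2 * \<Lambda>)" .
      then show ?thesis by (simp add: field_simps)
    qed
    also have "\<dots> \<le> p / c0 * (H M / M) * H s powr (2 * \<Lambda>)"
      using H_over_id_mono[OF s0 s(2)] p c0 by (intro mult_right_mono mult_left_mono) auto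
    finally show ?thesis .
  qed (use \<Lambda>_pos H_0 in \<open>simp add: W1_def\<close>)
  have ev: "\<forall>\<^sub>F t in at 0 within {0..M}. t \<in> {0..M}" "\<forall>\<^sub>F t in at 0 within {0..M}. 0 < t \<and> t \<le> M"
    by (auto simp: eventually_at_filter)
  have Hpow0: "((\<lambda>s. H s powr r) \<longlongrightarrow> 0) (at 0 within {0..M})" if "r > 0" for r
  proof -
    have "(H \<longlongrightarrow> H 0) (at 0 within {0..M})"
      using H_continuous_on[of M] M by (auto simp: continuous_on)
    then have "((\<lambda>s. H s powr r) \<longlongrightarrow> H 0 powr r) (at 0 within {0..M})"
      using that ev(1) by (intro tendsto_powr2 tendsto_const) (auto simp: H_0 H_nonneg elim!: eventually_mono)
    then show ?thesis using that by (simp add: H_0)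
  qed
  show ?thesis
  proof (rule that, unfold_locales)
    show "continuous_on {0..M} W1"
      unfolding continuous_on
    proof
      fix s assume s: "s \<in> {0..M}"
      show "(W1 \<longlongrightarrow> W1 s) (at s within {0..M})"
      proof (cases "s = 0")
        case True
        have "((\<lambda>s. p / c0 * (H M / M) * H s powr (2 * \<Lambda>)) \<longlongrightarrow> p / c0 * (H M / M) * 0) (at 0 within {0..M})"
          by (rule tendsto_mult[OF tendsto_const Hpow0]) (simp add: \<Lambda>_pos)
        then have lim: "((\<lambda>s. p / c0 * (H M / M) * H s powr (2 * \<Lambda>)) \<longlongrightarrow> 0) (at 0 within {0..M})"
          by simp
        have "(W1 \<longlongrightarrow> 0) (at 0 within {0..M})"
          by (rule tendsto_sandwich[OF eventually_mono[OF ev(1)] eventually_mono[OF ev(1)] tendsto_const lim])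
            (simp_all add: W1_nn W1_le del: times_divide_eq_left times_divide_eq_right)
        then show ?thesis using True by (simp add: W1_def)
      next
        case False
        with s have s0: "s > 0" by simp
        have "(a \<longlongrightarrow> a s) (at s within {0..M})"
          using a_cont s by (auto simp: continuous_on intro: tendsto_within_subset)
        moreover have "(H \<longlongrightarrow> H s) (at s within {0..M})"
          using H_continuous_on[of M] s by (auto simp: continuous_on)
        ultimately have "((\<lambda>s. p * H s powr (p - 1) * (H s powr (1 + \<Lambda>) / (s * a s))) \<longlongrightarrow> W1 s) (at s within {0..M})"
          using H_pos[OF s0] a_pos[OF s0] s0 unfolding W1_def
          by (auto intro!: tendsto_eq_intros)
        moreover
        have "eventually (\<lambda>t. t > 0) (at s within {0..M})"
          using s0 by (auto simp: eventually_at intro!: exI[of _ s] simp: dist_real_def)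
        then have "\<forall>\<^sub>F s in at s within {0..M}. p * H s powr (p - 1) * (H s powr (1 + \<Lambda>) / (s * a s)) = W1 s"
          by eventually_elim (simp add: W1_def)
        ultimately show ?thesis
          by (blast intro: Lim_transform_eventually)
      qed
    qed
  next
    fix s :: real assume s: "0 \<le> s" "s \<le> M"
    show "((\<lambda>s. H s powr p) has_real_derivative W1 s) (at s within {0..M})"
    proof (cases "s = 0")
      case True
      \<comment> \<open>At 0 the difference quotient of \<open>H^p\<close> is
        \<open>(H / s) H^(p-1)\<close>: a bounded factor times a positive power of
        \<open>H\<close>.\<close>
      have "((\<lambda>s. H M / M * H s powr (p - 1)) \<longlongrightarrow> H M / M * 0) (at 0 within {0..M})"
        by (rule tendsto_mult[OF tendsto_const Hpow0]) (use q \<Lambda>_pos in \<open>simp add: p_def\<close>)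
      then have lim: "((\<lambda>s. H M / M * H s powr (p - 1)) \<longlongrightarrow> 0) (at 0 within {0..M})" by simp
      have le: "H x powr p / x \<le> H M / M * H x powr (p - 1)" if "0 < x \<and> x \<le> M" for x
      proof -
        have "H x powr p / x = H x / x * H x powr (p - 1)"
          using H_pos[of x] that by (simp add: powr_diff)
        also have "\<dots> \<le> H M / M * H x powr (p - 1)"
          using H_over_id_mono[of x M] that by (intro mult_right_mono) auto
        finally show ?thesis .
      qed
      have "((\<lambda>s. H s powr p / s) \<longlongrightarrow> 0) (at 0 within {0..M})"
        by (rule tendsto_sandwich[OF eventually_mono[OF ev(2)] eventually_mono[OF ev(2)] tendsto_const lim])
          (use le in \<open>simp_all del: times_divide_eq_left times_divide_eq_right\<close>)
      then show ?thesis using True p by (simp add: has_field_derivative_iff H_0 W1_def)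
    next
      case False
      then show ?thesis using W_der[of s] s by (auto intro: has_field_derivative_at_within)
    qed
  next
    fix s :: real assume s: "0 < s" "s \<le> M"
    have e1: "H s powr (2 * p + 2 * \<Lambda>) = (H s powr (p - 1))\<^sup>2 * (H s powr (1 + \<Lambda>))\<^sup>2"
      by (simp add: power2_eq_square powr_add[symmetric])
    have "(W1 s)\<^sup>2 = p\<^sup>2 * H s powr (2 * p + 2 * \<Lambda>) / (s\<^sup>2 * a s) * (1 / a s)"
      using s unfolding W1_def e1 by (simp add: power2_eq_square field_simps)
    also have "\<dots> \<le> p\<^sup>2 * H s powr (2 * p + 2 * \<Lambda>) / (s\<^sup>2 * a s) * (H s powr (- q) / c0)"
      using inv_a[OF s] s a_pos[of s] by (intro mult_left_mono) auto
    also have "\<dots> = (p\<^sup>2 / (\<Lambda> * c0) * H s powr (2 * p - 1 - q)) * (\<Lambda> * H s powr (1 + 2 * \<Lambda>) / (s\<^sup>2 * a s))"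
    proof -
      have "H s powr (2 * p + 2 * \<Lambda>) * H s powr (- q) = H s powr (2 * p - 1 - q) * H s powr (1 + 2 * \<Lambda>)"
        by (simp add: powr_add[symmetric] algebra_simps)
      then show ?thesis using \<Lambda>_pos by (simp add: field_simps)
    qed
    also have "\<dots> \<le> C2 * (\<Lambda> * H s powr (1 + 2 * \<Lambda>) / (s\<^sup>2 * a s))"
      unfolding C2_def using H_mono[of s M] s c0 \<Lambda>_pos p q a_pos[of s] H_pos[of s]
      by (intro mult_right_mono mult_left_mono powr_mono2) (auto simp: p_def)
    also have "\<Lambda> * H s powr (1 + 2 * \<Lambda>) / (s\<^sup>2 * a s) = F s / (s * (a s * I s))"
    proof -
      have "H s powr (1 + 2 * \<Lambda>) = H s powr (1 + \<Lambda>) * H s powr \<Lambda>"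
        by (simp add: powr_add[symmetric] add.commute)
      then show ?thesis
        using s \<Lambda>_pos by (simp add: Ffun_def H_powr_\<Lambda> power2_eq_square add.commute)
    qed
    also have "C2 * \<dots> \<le> C2 * deriv F s"
      using deriv_F_ge[of s] s c0 \<Lambda>_pos by (intro mult_left_mono) (auto simp: C2_def)
    finally show "(W1 s)\<^sup>2 \<le> C2 * deriv F s" .
  next
    show "C2 > 0" using c0 \<Lambda>_pos p H_pos[OF M] by (simp add: C2_def)
  next
    fix s :: real assume s: "0 < s" "s \<le> M"
    have "0 \<le> F s / (s * (a s * I s))" using s F_pos[of s] a_pos[of s] I_pos[of s] by simp
    then show "0 \<le> deriv F s" using deriv_F_ge[of s] s by linarith
  next
    show "p > 1 + \<Lambda>" using q by (simp add: p_def)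
  next
    show "continuous_on {0<..M} (deriv F)"
      by (rule continuous_on_subset[OF continuous_on_deriv_F]) auto
  qed (use M \<Lambda>_pos H_0 H_pos F_0 A_pos F_sq_le H_continuous_on in \<open>auto simp: W1_def\<close>)
qed

end

section \<open>Translations and the chain rule for weak derivatives\<close>

lemma nn_integral_lborel_translate:
  fixes f :: "'a::euclidean_space \<Rightarrow> ennreal"
  assumes "f \<in> borel_measurable borel"
  shows "(\<integral>\<^sup>+z. f (z + c) \<partial>lborel) = (\<integral>\<^sup>+z. f z \<partial>lborel)"
proof -
  have "(\<integral>\<^sup>+z. f z \<partial>lborel) = (\<integral>\<^sup>+z. f z \<partial>distr lborel borel ((+) c))"
    by (simp add: lborel_distr_plus)
  also have "\<dots> = (\<integral>\<^sup>+z. f (z + c) \<partial>lborel)"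
    using assms by (subst nn_integral_distr) (simp_all add: add.commute)
  finally show ?thesis by simp
qed

lemma integral_lborel_translate:
  fixes f :: "'a::euclidean_space \<Rightarrow> 'b::{banach, second_countable_topology}"
  assumes "f \<in> borel_measurable borel"
  shows "(\<integral>z. f (z + c) \<partial>lborel) = (\<integral>z. f z \<partial>lborel)"
proof -
  have "(\<integral>z. f z \<partial>lborel) = (\<integral>z. f z \<partial>distr lborel borel ((+) c))"
    by (simp add: lborel_distr_plus)
  also have "\<dots> = (\<integral>z. f (z + c) \<partial>lborel)"
    using assms by (subst integral_distr) (simp_all add: add.commute)
  finally show ?thesis by simp
qed

lemma integrable_lborel_translate:
  fixes f :: "'a::euclidean_space \<Rightarrow> 'b::{banach, second_countable_topology}"
  assumes "integrable lborel f"
  shows "integrable lborel (\<lambda>z. f (z + c))"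
proof -
  have "integrable (distr lborel borel ((+) c)) f" using assms by (simp add: lborel_distr_plus)
  then show ?thesis
    using integrable_distr[of "(+) c" lborel borel f] by (simp add: add.commute)
qed

section \<open>Continuously differentiable test functions and their separating property\<close>

definition C1_derivative :: "('a::real_normed_vector \<Rightarrow> real) \<Rightarrow> ('a \<Rightarrow> 'a \<Rightarrow>\<^sub>L real) \<Rightarrow> bool" where
  "C1_derivative f f' \<longleftrightarrow> (\<forall>z. (f has_derivative blinfun_apply (f' z)) (at z)) \<and> continuous_on UNIV f'"

lemma C1_derivative_continuous: "C1_derivative f f' \<Longrightarrow> continuous_on S f"
  unfolding C1_derivative_def
  by (meson continuous_at_imp_continuous_on has_derivative_continuous)

lemma C1_derivative_compose:
  fixes g g' :: "real \<Rightarrow> real"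
  assumes f: "C1_derivative f f'" and g: "\<And>y. (g has_real_derivative g' y) (at y)"
    and g': "continuous_on UNIV g'"
  shows "C1_derivative (\<lambda>z. g (f z)) (\<lambda>z. g' (f z) *\<^sub>R f' z)"
  unfolding C1_derivative_def
proof (intro conjI allI)
  fix z
  have "((\<lambda>z. g (f z)) has_derivative (\<lambda>h. g' (f z) * blinfun_apply (f' z) h)) (at z)"
    using f g[of "f z"] unfolding C1_derivative_def has_field_derivative_def
    by (intro has_derivative_compose[where f = f and g = g and s = UNIV, simplified]) auto
  then show "((\<lambda>z. g (f z)) has_derivative blinfun_apply (g' (f z) *\<^sub>R f' z)) (at z)"
    by (simp add: scaleR_blinfun.rep_eq)
  have "continuous_on UNIV (\<lambda>z. g' (f z))"
    using continuous_on_compose2[OF g' C1_derivative_continuous[OF f]] by auto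
  then show "continuous_on UNIV (\<lambda>z. g' (f z) *\<^sub>R f' z)"
    using f by (auto simp: C1_derivative_def intro!: continuous_intros)
qed

lemma C1_derivative_mult:
  assumes f: "C1_derivative f f'" and g: "C1_derivative g g'"
  shows "C1_derivative (\<lambda>z. f z * g z) (\<lambda>z. f z *\<^sub>R g' z + g z *\<^sub>R f' z)"
  unfolding C1_derivative_def
proof (intro conjI allI)
  fix z
  show "((\<lambda>z. f z * g z) has_derivative blinfun_apply (f z *\<^sub>R g' z + g z *\<^sub>R f' z)) (at z)"
    using has_derivative_mult[of f "blinfun_apply (f' z)" z UNIV g "blinfun_apply (g' z)"] f g
    by (simp add: C1_derivative_def scaleR_blinfun.rep_eq plus_blinfun.rep_eq mult.commute)
  show "continuous_on UNIV (\<lambda>z. f z *\<^sub>R g' z + g z *\<^sub>R f' z)"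
    using C1_derivative_continuous[OF f] C1_derivative_continuous[OF g] f g
    by (auto simp: C1_derivative_def intro!: continuous_intros)
qed

lemma C1_derivative_prod:
  assumes "finite I" "\<And>i. i \<in> I \<Longrightarrow> \<exists>f'. C1_derivative (f i) f'"
  shows "\<exists>f'. C1_derivative (\<lambda>z. \<Prod>i\<in>I. f i z) f'"
  using assms
proof (induction I)
  case empty
  then show ?case
    by (intro exI[of _ "\<lambda>_. 0"]) (simp add: C1_derivative_def zero_blinfun.rep_eq)
next
  case (insert i I)
  then obtain f' g' where "C1_derivative (f i) f'" "C1_derivative (\<lambda>z. \<Prod>i\<in>I. f i z) g'"
    by blast
  from C1_derivative_mult[OF this] show ?case using insert.hyps by auto
qed

lemma C1_derivative_inner: "C1_derivative (\<lambda>z. z \<bullet> b) (\<lambda>_. blinfun_inner_left b)"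
  by (auto simp: C1_derivative_def intro!: derivative_eq_intros)

text \<open>Squaring removes the kink of the positive part. The fact serves the box bumps here and
  later the squared parabolic cutoff.\<close>

lemma has_real_derivative_pos_part_sq:
  "((\<lambda>y. (max 0 y)\<^sup>2) has_real_derivative 2 * max 0 y) (at (y::real))"
proof -
  consider "y > 0" | "y < 0" | "y = 0" by linarith
  then show ?thesis
  proof cases
    case 1
    have "((\<lambda>y. y\<^sup>2) has_real_derivative 2 * max 0 y) (at y)"
      using 1 by (auto intro!: derivative_eq_intros)
    then show ?thesis
      by (rule has_field_derivative_transform_within_open[where S = "{0<..}"]) (use 1 in auto)
  next
    case 2
    have "((\<lambda>y. 0) has_real_derivative 2 * max 0 y) (at y)" using 2 by simp
    then show ?thesis
      by (rule has_field_derivative_transform_within_open[where S = "{..<0}"]) (use 2 in auto)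
  next
    case 3
    have "((\<lambda>h::real. (max 0 h)\<^sup>2 / h) \<longlongrightarrow> 0) (at 0)"
    proof (rule Lim_null_comparison)
      show "\<forall>\<^sub>F h in at 0. norm ((max 0 h)\<^sup>2 / h) \<le> \<bar>h\<bar>"
        by (auto simp: max_def power2_eq_square)
      show "((\<lambda>h::real. \<bar>h\<bar>) \<longlongrightarrow> 0) (at 0)" by (intro tendsto_eq_intros) auto
    qed
    then show ?thesis using 3 by (simp add: has_field_derivative_iff)
  qed
qed

text \<open>\<open>P\<close> is the product of the squared positive parts of the signed distances to
  all faces, hence C^1 and positive exactly inside the open box. Then \<open>1 - exp (- n P)\<close>
  vanishes off the box and tends to 1 inside it.\<close>

lemma C1_bumps_exist:
  fixes a c :: "'a::euclidean_space"
  obtains \<zeta> \<zeta>' where "\<And>n::nat. C1_derivative (\<zeta> n) (\<zeta>' n)"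
    "\<And>n z. 0 \<le> \<zeta> n z" "\<And>n z. \<zeta> n z \<le> 1" "\<And>n z. z \<notin> box a c \<Longrightarrow> \<zeta> n z = 0"
    "\<And>z. (\<lambda>n. \<zeta> n z) \<longlonglongrightarrow> indicator (box a c) z"
proof -
  define P where "P z = (\<Prod>b\<in>Basis. (max 0 (z \<bullet> b - a \<bullet> b))\<^sup>2 * (max 0 (c \<bullet> b - z \<bullet> b))\<^sup>2)" for z
  have P0: "P z \<ge> 0" for z unfolding P_def by (intro prod_nonneg) auto
  have Pout: "P z = 0" if "z \<notin> box a c" for z
    using that unfolding P_def box_def by (auto simp: not_less intro!: bexI prod_zero)
  have Pin: "P z > 0" if "z \<in> box a c" for z
    using that unfolding P_def box_def by (auto intro!: prod_pos)
  have "\<exists>P'. C1_derivative P P'"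
    unfolding P_def
  proof (rule C1_derivative_prod)
    fix b :: 'a assume "b \<in> Basis"
    have 1: "((\<lambda>y. (max 0 (y - k))\<^sup>2) has_real_derivative 2 * max 0 (y - k)) (at y)" for k y :: real
    proof -
      have "((\<lambda>y. y - k) has_real_derivative 1) (at y)" by (auto intro!: derivative_eq_intros)
      from DERIV_chain2[where f = "\<lambda>y. (max 0 y)\<^sup>2" and g = "\<lambda>y. y - k",
          OF has_real_derivative_pos_part_sq this] show ?thesis by simp
    qed
    have 2: "((\<lambda>y. (max 0 (k - y))\<^sup>2) has_real_derivative - (2 * max 0 (k - y))) (at y)" for k y :: real
    proof -
      have "((\<lambda>y. k - y) has_real_derivative -1) (at y)" by (auto intro!: derivative_eq_intros)
      from DERIV_chain2[where f = "\<lambda>y. (max 0 y)\<^sup>2" and g = "\<lambda>y. k - y",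
          OF has_real_derivative_pos_part_sq this] show ?thesis by simp
    qed
    show "\<exists>f'. C1_derivative (\<lambda>z. (max 0 (z \<bullet> b - a \<bullet> b))\<^sup>2 * (max 0 (c \<bullet> b - z \<bullet> b))\<^sup>2) f'"
      by (rule exI, rule C1_derivative_mult;
          rule C1_derivative_compose[OF C1_derivative_inner], rule 1 2; intro continuous_intros)
  qed simp
  then obtain P' where P': "C1_derivative P P'" ..
  define \<zeta> where "\<zeta> n z = 1 - exp (- real n * P z)" for n z
  show ?thesis
  proof
    show "C1_derivative (\<zeta> n) (\<lambda>z. (real n * exp (- real n * P z)) *\<^sub>R P' z)" for n
      unfolding \<zeta>_def
      by (rule C1_derivative_compose[OF P', of "\<lambda>y. 1 - exp (- real n * y)"])
        (auto intro!: derivative_eq_intros continuous_intros)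
    show "0 \<le> \<zeta> n z" "\<zeta> n z \<le> 1" "z \<notin> box a c \<Longrightarrow> \<zeta> n z = 0" for n z
      using P0[of z] by (auto simp: \<zeta>_def Pout)
    show "(\<lambda>n. \<zeta> n z) \<longlonglongrightarrow> indicator (box a c) z" for z
    proof (cases "z \<in> box a c")
      case True
      have "exp (- P z) < 1" using Pin[OF True] by simp
      then have "(\<lambda>n. exp (- P z) ^ n) \<longlonglongrightarrow> 0"
        by (intro LIMSEQ_realpow_zero) simp_all
      then have "(\<lambda>n. 1 - exp (- P z) ^ n) \<longlonglongrightarrow> 1 - 0" by (intro tendsto_diff tendsto_const)
      then show ?thesis using True by (simp add: \<zeta>_def exp_of_nat_mult[symmetric])
    qed (simp add: \<zeta>_def Pout)
  qed
qed

text \<open>The positive and the negative part of \<open>D\<close> on a box are densities of two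
  finite measures. They agree on open boxes, which generate the Borel sets and are closed under
  intersection, so they are equal. Evaluating both on the sets where \<open>D\<close> has one sign
  forces \<open>D = 0\<close> almost everywhere.\<close>

lemma AE_zero_of_integral_box_zero:
  fixes D :: "'a::euclidean_space \<Rightarrow> real"
  assumes D: "integrable lborel D" and A: "open A"
    and zero: "\<And>a c. cbox a c \<subseteq> A \<Longrightarrow> (\<integral>z. indicator (box a c) z * D z \<partial>lborel) = 0"
  shows "AE z in lborel. z \<in> A \<longrightarrow> D z = 0"
proof -
  have [measurable]: "D \<in> borel_measurable borel" using D by auto
  have box: "AE z in lborel. z \<in> box a c \<longrightarrow> D z = 0" if ac: "cbox a c \<subseteq> A" for a c :: 'a
  proof -
    let ?B = "box a c"
    define N1 where "N1 = density lborel (\<lambda>z. ennreal (indicator ?B z * max 0 (D z)))"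
    define N2 where "N2 = density lborel (\<lambda>z. ennreal (indicator ?B z * max 0 (- D z)))"
    have i1: "integrable lborel (\<lambda>z. indicator S z * max 0 (D z))"
     and i2: "integrable lborel (\<lambda>z. indicator S z * max 0 (- D z))" if "S \<in> sets borel" for S
      using that by (auto intro!: Bochner_Integration.integrable_bound[OF D] AE_I2 split: split_indicator)
    have e1: "emeasure N1 X = ennreal (\<integral>z. indicator (X \<inter> ?B) z * max 0 (D z) \<partial>lborel)"
     and e2: "emeasure N2 X = ennreal (\<integral>z. indicator (X \<inter> ?B) z * max 0 (- D z) \<partial>lborel)"
      if [measurable]: "X \<in> sets borel" for X
    proof -
      have "emeasure N1 X = (\<integral>\<^sup>+z. ennreal (indicator (X \<inter> ?B) z * max 0 (D z)) \<partial>lborel)"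
        unfolding N1_def by (subst emeasure_density) (auto intro!: nn_integral_cong split: split_indicator)
      then show "emeasure N1 X = ennreal (\<integral>z. indicator (X \<inter> ?B) z * max 0 (D z) \<partial>lborel)"
        using i1[of "X \<inter> ?B"] by (simp add: nn_integral_eq_integral)
      have "emeasure N2 X = (\<integral>\<^sup>+z. ennreal (indicator (X \<inter> ?B) z * max 0 (- D z)) \<partial>lborel)"
        unfolding N2_def by (subst emeasure_density) (auto intro!: nn_integral_cong split: split_indicator)
      then show "emeasure N2 X = ennreal (\<integral>z. indicator (X \<inter> ?B) z * max 0 (- D z) \<partial>lborel)"
        using i2[of "X \<inter> ?B"] by (simp add: nn_integral_eq_integral)
    qed
    have eqb: "emeasure N1 X = emeasure N2 X" if X: "X \<in> range (\<lambda>(a, b). box a b)" for X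
    proof -
      obtain a' c' where X': "X = box a' c'" using X by auto
      obtain a2 c2 where ac2: "X \<inter> ?B = box a2 c2" unfolding X' box_Int_box by blast
      have [measurable]: "X \<in> sets borel" by (simp add: X')
      have "(\<integral>z. indicator (X \<inter> ?B) z * max 0 (D z) \<partial>lborel) - (\<integral>z. indicator (X \<inter> ?B) z * max 0 (- D z) \<partial>lborel)
        = (\<integral>z. indicator (X \<inter> ?B) z * max 0 (D z) - indicator (X \<inter> ?B) z * max 0 (- D z) \<partial>lborel)"
        by (rule Bochner_Integration.integral_diff[symmetric]; rule i1 i2; simp)
      also have "\<dots> = (\<integral>z. indicator (X \<inter> ?B) z * D z \<partial>lborel)"
        by (intro Bochner_Integration.integral_cong) (auto simp: max_def indicator_def)
      also have "\<dots> = 0"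
      \<comment> \<open>The hypothesis asks for a closed box inside \<open>A\<close>. A nonempty
        open box contained in \<open>box a c\<close> has its closure in \<open>cbox a c\<close>; for
        the empty box the integral is trivially 0.\<close>
      proof (cases "box a2 c2 = {}")
        case False
        have "box a2 c2 \<subseteq> box a c" using ac2 by auto
        then have "cbox a2 c2 \<subseteq> cbox a c"
          using False by (metis closure_box closure_mono box_subset_cbox closed_cbox closure_minimal order_trans)
        then show ?thesis unfolding ac2 using zero ac by blast
      qed (simp add: ac2)
      finally show ?thesis by (simp add: e1 e2)
    qed
    have N: "N1 = N2"
    proof (rule measure_eqI_generator_eq[OF _ _ eqb])
      show "Int_stable (range (\<lambda>(a, b). box a b :: 'a set))"
        unfolding Int_stable_def by (auto simp: box_Int_box)
      show "range (\<lambda>n::nat. box (- (real n *\<^sub>R One)) (real n *\<^sub>R One)) \<subseteq> range (\<lambda>(a, b). box a b :: 'a set)" by auto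
      show "(\<Union>n::nat. box (- (real n *\<^sub>R One)) (real n *\<^sub>R One)) = (UNIV :: 'a set)"
        by (rule UN_box_eq_UNIV)
      show "emeasure N1 (box (- (real i *\<^sub>R One)) (real i *\<^sub>R One)) \<noteq> \<infinity>" for i
        by (simp add: e1)
      show "sets N1 = sigma_sets UNIV (range (\<lambda>(a, b). box a b))"
        "sets N2 = sigma_sets UNIV (range (\<lambda>(a, b). box a b))"
        unfolding N1_def N2_def by (simp_all add: borel_eq_box)
    qed auto
    have n0: "AE z in lborel. indicator (S \<inter> ?B) z * max 0 (s * D z) = 0"
      if S: "S = {z. s * D z > 0}" "s = 1 \<or> s = -1" for S s
    proof -
      have [measurable]: "S \<in> sets borel" unfolding S by measurable
      have "(\<integral>z. indicator (S \<inter> ?B) z * max 0 (s * D z) \<partial>lborel) = (\<integral>z. indicator (S \<inter> ?B) z * max 0 (- s * D z) \<partial>lborel)"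
        using arg_cong[OF N, of "\<lambda>N. emeasure N S"] S(2)
        by (auto simp: e1 e2 integral_nonneg_AE)
      also have "\<dots> = (\<integral>z. 0 \<partial>(lborel :: 'a measure))"
        by (intro Bochner_Integration.integral_cong) (auto simp: S indicator_def)
      finally have z: "(\<integral>z. indicator (S \<inter> ?B) z * max 0 (s * D z) \<partial>lborel) = 0" by simp
      have "integrable lborel (\<lambda>z. indicator (S \<inter> ?B) z * max 0 (s * D z))"
        using S(2) i1[of "S \<inter> ?B"] i2[of "S \<inter> ?B"] by auto
      from integral_nonneg_eq_0_iff_AE[OF this] z show ?thesis by auto
    qed
    show ?thesis
      using n0[of "{z. 1 * D z > 0}" 1, OF refl disjI1[OF refl]]
        n0[of "{z. -1 * D z > 0}" "-1", OF refl disjI2[OF refl]]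
      by eventually_elim (auto simp: indicator_def max_def split: if_splits)
  qed
  \<comment> \<open>Countably many closed boxes fill \<open>A\<close>, and their faces are null
    sets, so the statement for open boxes suffices.\<close>
  obtain \<D> where \<D>: "countable \<D>" "\<D> \<subseteq> Pow A" "\<And>X. X \<in> \<D> \<Longrightarrow> \<exists>a b. X = cbox a b" "\<Union>\<D> = A"
    using open_countable_Union_open_cbox[OF A] by auto
  have "AE z in lborel. z \<in> X \<longrightarrow> D z = 0" if X: "X \<in> \<D>" for X
  proof -
    obtain a c where ac: "X = cbox a c" using \<D>(3)[OF X] by auto
    have "AE z in lborel. z \<notin> cbox a c - box a c"
      by (rule AE_not_in) (simp add: null_sets_def emeasure_Diff emeasure_lborel_box_eq emeasure_lborel_cbox_eq box_subset_cbox)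
    moreover have "AE z in lborel. z \<in> box a c \<longrightarrow> D z = 0" using box \<D>(2) X ac by blast
    ultimately show ?thesis unfolding ac by eventually_elim auto
  qed
  then have "AE z in lborel. \<forall>X\<in>\<D>. z \<in> X \<longrightarrow> D z = 0"
    using \<D>(1) by (intro AE_ball_countable[THEN iffD2] ballI)
  then show ?thesis by eventually_elim (use \<D>(4) in auto)
qed

text \<open>Along \<open>V\<close> the average is a primitive of a finite difference. Inserted as a
  test function, it makes a weak derivative in direction \<open>V\<close> produce the increment over
  the whole segment.\<close>

lemma C1_derivative_segment_average:
  fixes V :: "'a::euclidean_space"
  assumes \<zeta>: "C1_derivative \<zeta> \<zeta>'"
  obtains \<phi>' where "C1_derivative (\<lambda>z. integral {0..1} (\<lambda>\<tau>. \<zeta> (z - \<tau> *\<^sub>R V))) \<phi>'"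
    "\<And>z. \<phi>' z V = \<zeta> z - \<zeta> (z - V)"
proof -
  define \<phi>' where "\<phi>' z = integral {0..1} (\<lambda>\<tau>. \<zeta>' (z - \<tau> *\<^sub>R V))" for z
  have d: "(\<zeta> has_derivative blinfun_apply (\<zeta>' z)) (at z)" for z
    using \<zeta> by (simp add: C1_derivative_def)
  have \<zeta>'c: "continuous_on S \<zeta>'" for S
    using \<zeta> continuous_on_subset by (auto simp: C1_derivative_def)
  have c1: "continuous_on S (\<lambda>x. \<zeta> (g x))" if "continuous_on S g" for S and g :: "'c::topological_space \<Rightarrow> 'a"
    by (rule continuous_on_compose2[OF C1_derivative_continuous[OF \<zeta>, of UNIV] that]) auto
  have c2: "continuous_on S (\<lambda>x. \<zeta>' (g x))" if "continuous_on S g" for S and g :: "'c::topological_space \<Rightarrow> 'a"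
    by (rule continuous_on_compose2[OF \<zeta>'c[of UNIV] that]) auto
  have "((\<lambda>z. integral (cbox 0 1) (\<lambda>\<tau>. \<zeta> (z - \<tau> *\<^sub>R V))) has_derivative
      integral (cbox 0 1) (\<lambda>\<tau>. \<zeta>' (z - \<tau> *\<^sub>R V))) (at z within UNIV)" for z
  proof (rule leibniz_rule)
    fix x and t :: real
    have "((\<lambda>z. z - t *\<^sub>R V) has_derivative (\<lambda>h. h)) (at x)" by (auto intro!: derivative_eq_intros)
    from has_derivative_compose[OF this d[of "x - t *\<^sub>R V"]]
    show "((\<lambda>z. \<zeta> (z - t *\<^sub>R V)) has_derivative blinfun_apply (\<zeta>' (x - t *\<^sub>R V))) (at x within UNIV)" by simp
    show "(\<lambda>\<tau>::real. \<zeta> (x - \<tau> *\<^sub>R V)) integrable_on cbox 0 1"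
      by (intro integrable_continuous c1 continuous_intros)
    show "continuous_on (UNIV \<times> cbox 0 (1::real)) (\<lambda>(x, t). \<zeta>' (x - t *\<^sub>R V))"
      unfolding split_beta by (intro c2 continuous_intros)
  qed auto
  moreover have "continuous_on UNIV (\<lambda>z. integral (cbox 0 (1::real)) (\<lambda>\<tau>. \<zeta>' (z - \<tau> *\<^sub>R V)))"
    by (rule integral_continuous_on_param) (unfold split_beta, intro c2 continuous_intros)
  ultimately have 1: "C1_derivative (\<lambda>z. integral {0..1} (\<lambda>\<tau>. \<zeta> (z - \<tau> *\<^sub>R V))) \<phi>'"
    unfolding C1_derivative_def \<phi>'_def by simp
  have 2: "\<phi>' z V = \<zeta> z - \<zeta> (z - V)" for z
  proof -
    have "((\<lambda>\<tau>. - \<zeta> (z - \<tau> *\<^sub>R V)) has_vector_derivative \<zeta>' (z - t *\<^sub>R V) V) (at t within {0..1})" for t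
    proof -
      have "((\<lambda>\<tau>. z - \<tau> *\<^sub>R V) has_derivative (\<lambda>h. - (h *\<^sub>R V))) (at t)"
        by (auto intro!: derivative_eq_intros)
      from has_derivative_compose[OF this d[of "z - t *\<^sub>R V"]]
      have "((\<lambda>\<tau>. - \<zeta> (z - \<tau> *\<^sub>R V)) has_derivative (\<lambda>h. h *\<^sub>R \<zeta>' (z - t *\<^sub>R V) V)) (at t)"
        by (auto intro!: derivative_eq_intros simp: blinfun.minus_right blinfun.scaleR_right)
      then show ?thesis
        unfolding has_vector_derivative_def by (rule has_derivative_at_withinI)
    qed
    then have "((\<lambda>\<tau>. \<zeta>' (z - \<tau> *\<^sub>R V) V) has_integral (- \<zeta> (z - 1 *\<^sub>R V) - (- \<zeta> (z - 0 *\<^sub>R V)))) {0..1}"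
      by (intro fundamental_theorem_of_calculus) auto
    moreover have "((\<lambda>\<tau>. \<zeta>' (z - \<tau> *\<^sub>R V)) has_integral \<phi>' z) {0..1}"
      unfolding \<phi>'_def
      by (intro integrable_integral integrable_continuous_real c2 continuous_intros)
    then have "((\<lambda>\<tau>. \<zeta>' (z - \<tau> *\<^sub>R V) V) has_integral \<phi>' z V) {0..1}"
      by (rule has_integral_linear[OF _ blinfun.bounded_linear_left, unfolded o_def])
    ultimately show ?thesis by (simp add: has_integral_unique)
  qed
  show ?thesis by (rule that[OF 1 2])
qed

section \<open>Increments along segments and the chain rule\<close>

lemma integrable_segment:
  fixes k :: "'a::euclidean_space \<Rightarrow> real"
  assumes k: "integrable lborel k"
  shows "integrable (lborel \<Otimes>\<^sub>M lborel) (\<lambda>(\<tau>, z). indicator {0..1::real} \<tau> * k (z + \<tau> *\<^sub>R V))"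
proof (rule lborel_pair.Fubini_integrable)
  have [measurable]: "k \<in> borel_measurable borel" using k by auto
  show "(\<lambda>(\<tau>, z). indicator {0..1::real} \<tau> * k (z + \<tau> *\<^sub>R V)) \<in> borel_measurable (lborel \<Otimes>\<^sub>M lborel)"
    by measurable
  have "(\<integral>z. norm (case (\<tau>, z) of (\<tau>, z) \<Rightarrow> indicator {0..1} \<tau> * k (z + \<tau> *\<^sub>R V)) \<partial>lborel)
      = indicator {0..1} \<tau> * (\<integral>z. \<bar>k z\<bar> \<partial>lborel)" for \<tau> :: real
    using integral_lborel_translate[of "\<lambda>z. \<bar>k z\<bar>" "\<tau> *\<^sub>R V"] by (simp add: abs_mult)
  then show "integrable lborel (\<lambda>\<tau>. \<integral>z. norm (case (\<tau>, z) of (\<tau>, z) \<Rightarrow> indicator {0..1} \<tau> * k (z + \<tau> *\<^sub>R V)) \<partial>lborel)"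
    by simp
  show "AE \<tau> in lborel. integrable lborel (\<lambda>z. case (\<tau>, z) of (\<tau>, z) \<Rightarrow> indicator {0..1::real} \<tau> * k (z + \<tau> *\<^sub>R V))"
    using integrable_lborel_translate[OF k] by auto
qed

text \<open>A duality argument: testing with the segment average of a bump and moving the
  translations onto \<open>f\<close> and \<open>k\<close> gives
  \<open>\<integral> \<zeta> D = 0\<close> for the defect \<open>D\<close>. Letting the bumps tend
  to the indicator of a box, the integrals of \<open>D\<close> over boxes in \<open>A\<close>
  vanish.\<close>

lemma weak_derivative_translation:
  fixes f k :: "'a::euclidean_space \<Rightarrow> real" and V :: 'a
  assumes f: "integrable lborel f" and k: "integrable lborel k"
    and weak: "\<And>\<phi> \<phi>'. C1_derivative \<phi> \<phi>' \<Longrightarrow> (\<And>z. z \<notin> K \<Longrightarrow> \<phi> z = 0) \<Longrightarrow>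
      (\<integral>z. f z * \<phi>' z V \<partial>lborel) = - (\<integral>z. \<phi> z * k z \<partial>lborel)"
    and A: "open A" and K: "\<And>z \<tau>. z \<in> A \<Longrightarrow> 0 \<le> \<tau> \<Longrightarrow> \<tau> \<le> 1 \<Longrightarrow> z + \<tau> *\<^sub>R V \<in> K"
  shows "AE z in lborel. z \<in> A \<longrightarrow> f (z + V) - f z = (\<integral>\<tau>. indicator {0..1} \<tau> * k (z + \<tau> *\<^sub>R V) \<partial>lborel)"
proof -
  have [measurable]: "f \<in> borel_measurable borel" "k \<in> borel_measurable borel" using f k by auto
  define \<kappa> where "\<kappa> z = (\<integral>\<tau>. indicator {0..1} \<tau> * k (z + \<tau> *\<^sub>R V) \<partial>lborel)" for z
  define D where "D z = f (z + V) - f z - \<kappa> z" for z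
  note int_swap = integrable_segment[OF k, of V]
  have int1: "integrable (lborel \<Otimes>\<^sub>M lborel) (\<lambda>(z, \<tau>). indicator {0..1::real} \<tau> * k (z + \<tau> *\<^sub>R V))"
    using lborel_pair.integrable_product_swap[OF int_swap] by (simp add: split_beta)
  have \<kappa>_int: "integrable lborel \<kappa>"
    using lborel_pair.integrable_fst'[OF int1] by (simp add: \<kappa>_def[abs_def])
  have D_int: "integrable lborel D"
    unfolding D_def by (intro Bochner_Integration.integrable_diff integrable_lborel_translate f \<kappa>_int)
  have zero: "(\<integral>z. indicator (box a c) z * D z \<partial>lborel) = 0" if ac: "cbox a c \<subseteq> A" for a c
  proof -
    obtain \<zeta> \<zeta>' where \<zeta>: "\<And>n::nat. C1_derivative (\<zeta> n) (\<zeta>' n)"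
      "\<And>n z. 0 \<le> \<zeta> n z" "\<And>n z. \<zeta> n z \<le> 1" "\<And>n z. z \<notin> box a c \<Longrightarrow> \<zeta> n z = 0"
      "\<And>z. (\<lambda>n. \<zeta> n z) \<longlonglongrightarrow> indicator (box a c) z"
      using C1_bumps_exist[of a c] by blast
    have [measurable]: "\<zeta> n \<in> borel_measurable borel" for n
      by (rule borel_measurable_continuous_onI[OF C1_derivative_continuous[OF \<zeta>(1)]])
    have bd: "integrable lborel (\<lambda>z. \<zeta> n (r z) * g z)" if "integrable lborel g" "r \<in> borel_measurable borel"
      for g :: "'a \<Rightarrow> real" and r and n
      using that by (intro Bochner_Integration.integrable_bound[OF that(1)])
        (auto intro!: AE_I2 mult_left_le_one_le simp: abs_mult \<zeta>)
    have "(\<integral>z. \<zeta> n z * D z \<partial>lborel) = 0" for n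
    proof -
      let ?\<zeta> = "\<zeta> n"
      obtain \<phi>' where \<phi>: "C1_derivative (\<lambda>z. integral {0..1} (\<lambda>\<tau>. ?\<zeta> (z - \<tau> *\<^sub>R V))) \<phi>'"
        "\<And>z. \<phi>' z V = ?\<zeta> z - ?\<zeta> (z - V)"
        using C1_derivative_segment_average[OF \<zeta>(1)] by blast
      let ?\<phi> = "\<lambda>z. integral {0..1} (\<lambda>\<tau>. ?\<zeta> (z - \<tau> *\<^sub>R V))"
      have \<phi>_leb: "?\<phi> z = (\<integral>\<tau>. indicator {0..1} \<tau> * ?\<zeta> (z - \<tau> *\<^sub>R V) \<partial>lborel)" for z
      proof -
        have "continuous_on {0..1} (\<lambda>\<tau>. ?\<zeta> (z - \<tau> *\<^sub>R V))"
          by (rule continuous_on_compose2[OF C1_derivative_continuous[OF \<zeta>(1), of UNIV]]) (auto intro!: continuous_intros)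
        then have "set_integrable lborel {0..1} (\<lambda>\<tau>. ?\<zeta> (z - \<tau> *\<^sub>R V))"
          unfolding set_integrable_def by (intro borel_integrable_compact) auto
        from set_borel_integral_eq_integral(2)[OF this] show ?thesis
          by (simp add: set_lebesgue_integral_def)
      qed
      have "?\<phi> z = 0" if "z \<notin> K" for z
      proof -
        \<comment> \<open>If the average were nonzero at \<open>z\<close>, some point
          \<open>z - \<tau> V\<close> would lie in the box, and the segment starting there would put
          \<open>z\<close> into \<open>K\<close>.\<close>
        have "?\<zeta> (z - \<tau> *\<^sub>R V) = 0" if "\<tau> \<in> {0..1}" for \<tau>
        proof (rule \<zeta>(4), rule notI)
          assume "z - \<tau> *\<^sub>R V \<in> box a c"
          then have "z - \<tau> *\<^sub>R V \<in> A" using ac box_subset_cbox by blast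
          then show False using K[of "z - \<tau> *\<^sub>R V" \<tau>] that \<open>z \<notin> K\<close> by auto
        qed
        then have "?\<phi> z = integral {0..1} (\<lambda>\<tau>::real. 0)"
          by (intro Henstock_Kurzweil_Integration.integral_cong) auto
        then show ?thesis by simp
      qed
      from weak[OF \<phi>(1) this]
      have w: "(\<integral>z. f z * (?\<zeta> z - ?\<zeta> (z - V)) \<partial>lborel) = - (\<integral>z. ?\<phi> z * k z \<partial>lborel)"
        by (simp add: \<phi>(2))
      have l: "(\<integral>z. f z * (?\<zeta> z - ?\<zeta> (z - V)) \<partial>lborel)
          = (\<integral>z. ?\<zeta> z * f z \<partial>lborel) - (\<integral>z. ?\<zeta> z * f (z + V) \<partial>lborel)"
      proof -
        have "(\<integral>z. f z * (?\<zeta> z - ?\<zeta> (z - V)) \<partial>lborel)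
          = (\<integral>z. ?\<zeta> z * f z - ?\<zeta> (z - V) * f z \<partial>lborel)"
          by (simp add: algebra_simps)
        also have "\<dots> = (\<integral>z. ?\<zeta> z * f z \<partial>lborel) - (\<integral>z. ?\<zeta> (z - V) * f z \<partial>lborel)"
          by (intro Bochner_Integration.integral_diff bd[OF f, of "\<lambda>z. z", simplified] bd[OF f]) auto
        also have "(\<integral>z. ?\<zeta> (z - V) * f z \<partial>lborel) = (\<integral>z. ?\<zeta> z * f (z + V) \<partial>lborel)"
          using integral_lborel_translate[of "\<lambda>z. ?\<zeta> (z - V) * f z" V] by simp
        finally show ?thesis .
      qed
      have i2: "integrable (lborel \<Otimes>\<^sub>M lborel) (\<lambda>(\<tau>, z). indicator {0..1::real} \<tau> * k (z + \<tau> *\<^sub>R V) * ?\<zeta> z)"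
        by (rule Bochner_Integration.integrable_bound[OF int_swap])
          (auto intro!: AE_I2 mult_right_le_one_le simp: abs_mult \<zeta>)
      have i3: "integrable (lborel \<Otimes>\<^sub>M lborel) (\<lambda>(\<tau>, z). indicator {0..1::real} \<tau> * ?\<zeta> (z - \<tau> *\<^sub>R V) * k z)"
      proof (rule lborel_pair.Fubini_integrable)
        show "(\<lambda>(\<tau>, z). indicator {0..1::real} \<tau> * ?\<zeta> (z - \<tau> *\<^sub>R V) * k z) \<in> borel_measurable (lborel \<Otimes>\<^sub>M lborel)"
          by measurable
        have b: "integrable lborel (\<lambda>z. ?\<zeta> (z - \<tau> *\<^sub>R V) * k z)" for \<tau> by (intro bd k) auto
        then show "AE \<tau> in lborel. integrable lborel (\<lambda>z. case (\<tau>, z) of (\<tau>, z) \<Rightarrow> indicator {0..1::real} \<tau> * ?\<zeta> (z - \<tau> *\<^sub>R V) * k z)"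
          by (auto simp: mult.assoc)
        have "(\<integral>z. norm (case (\<tau>, z) of (\<tau>, z) \<Rightarrow> indicator {0..1} \<tau> * ?\<zeta> (z - \<tau> *\<^sub>R V) * k z) \<partial>lborel)
            \<le> indicator {0..1} \<tau> * (\<integral>z. \<bar>k z\<bar> \<partial>lborel)" for \<tau> :: real
        proof -
          have "(\<integral>z. norm (case (\<tau>, z) of (\<tau>, z) \<Rightarrow> indicator {0..1} \<tau> * ?\<zeta> (z - \<tau> *\<^sub>R V) * k z) \<partial>lborel)
            = indicator {0..1} \<tau> * (\<integral>z. \<bar>?\<zeta> (z - \<tau> *\<^sub>R V) * k z\<bar> \<partial>lborel)"
            by (simp add: abs_mult mult.assoc)
          also have "\<dots> \<le> indicator {0..1} \<tau> * (\<integral>z. \<bar>k z\<bar> \<partial>lborel)"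
          proof (rule mult_left_mono)
            show "(\<integral>z. \<bar>?\<zeta> (z - \<tau> *\<^sub>R V) * k z\<bar> \<partial>lborel) \<le> (\<integral>z. \<bar>k z\<bar> \<partial>lborel)"
              by (rule integral_mono[OF integrable_abs[OF b] integrable_abs[OF k]])
                (auto intro!: mult_left_le_one_le simp: abs_mult \<zeta>)
          qed simp
          finally show ?thesis .
        qed
        note le = this
        show "integrable lborel (\<lambda>\<tau>. \<integral>z. norm (case (\<tau>, z) of (\<tau>, z) \<Rightarrow> indicator {0..1::real} \<tau> * ?\<zeta> (z - \<tau> *\<^sub>R V) * k z) \<partial>lborel)"
        proof (rule Bochner_Integration.integrable_bound[of lborel "\<lambda>\<tau>. indicator {0..1} \<tau> * (\<integral>z. \<bar>k z\<bar> \<partial>lborel)"])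
          show "AE \<tau> in lborel. norm (\<integral>z. norm (case (\<tau>, z) of (\<tau>, z) \<Rightarrow> indicator {0..1::real} \<tau> * ?\<zeta> (z - \<tau> *\<^sub>R V) * k z) \<partial>lborel)
              \<le> norm (indicator {0..1} \<tau> * (\<integral>z. \<bar>k z\<bar> \<partial>lborel))"
          proof (rule AE_I2)
            fix \<tau> :: real
            have "0 \<le> (\<integral>z. norm (case (\<tau>, z) of (\<tau>, z) \<Rightarrow> indicator {0..1::real} \<tau> * ?\<zeta> (z - \<tau> *\<^sub>R V) * k z) \<partial>lborel)"
              by (rule integral_nonneg_AE) simp
            with le[of \<tau>] show "norm (\<integral>z. norm (case (\<tau>, z) of (\<tau>, z) \<Rightarrow> indicator {0..1::real} \<tau> * ?\<zeta> (z - \<tau> *\<^sub>R V) * k z) \<partial>lborel)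
              \<le> norm (indicator {0..1} \<tau> * (\<integral>z. \<bar>k z\<bar> \<partial>lborel))"
              unfolding real_norm_def by linarith
          qed
        qed simp_all
      qed
      have "(\<integral>z. ?\<phi> z * k z \<partial>lborel) = (\<integral>z. \<integral>\<tau>. indicator {0..1} \<tau> * ?\<zeta> (z - \<tau> *\<^sub>R V) * k z \<partial>lborel \<partial>lborel)"
        by (simp add: \<phi>_leb)
      also have "\<dots> = (\<integral>\<tau>. \<integral>z. indicator {0..1} \<tau> * ?\<zeta> (z - \<tau> *\<^sub>R V) * k z \<partial>lborel \<partial>lborel)"
        using lborel_pair.Fubini_integral[OF i3] by simp
      also have "\<dots> = (\<integral>\<tau>. \<integral>z. indicator {0..1} \<tau> * k (z + \<tau> *\<^sub>R V) * ?\<zeta> z \<partial>lborel \<partial>lborel)"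
      proof (rule Bochner_Integration.integral_cong[OF refl])
        fix \<tau> :: real
        show "(\<integral>z. indicator {0..1} \<tau> * ?\<zeta> (z - \<tau> *\<^sub>R V) * k z \<partial>lborel) = (\<integral>z. indicator {0..1} \<tau> * k (z + \<tau> *\<^sub>R V) * ?\<zeta> z \<partial>lborel)"
          using integral_lborel_translate[of "\<lambda>z. indicator {0..1} \<tau> * ?\<zeta> (z - \<tau> *\<^sub>R V) * k z" "\<tau> *\<^sub>R V"]
          by (simp add: mult_ac)
      qed
      also have "\<dots> = (\<integral>z. \<integral>\<tau>. indicator {0..1} \<tau> * k (z + \<tau> *\<^sub>R V) * ?\<zeta> z \<partial>lborel \<partial>lborel)"
        using lborel_pair.Fubini_integral[OF i2] by simp
      also have "\<dots> = (\<integral>z. ?\<zeta> z * \<kappa> z \<partial>lborel)"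
        by (simp add: \<kappa>_def mult.commute)
      finally have "(\<integral>z. ?\<phi> z * k z \<partial>lborel) = (\<integral>z. ?\<zeta> z * \<kappa> z \<partial>lborel)" .
      moreover have "(\<integral>z. ?\<zeta> z * D z \<partial>lborel)
          = (\<integral>z. ?\<zeta> z * f (z + V) \<partial>lborel) - (\<integral>z. ?\<zeta> z * f z \<partial>lborel) - (\<integral>z. ?\<zeta> z * \<kappa> z \<partial>lborel)"
        using bd[OF integrable_lborel_translate[OF f], of "\<lambda>z. z" n V] bd[OF f, of "\<lambda>z. z" n] bd[OF \<kappa>_int, of "\<lambda>z. z" n]
        by (simp add: D_def right_diff_distrib)
      ultimately show ?thesis using w l by simp
    qed
    moreover have "(\<lambda>n. \<integral>z. \<zeta> n z * D z \<partial>lborel) \<longlonglongrightarrow> (\<integral>z. indicator (box a c) z * D z \<partial>lborel)"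
    proof (rule integral_dominated_convergence[where w = "\<lambda>z. \<bar>D z\<bar>"])
      show "AE z in lborel. (\<lambda>n. \<zeta> n z * D z) \<longlonglongrightarrow> indicator (box a c) z * D z"
        by (intro AE_I2 tendsto_mult tendsto_const \<zeta>)
      show "AE z in lborel. norm (\<zeta> n z * D z) \<le> \<bar>D z\<bar>" for n
        by (auto intro!: AE_I2 mult_left_le_one_le simp: abs_mult \<zeta>)
    qed (use D_int in auto)
    ultimately show ?thesis by (simp add: LIMSEQ_const_iff)
  qed
  show ?thesis
    using AE_zero_of_integral_box_zero[OF D_int A zero] unfolding D_def \<kappa>_def by simp
qed

text \<open>\<open>k\<close> is merely integrable, so \<open>U\<close> need not be differentiable
  everywhere. Instead, the mean value theorem for \<open>W\<close> is applied on short time steps.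
  Uniform continuity of \<open>W1\<close> along \<open>U\<close> costs an error \<open>e\<close> in
  the factor; the steps telescope, and then \<open>e\<close> tends to 0.\<close>

lemma abs_increment_le_integral:
  fixes k W W1 :: "real \<Rightarrow> real"
  assumes k: "k absolutely_integrable_on {0..1}"
    and U: "\<And>s. s \<in> {0..1} \<Longrightarrow> U s = c + integral {0..s} k"
    and UM: "\<And>s. s \<in> {0..1} \<Longrightarrow> U s \<in> {0..M}"
    and W: "\<And>y. y \<in> {0..M} \<Longrightarrow> (W has_real_derivative W1 y) (at y within {0..M})"
    and W1: "continuous_on {0..M} W1"
  shows "(\<lambda>\<tau>. \<bar>W1 (U \<tau>)\<bar> * \<bar>k \<tau>\<bar>) absolutely_integrable_on {0..1}"
    and "\<bar>W (U 1) - W (U 0)\<bar> \<le> integral {0..1} (\<lambda>\<tau>. \<bar>W1 (U \<tau>)\<bar> * \<bar>k \<tau>\<bar>)"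
proof -
  have kint: "k integrable_on {0..1}" using k by (rule set_lebesgue_integral_eq_integral(1))
  have "continuous_on {0..1} (\<lambda>s. c + integral {0..s} k)"
    by (intro continuous_intros indefinite_integral_continuous_1 kint)
  then have Uc: "continuous_on {0..1} U"
    by (rule continuous_on_eq) (simp add: U)
  have VC: "continuous_on {0..1} (\<lambda>\<tau>. W1 (U \<tau>))"
    by (rule continuous_on_compose2[OF W1 Uc]) (use UM in auto)
  have prod: "(\<lambda>\<tau>. (\<bar>W1 (U \<tau>)\<bar> + e) * \<bar>k \<tau>\<bar>) absolutely_integrable_on {0..1}" for e
  proof (rule absolutely_integrable_bounded_measurable_product_real)
    have c: "continuous_on {0..1} (\<lambda>\<tau>. \<bar>W1 (U \<tau>)\<bar> + e)" by (intro continuous_intros VC)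
    then show "(\<lambda>\<tau>. \<bar>W1 (U \<tau>)\<bar> + e) \<in> borel_measurable (lebesgue_on {0..1})"
      by (rule continuous_imp_measurable_on_sets_lebesgue) auto
    show "bounded ((\<lambda>\<tau>. \<bar>W1 (U \<tau>)\<bar> + e) ` {0..1})"
      by (rule compact_imp_bounded, rule compact_continuous_image[OF c]) auto
    show "(\<lambda>\<tau>. \<bar>k \<tau>\<bar>) absolutely_integrable_on {0..1}"
      using absolutely_integrable_norm[OF k] by (simp add: o_def)
  qed auto
  show "(\<lambda>\<tau>. \<bar>W1 (U \<tau>)\<bar> * \<bar>k \<tau>\<bar>) absolutely_integrable_on {0..1}"
    using prod[of 0] by simp
  have main: "\<bar>W (U 1) - W (U 0)\<bar> \<le> integral {0..1} (\<lambda>\<tau>. (\<bar>W1 (U \<tau>)\<bar> + e) * \<bar>k \<tau>\<bar>)" if e: "e > 0" for e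
  proof -
    define G where "G s = integral {0..s} (\<lambda>\<tau>. (\<bar>W1 (U \<tau>)\<bar> + e) * \<bar>k \<tau>\<bar>)" for s
    have pint: "(\<lambda>\<tau>. (\<bar>W1 (U \<tau>)\<bar> + e) * \<bar>k \<tau>\<bar>) integrable_on {0..1}"
      by (rule set_lebesgue_integral_eq_integral(1)[OF prod])
    have "uniformly_continuous_on {0..1} (\<lambda>\<tau>. W1 (U \<tau>))"
      by (rule compact_uniformly_continuous[OF VC]) simp
    then obtain d where d: "d > 0" "\<And>s t. s \<in> {0..1} \<Longrightarrow> t \<in> {0..1} \<Longrightarrow> \<bar>t - s\<bar> < d \<Longrightarrow> \<bar>W1 (U t) - W1 (U s)\<bar> < e"
      unfolding uniformly_continuous_on_def dist_real_def using e by metis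
    have step: "\<bar>W (U t) - W (U s)\<bar> \<le> G t - G s" if st: "0 \<le> s" "s \<le> t" "t \<le> 1" "t - s < d" for s t
    proof -
      have sub: "f integrable_on {0..1} \<Longrightarrow> f integrable_on {s..t}" for f :: "real \<Rightarrow> real"
        using st by (rule_tac integrable_subinterval_real[of f 0 1]) auto
      have sub0: "f integrable_on {0..1} \<Longrightarrow> f integrable_on {0..t}" for f :: "real \<Rightarrow> real"
        using st by (rule_tac integrable_subinterval_real[of f 0 1]) auto
      have Ud: "U t - U s = integral {s..t} k"
        using Henstock_Kurzweil_Integration.integral_combine[OF st(1,2) sub0[OF kint]] st by (simp add: U)
      have Gd: "G t - G s = integral {s..t} (\<lambda>\<tau>. (\<bar>W1 (U \<tau>)\<bar> + e) * \<bar>k \<tau>\<bar>)"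
        using Henstock_Kurzweil_Integration.integral_combine[OF st(1,2) sub0[OF pint]] by (simp add: G_def)
      obtain \<xi> where \<xi>: "\<xi> \<in> closed_segment (U s) (U t)" "W (U t) - W (U s) = W1 \<xi> * (U t - U s)"
      proof -
        have in_M: "closed_segment (U s) (U t) \<subseteq> {0..M}"
          using UM[of s] UM[of t] st unfolding closed_segment_eq_real_ivl by (auto split: if_splits)
        have mv: "\<exists>x\<in>{p..q}. W q - W p = W1 x * (q - p)" if pq: "p \<le> q" "{p..q} \<subseteq> {0..M}" for p q
        proof -
          have "(W has_derivative (*) (W1 x)) (at x within {p..q})" if "p \<le> x" "x \<le> q" for x
          proof -
            have "x \<in> {0..M}" using pq that by auto
            from W[OF this] show ?thesis
              unfolding has_field_derivative_def by (rule has_derivative_subset[OF _ pq(2)])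
          qed
          from mvt_very_simple[OF pq(1) this] show ?thesis by auto
        qed
        have "\<exists>x\<in>closed_segment (U s) (U t). W (U t) - W (U s) = W1 x * (U t - U s)"
        proof (cases "U s \<le> U t")
          case True
          then show ?thesis using mv[of "U s" "U t"] in_M by (simp add: closed_segment_eq_real_ivl)
        next
          case False
          then have "\<exists>x\<in>{U t..U s}. W (U s) - W (U t) = W1 x * (U s - U t)"
            using mv[of "U t" "U s"] in_M by (simp add: closed_segment_eq_real_ivl)
          then obtain x where "x \<in> {U t..U s}" "W (U s) - W (U t) = W1 x * (U s - U t)" ..
          then have "W (U t) - W (U s) = W1 x * (U t - U s)" by (simp add: algebra_simps)
          then show ?thesis using False \<open>x \<in> _\<close> by (auto simp: closed_segment_eq_real_ivl)
        qed
        then show ?thesis using that by blast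
      qed
      \<comment> \<open>By the intermediate value property the mean value point is itself a value of
        \<open>U\<close> within the step, so \<open>W1 \<xi>\<close> can be compared with
        \<open>W1 (U \<tau>)\<close> there.\<close>
      obtain \<sigma> where \<sigma>: "\<sigma> \<in> {s..t}" "\<xi> = U \<sigma>"
      proof -
        have "connected (U ` {s..t})"
          by (intro connected_continuous_image continuous_on_subset[OF Uc]) (use st in auto)
        moreover have "U s \<in> U ` {s..t}" "U t \<in> U ` {s..t}" using st by auto
        ultimately have "closed_segment (U s) (U t) \<subseteq> U ` {s..t}"
          by (metis closed_segment_eq_real_ivl connected_contains_Icc)
        then show ?thesis using \<xi>(1) that by blast
      qed
      have "\<bar>W (U t) - W (U s)\<bar> = norm (integral {s..t} (\<lambda>\<tau>. W1 (U \<sigma>) * k \<tau>))"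
        using \<xi>(2) \<sigma>(2) by (simp add: Ud)
      also have "\<dots> \<le> integral {s..t} (\<lambda>\<tau>. (\<bar>W1 (U \<tau>)\<bar> + e) * \<bar>k \<tau>\<bar>)"
      proof (rule Henstock_Kurzweil_Integration.integral_norm_bound_integral)
        show "(\<lambda>\<tau>. W1 (U \<sigma>) * k \<tau>) integrable_on {s..t}"
          by (rule integrable_on_mult_right[OF sub[OF kint]])
        show "norm (W1 (U \<sigma>) * k \<tau>) \<le> (\<bar>W1 (U \<tau>)\<bar> + e) * \<bar>k \<tau>\<bar>" if "\<tau> \<in> {s..t}" for \<tau>
        proof -
          have "\<bar>\<tau> - \<sigma>\<bar> < d" using \<sigma>(1) that st by auto
          then have "\<bar>W1 (U \<tau>) - W1 (U \<sigma>)\<bar> < e" using d(2)[of \<sigma> \<tau>] \<sigma>(1) that st by auto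
          then show ?thesis by (auto simp: abs_mult intro!: mult_right_mono)
        qed
      qed (rule sub[OF pint])
      finally show ?thesis by (simp add: Gd)
    qed
    obtain m :: nat where m: "inverse (real (Suc m)) < d" using reals_Archimedean[OF d(1)] by blast
    define n where "n = Suc m"
    have n: "n > 0" "1 / n < d" using m by (simp_all add: n_def inverse_eq_divide)
    have "\<bar>W (U (real i / n)) - W (U 0)\<bar> \<le> G (real i / n)" if "i \<le> n" for i
      using that
    proof (induction i)
      case (Suc i)
      have "\<bar>W (U (real (Suc i) / n)) - W (U (real i / n))\<bar> \<le> G (real (Suc i) / n) - G (real i / n)"
        using Suc.prems n by (intro step) (auto simp: field_simps)
      then show ?case using Suc by linarith
    qed (simp add: G_def)
    from this[of n] n show ?thesis by (simp add: G_def)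
  qed
  have i0: "(\<lambda>\<tau>. \<bar>W1 (U \<tau>)\<bar> * \<bar>k \<tau>\<bar>) integrable_on {0..1}"
    using set_lebesgue_integral_eq_integral(1)[OF prod[of 0]] by simp
  have ik: "(\<lambda>\<tau>. \<bar>k \<tau>\<bar>) integrable_on {0..1}"
    using set_lebesgue_integral_eq_integral(1)[OF absolutely_integrable_norm[OF k]] by (simp add: o_def)
  show "\<bar>W (U 1) - W (U 0)\<bar> \<le> integral {0..1} (\<lambda>\<tau>. \<bar>W1 (U \<tau>)\<bar> * \<bar>k \<tau>\<bar>)"
  proof (rule field_le_epsilon)
    fix e :: real assume "e > 0"
    define I where "I = integral {0..1} (\<lambda>\<tau>. \<bar>k \<tau>\<bar>)"
    have I: "I \<ge> 0" unfolding I_def by (rule Henstock_Kurzweil_Integration.integral_nonneg[OF ik]) simp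
    \<comment> \<open>The added 1 covers the case that the integral of \<open>\<bar>k\<bar>\<close>
      is 0.\<close>
    define e' where "e' = e / (I + 1)"
    have e': "e' > 0" using \<open>e > 0\<close> I by (simp add: e'_def)
    have "integral {0..1} (\<lambda>\<tau>. (\<bar>W1 (U \<tau>)\<bar> + e') * \<bar>k \<tau>\<bar>) = integral {0..1} (\<lambda>\<tau>. \<bar>W1 (U \<tau>)\<bar> * \<bar>k \<tau>\<bar>) + e' * I"
      using Henstock_Kurzweil_Integration.integral_add[OF i0 integrable_on_mult_right[OF ik, of e']]
      by (simp add: distrib_right I_def)
    moreover have "e' * I \<le> e" using I \<open>e > 0\<close> by (simp add: e'_def field_simps)
    ultimately show "\<bar>W (U 1) - W (U 0)\<bar> \<le> integral {0..1} (\<lambda>\<tau>. \<bar>W1 (U \<tau>)\<bar> * \<bar>k \<tau>\<bar>) + e"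
      using main[OF e'] by linarith
  qed
qed

lemma AE_integrable_segment:
  fixes k :: "'a::euclidean_space \<Rightarrow> real"
  assumes k: "integrable lborel k"
  shows "AE z in lborel. integrable lborel (\<lambda>\<tau>. indicator {0..1::real} \<tau> * k (z + \<tau> *\<^sub>R V))"
  using lborel_pair.AE_integrable_fst'[OF lborel_pair.integrable_product_swap[OF integrable_segment[OF k, of V]]]
  by simp

text \<open>On almost every segment \<open>f\<close> coincides, at almost every parameter, with the
  absolutely continuous function \<open>U z\<close>. The one-dimensional estimate applies to the
  latter, and Cauchy-Schwarz on the unit interval gives the square. \<open>W\<close> is needed only
  on \<open>[0, M]\<close>, with one-sided derivatives at the ends.\<close>

lemma chain_rule_segment:
  fixes f k :: "'a::euclidean_space \<Rightarrow> real" and V :: 'a and W W1 :: "real \<Rightarrow> real"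
  assumes f: "integrable lborel f" and k: "integrable lborel k"
    and weak: "\<And>\<phi> \<phi>'. C1_derivative \<phi> \<phi>' \<Longrightarrow> (\<And>z. z \<notin> K \<Longrightarrow> \<phi> z = 0) \<Longrightarrow>
      (\<integral>z. f z * \<phi>' z V \<partial>lborel) = - (\<integral>z. \<phi> z * k z \<partial>lborel)"
    and A: "open A" and K: "\<And>z \<tau>. z \<in> A \<Longrightarrow> 0 \<le> \<tau> \<Longrightarrow> \<tau> \<le> 1 \<Longrightarrow> z + \<tau> *\<^sub>R V \<in> K"
    and fM: "\<And>z. f z \<in> {0..M}"
    and W: "\<And>y. y \<in> {0..M} \<Longrightarrow> (W has_real_derivative W1 y) (at y within {0..M})"
    and W1: "continuous_on {0..M} W1"
  shows "AE z in lborel. z \<in> A \<longrightarrow> ennreal ((W (f (z + V)) - W (f z))\<^sup>2)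
      \<le> (\<integral>\<^sup>+\<tau>. ennreal (indicator {0..1} \<tau> * (W1 (f (z + \<tau> *\<^sub>R V)) * k (z + \<tau> *\<^sub>R V))\<^sup>2) \<partial>lborel)"
proof -
  have [measurable]: "f \<in> borel_measurable borel" "k \<in> borel_measurable borel" using f k by auto
  have [measurable]: "A \<in> sets borel" using A by simp
  have [measurable]: "(\<lambda>z. W1 (f z)) \<in> borel_measurable borel"
  proof -
    have "(\<lambda>y. indicator {0..M} y *\<^sub>R W1 y) \<in> borel_measurable borel"
      by (rule borel_measurable_continuous_on_indicator[OF _ W1]) simp
    then have "(\<lambda>z. indicator {0..M} (f z) *\<^sub>R W1 (f z)) \<in> borel_measurable borel"
      by (rule measurable_compose[rotated]) simp
    then show ?thesis using fM by (simp add: indicator_def)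
  qed
  define k' where "k' z \<tau> = indicator {0..1} \<tau> * k (z + \<tau> *\<^sub>R V)" for z and \<tau> :: real
  have [measurable]: "(\<lambda>(z, \<tau>). k' z \<tau>) \<in> borel_measurable (lborel \<Otimes>\<^sub>M lborel)"
    unfolding k'_def by measurable
  define U where "U z s = f z + (\<integral>\<tau>. indicator {0..s} \<tau> * k' z \<tau> \<partial>lborel)" for z s
  \<comment> \<open>The translation formula is applied to the shorter vector \<open>s V\<close>,
    whose directional derivative is \<open>s k\<close>; substitution turns the result into a partial
    integral over \<open>{0..s}\<close>.\<close>
  have trans: "AE z in lborel. z \<in> A \<longrightarrow> f (z + s *\<^sub>R V) = U z s" if s: "0 \<le> s" "s \<le> 1" for s
  proof -
    have "AE z in lborel. z \<in> A \<longrightarrow> f (z + s *\<^sub>R V) - f z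
        = (\<integral>\<tau>. indicator {0..1} \<tau> * (s * k (z + \<tau> *\<^sub>R (s *\<^sub>R V))) \<partial>lborel)"
    proof (rule weak_derivative_translation[OF f _ _ A])
      show "integrable lborel (\<lambda>z. s * k z)" using k by simp
      show "(\<integral>z. f z * \<phi>' z (s *\<^sub>R V) \<partial>lborel) = - (\<integral>z. \<phi> z * (s * k z) \<partial>lborel)"
        if "C1_derivative \<phi> \<phi>'" "\<And>z. z \<notin> K \<Longrightarrow> \<phi> z = 0" for \<phi> \<phi>'
        using weak[OF that] by (simp add: blinfun.scaleR_right mult.left_commute[of _ s])
      show "z + \<tau> *\<^sub>R s *\<^sub>R V \<in> K" if "z \<in> A" "0 \<le> \<tau>" "\<tau> \<le> 1" for z \<tau>
        using K[of z "\<tau> * s"] that s by (simp add: mult_le_one)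
    qed
    then show ?thesis
    proof eventually_elim
      case (elim z)
      have "(\<integral>\<tau>. indicator {0..1} \<tau> * (s * k (z + \<tau> *\<^sub>R (s *\<^sub>R V))) \<partial>lborel) = (\<integral>\<tau>. indicator {0..s} \<tau> * k' z \<tau> \<partial>lborel)"
      proof (cases "s = 0")
        case False
        with s have s0: "s > 0" by simp
        have "(\<integral>\<tau>. indicator {0..s} \<tau> * k' z \<tau> \<partial>lborel) = \<bar>s\<bar> *\<^sub>R (\<integral>\<tau>. indicator {0..s} (0 + s * \<tau>) * k' z (0 + s * \<tau>) \<partial>lborel)"
          using False by (rule lborel_integral_real_affine)
        also have "\<dots> = (\<integral>\<tau>. s * (indicator {0..s} (s * \<tau>) * k' z (s * \<tau>)) \<partial>lborel)"
          using s0 by simp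
        also have "\<dots> = (\<integral>\<tau>. indicator {0..1} \<tau> * (s * k (z + \<tau> *\<^sub>R (s *\<^sub>R V))) \<partial>lborel)"
        proof (rule Bochner_Integration.integral_cong[OF refl])
          fix \<tau> :: real
          have "0 \<le> s * \<tau> \<and> s * \<tau> \<le> s \<longleftrightarrow> 0 \<le> \<tau> \<and> \<tau> \<le> 1"
            using s0 by (simp add: zero_le_mult_iff)
          moreover have "0 \<le> \<tau> \<Longrightarrow> \<tau> \<le> 1 \<Longrightarrow> s * \<tau> \<le> 1" using s by (simp add: mult_le_one)
          ultimately show "s * (indicator {0..s} (s * \<tau>) * k' z (s * \<tau>)) = indicator {0..1} \<tau> * (s * k (z + \<tau> *\<^sub>R (s *\<^sub>R V)))"
            using s0 by (auto simp: k'_def indicator_def mult.commute)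
        qed
        finally show ?thesis by simp
      next
        case True
        have "(\<integral>\<tau>. indicator {0..0::real} \<tau> * k' z \<tau> \<partial>lborel) = (\<integral>\<tau>. indicator {0..0::real} \<tau> * k' z 0 \<partial>lborel)"
          by (rule Bochner_Integration.integral_cong) (auto simp: indicator_def)
        then show ?thesis using True by simp
      qed
      then show ?case using elim by (auto simp: U_def)
    qed
  qed
  \<comment> \<open>The exceptional set in \<open>trans\<close> depends on \<open>s\<close>. Fubini
    exchanges the quantifiers: for almost every \<open>z\<close>, the identity holds for almost
    every \<open>s\<close>.\<close>
  have ae_s: "AE z in lborel. AE s in lborel. z \<in> A \<longrightarrow> 0 \<le> s \<longrightarrow> s \<le> 1 \<longrightarrow> f (z + s *\<^sub>R V) = U z s"
  proof (subst lborel_pair.AE_commute)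
    have [measurable]: "(\<lambda>x. U (fst x) (snd x)) \<in> borel_measurable (lborel \<Otimes>\<^sub>M lborel)"
    proof -
      have [measurable]: "Measurable.pred ((lborel \<Otimes>\<^sub>M lborel) \<Otimes>\<^sub>M lborel) (\<lambda>x. snd x \<in> {0..snd (fst x) :: real})"
        unfolding atLeastAtMost_iff by measurable
      show ?thesis unfolding U_def k'_def by measurable
    qed
    show "{x \<in> space (lborel \<Otimes>\<^sub>M lborel). fst x \<in> A \<longrightarrow> 0 \<le> snd x \<longrightarrow> snd x \<le> 1 \<longrightarrow> f (fst x + snd x *\<^sub>R V) = U (fst x) (snd x)} \<in> sets (lborel \<Otimes>\<^sub>M lborel)"
      by measurable
    show "AE s in lborel. AE z in lborel. z \<in> A \<longrightarrow> 0 \<le> s \<longrightarrow> s \<le> 1 \<longrightarrow> f (z + s *\<^sub>R V) = U z s"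
    proof (rule AE_I2)
      fix s :: real
      show "AE z in lborel. z \<in> A \<longrightarrow> 0 \<le> s \<longrightarrow> s \<le> 1 \<longrightarrow> f (z + s *\<^sub>R V) = U z s"
        using trans[of s] by (cases "0 \<le> s \<and> s \<le> 1") (auto elim!: eventually_mono)
    qed
  qed
  have "AE z in lborel. z \<in> A \<longrightarrow> f (z + 1 *\<^sub>R V) = U z 1" by (rule trans) auto
  with ae_s AE_integrable_segment[OF k, of V] show ?thesis
  proof eventually_elim
    case (elim z)
    show ?case
    proof
      assume zA: "z \<in> A"
      have ki: "integrable lborel (k' z)" using elim(2) by (simp add: k'_def[abs_def])
      have UK: "AE s in lborel. s \<in> {0..1} \<longrightarrow> f (z + s *\<^sub>R V) = U z s"
        using elim(1) by eventually_elim (use zA in auto)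
      have k'a: "k' z absolutely_integrable_on {0..s}" for s
        using integrable_mult_indicator[of "{0..s}", OF _ ki] unfolding set_integrable_def
        by (auto intro: integrable_completion[THEN iffD2])
      have Ueq: "U z s = f z + integral {0..s} (k' z)" for s
      proof -
        have "set_integrable lborel {0..s} (k' z)"
          unfolding set_integrable_def by (rule integrable_mult_indicator[OF _ ki]) simp
        from set_borel_integral_eq_integral(2)[OF this] show ?thesis
          by (simp add: U_def set_lebesgue_integral_def)
      qed
      have "continuous_on {0..1} (\<lambda>s. f z + integral {0..s} (k' z))"
        by (intro continuous_intros indefinite_integral_continuous_1 set_lebesgue_integral_eq_integral(1) k'a)
      then have Uc: "continuous_on {0..1} (U z)" by (simp add: Ueq[abs_def])
      \<comment> \<open>The range of \<open>f\<close> is known to pass to \<open>U z\<close> only at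
        almost every parameter. Being continuous, \<open>U z\<close> would leave the closed interval
        on a whole interval of parameters, which has positive measure.\<close>
      have UM: "U z s \<in> {0..M}" if s: "s \<in> {0..1}" for s
      proof (rule ccontr)
        assume "U z s \<notin> {0..M}"
        then obtain r where r: "r > 0" "ball (U z s) r \<subseteq> - {0..M}"
          using openE[OF open_Compl[OF closed_atLeastAtMost], of "U z s" 0 M] by blast
        then obtain e where e: "e > 0" "\<And>t. t \<in> {0..1} \<Longrightarrow> dist t s < e \<Longrightarrow> dist (U z t) (U z s) < r"
          using Uc[unfolded continuous_on_iff, rule_format, OF s r(1)] by blast
        have eM: "U z t \<notin> {0..M}" if "t \<in> {0..1}" "dist t s < e" for t
        proof -
          have "U z t \<in> ball (U z s) r" using e(2)[OF that] by (simp add: dist_commute)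
          then show ?thesis using r(2) by blast
        qed
        define p where "p = max 0 (s - e / 2)"
        define q where "q = min 1 (s + e / 2)"
        have pq: "p < q" using s e(1) by (auto simp: p_def q_def max_def min_def)
        have "AE t in lborel. t \<notin> {p..q}"
          using UK 
        proof eventually_elim
          case (elim t)
          show ?case
          proof
            assume "t \<in> {p..q}"
            then have "t \<in> {0..1}" "dist t s < e" using s e(1) by (auto simp: p_def q_def dist_real_def)
            then show False using eM[of t] elim fM[of "z + t *\<^sub>R V"] by simp
          qed
        qed
        then have "{p..q} \<in> null_sets lborel"
          by (subst AE_iff_null_sets) simp_all
        then have "emeasure lborel {p..q} = 0" by (rule null_setsD1)
        then show False using pq by simp
      qed
      note chain = abs_increment_le_integral[OF k'a Ueq UM W W1]
      define r where "r \<tau> = indicator {0..1} \<tau> * \<bar>W1 (f (z + \<tau> *\<^sub>R V)) * k (z + \<tau> *\<^sub>R V)\<bar>" for \<tau> :: real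
      have [measurable]: "r \<in> borel_measurable borel" unfolding r_def by measurable
      have "\<bar>W (f (z + V)) - W (f z)\<bar> = \<bar>W (U z 1) - W (U z 0)\<bar>"
        using elim(3) zA by (simp add: Ueq)
      also have "ennreal \<dots> \<le> ennreal (integral {0..1} (\<lambda>\<tau>. \<bar>W1 (U z \<tau>)\<bar> * \<bar>k' z \<tau>\<bar>))"
        by (rule ennreal_leI[OF chain(2)])
      also have "\<dots> = ennreal (\<integral>\<tau>. indicator {0..1} \<tau> *\<^sub>R (\<bar>W1 (U z \<tau>)\<bar> * \<bar>k' z \<tau>\<bar>) \<partial>lebesgue)"
        using set_lebesgue_integral_eq_integral(2)[OF chain(1)] by (simp add: set_lebesgue_integral_def)
      also have "\<dots> = (\<integral>\<^sup>+\<tau>. ennreal (indicator {0..1} \<tau> *\<^sub>R (\<bar>W1 (U z \<tau>)\<bar> * \<bar>k' z \<tau>\<bar>)) \<partial>lebesgue)"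
        using chain(1) unfolding set_integrable_def by (intro nn_integral_eq_integral[symmetric]) auto
      also have "\<dots> = (\<integral>\<^sup>+\<tau>. ennreal (r \<tau>) \<partial>lebesgue)"
      proof (rule nn_integral_cong_AE)
        show "AE \<tau> in lebesgue. ennreal (indicator {0..1} \<tau> *\<^sub>R (\<bar>W1 (U z \<tau>)\<bar> * \<bar>k' z \<tau>\<bar>)) = ennreal (r \<tau>)"
          using AE_completion[OF UK] by eventually_elim (auto simp: r_def k'_def abs_mult indicator_def)
      qed
      also have "\<dots> = (\<integral>\<^sup>+\<tau>. ennreal (r \<tau>) * indicator {0..1} \<tau> \<partial>lborel)"
        by (subst nn_integral_completion) (auto intro!: nn_integral_cong simp: r_def indicator_def)
      finally have le: "ennreal \<bar>W (f (z + V)) - W (f z)\<bar> \<le> (\<integral>\<^sup>+\<tau>. ennreal (r \<tau>) * indicator {0..1} \<tau> \<partial>lborel)" .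
      have "ennreal ((W (f (z + V)) - W (f z))\<^sup>2) = (ennreal \<bar>W (f (z + V)) - W (f z)\<bar>)\<^sup>2"
        by (simp add: ennreal_power)
      also have "\<dots> \<le> (\<integral>\<^sup>+\<tau>. ennreal (r \<tau>) * indicator {0..1} \<tau> \<partial>lborel)\<^sup>2"
        by (rule power_mono[OF le]) simp
      also have "\<dots> \<le> (\<integral>\<^sup>+\<tau>. (ennreal (r \<tau>))\<^sup>2 \<partial>lborel) * (\<integral>\<^sup>+\<tau>. (indicator {0..1::real} \<tau>)\<^sup>2 \<partial>lborel)"
        by (rule Cauchy_Schwarz_nn_integral) simp_all
      also have "(\<integral>\<^sup>+\<tau>. (indicator {0..1::real} \<tau>)\<^sup>2 \<partial>lborel) = (\<integral>\<^sup>+\<tau>. indicator {0..1::real} \<tau> \<partial>lborel)"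
        by (intro nn_integral_cong) (simp add: indicator_def)
      also have "\<dots> = 1" by simp
      also have "(\<integral>\<^sup>+\<tau>. (ennreal (r \<tau>))\<^sup>2 \<partial>lborel) * 1
          = (\<integral>\<^sup>+\<tau>. ennreal (indicator {0..1} \<tau> * (W1 (f (z + \<tau> *\<^sub>R V)) * k (z + \<tau> *\<^sub>R V))\<^sup>2) \<partial>lborel)"
        by (auto intro!: nn_integral_cong simp: r_def ennreal_power power_mult_distrib indicator_def)
      finally show "ennreal ((W (f (z + V)) - W (f z))\<^sup>2)
        \<le> (\<integral>\<^sup>+\<tau>. ennreal (indicator {0..1} \<tau> * (W1 (f (z + \<tau> *\<^sub>R V)) * k (z + \<tau> *\<^sub>R V))\<^sup>2) \<partial>lborel)" .
    qed
  qed
qed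

section \<open>The De Giorgi iteration\<close>

lemma borel_measurable_continuous_on_compose:
  fixes g :: "real \<Rightarrow> real"
  assumes g: "continuous_on S g" and S: "S \<in> sets borel" and f: "f \<in> borel_measurable M"
    and fS: "\<And>x. f x \<in> S"
  shows "(\<lambda>x. g (f x)) \<in> borel_measurable M"
proof -
  have "(\<lambda>y. indicator S y *\<^sub>R g y) \<in> borel_measurable borel"
    by (rule borel_measurable_continuous_on_indicator[OF S g])
  from measurable_compose[OF f this] show ?thesis using fS by simp
qed

text \<open>The interface between the energy estimate and the iteration. It mentions only Borel
  functions defined everywhere; the domain, the initial condition and the original \<open>u\<close>
  have been consumed. The gradient is assumed square integrable only on slabs with
  \<open>\<sigma> > 0\<close>, that is, away from the initial time.\<close>

locale local_solution = entropy_structure H F W1 M \<Lambda> p C1 C2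
  for H F W1 :: "real \<Rightarrow> real" and M \<Lambda> p C1 C2 +
  fixes v :: "'a::euclidean_space \<times> real \<Rightarrow> real" and G :: "'a \<times> real \<Rightarrow> 'a"
    and x0 :: 'a and R T K :: real
  assumes v_borel [measurable]: "v \<in> borel_measurable borel"
    and G_borel [measurable]: "G \<in> borel_measurable borel"
    and v_bounds: "0 \<le> v z" "v z \<le> M"
    and R_pos: "R > 0" and T_pos: "T > 0" and K_pos: "K > 0"
    and G_sq_integrable: "0 < \<sigma> \<Longrightarrow> s < T \<Longrightarrow>
          set_integrable lborel (cball x0 R \<times> {\<sigma>..s}) (\<lambda>z. (norm (G z))\<^sup>2)"
    and weak_gradient: "0 < \<sigma> \<Longrightarrow> s < T \<Longrightarrow> C1_derivative \<phi> \<phi>' \<Longrightarrow>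
          (\<And>z. z \<notin> cball x0 R \<times> {\<sigma>..s} \<Longrightarrow> \<phi> z = 0) \<Longrightarrow>
          (\<integral>z. v z * \<phi>' z (y, 0) \<partial>lborel) = - (\<integral>z. \<phi> z * (G z \<bullet> y) \<partial>lborel)"
    and energy_slice: "0 < \<rho> \<Longrightarrow> \<rho> \<le> R \<Longrightarrow> 0 < s \<Longrightarrow> s < T \<Longrightarrow>
          AE t in lborel. t \<in> {0<..<s} \<longrightarrow>
            (\<integral>\<^sup>+x. ennreal ((max 0 (\<rho>\<^sup>2 - (norm (x - x0))\<^sup>2))\<^sup>2 * H (v (x, t))) \<partial>lborel)
            \<le> ennreal (K * \<rho>\<^sup>2) * (\<integral>\<^sup>+z\<in>ball x0 \<rho> \<times> {0<..<s}. ennreal (H (v z) powr (1 + \<Lambda>)) \<partial>lborel)"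
    and energy_gradient: "0 < \<rho> \<Longrightarrow> \<rho> \<le> R \<Longrightarrow> 0 < s \<Longrightarrow> s < T \<Longrightarrow>
          (\<integral>\<^sup>+z\<in>UNIV \<times> {0<..<s}. ennreal ((max 0 (\<rho>\<^sup>2 - (norm (fst z - x0))\<^sup>2))\<^sup>2
              * (if v z = 0 then 0 else deriv F (v z)) * (norm (G z))\<^sup>2) \<partial>lborel)
            \<le> ennreal (K * \<rho>\<^sup>2) * (\<integral>\<^sup>+z\<in>ball x0 \<rho> \<times> {0<..<s}. ennreal (H (v z) powr (1 + \<Lambda>)) \<partial>lborel)"
begin

definition Z :: "real \<Rightarrow> real \<Rightarrow> ennreal" where
  "Z \<rho> s = (\<integral>\<^sup>+z\<in>ball x0 \<rho> \<times> {0<..<s}. ennreal (H (v z) powr (1 + \<Lambda>)) \<partial>lborel)"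

definition h where "h z = H (v z)"
definition w where "w z = H (v z) powr p"
text \<open>The square of the norm of what the chain rule predicts for the spatial gradient of
  \<open>w\<close>, as \<open>W1\<close> is the derivative of \<open>H^p\<close>.\<close>

definition g2 where "g2 z = (W1 (v z))\<^sup>2 * (norm (G z))\<^sup>2"

lemma v_in: "v z \<in> {0..M}" using v_bounds[of z] by simp

lemma h_borel [measurable]: "h \<in> borel_measurable borel"
  unfolding h_def by (rule borel_measurable_continuous_on_compose[OF H_continuous _ v_borel v_in]) simp

lemma W1_borel [measurable]: "(\<lambda>z. W1 (v z)) \<in> borel_measurable borel"
  by (rule borel_measurable_continuous_on_compose[OF W1_continuous _ v_borel v_in]) simp

lemma w_borel [measurable]: "w \<in> borel_measurable borel"
  unfolding w_def h_def[symmetric] by measurable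

lemma g2_borel [measurable]: "g2 \<in> borel_measurable borel"
  unfolding g2_def by measurable

lemma h_nonneg: "h z \<ge> 0"
  using H_pos[of "v z"] H_0 v_bounds[of z] by (cases "v z = 0") (auto simp: h_def)

lemma w_eq: "w z = h z powr p" by (simp add: w_def h_def)

lemma w_nonneg: "w z \<ge> 0" by (simp add: w_def)

lemma g2_nonneg: "g2 z \<ge> 0" by (simp add: g2_def)

lemma h_bounded: obtains B where "B \<ge> 1" "\<And>z. h z \<le> B"
proof -
  have "bounded (H ` {0..M})"
    by (rule compact_imp_bounded, rule compact_continuous_image[OF H_continuous]) simp
  then obtain B where B: "\<forall>y\<in>H ` {0..M}. norm y \<le> B" unfolding bounded_iff by blast
  have "h z \<le> max 1 B" for z
  proof -
    have "norm (h z) \<le> B" using B v_in[of z] unfolding h_def by blast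
    then show ?thesis by simp
  qed
  then show ?thesis using that[of "max 1 B"] by auto
qed

lemma ball_borel [measurable]: "ball (c :: 'b::metric_space) e \<in> sets borel"
  by simp

lemma pair_sets [measurable]: "A \<in> sets borel \<Longrightarrow> B \<in> sets borel \<Longrightarrow> A \<times> B \<in> sets (borel :: ('a \<times> real) measure)"
  by (rule borel_Times)

lemma fst_borel [measurable]: "fst \<in> borel_measurable (borel :: ('a \<times> real) measure)"
  and snd_borel [measurable]: "snd \<in> borel_measurable (borel :: ('a \<times> real) measure)"
  by (intro borel_measurable_continuous_onI continuous_intros)+

text \<open>\<open>\<rho>'^2 - \<rho>^2 \<ge> \<rho>' (\<rho>' - \<rho>)\<close>. Keeping the factor
  \<open>\<rho>'\<close> pays off: its square cancels the \<open>\<rho>'^2\<close> on the right of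
  the energy bounds, so that the outer radius disappears from the constants.\<close>

lemma m_lower:
  assumes "0 < \<rho>" "\<rho> < \<rho>'" "x \<in> ball x0 \<rho>"
  shows "\<rho>'\<^sup>2 * (\<rho>' - \<rho>)\<^sup>2 \<le> (max 0 (\<rho>'\<^sup>2 - (norm (x - x0))\<^sup>2))\<^sup>2"
proof -
  have "norm (x - x0) \<le> \<rho>" using assms(3) by (simp add: dist_norm norm_minus_commute)
  then have "(norm (x - x0))\<^sup>2 \<le> \<rho>\<^sup>2" by (intro power_mono) auto
  moreover have "\<rho>' * (\<rho>' - \<rho>) \<le> \<rho>'\<^sup>2 - \<rho>\<^sup>2"
    using mult_nonneg_nonneg[of \<rho> "\<rho>' - \<rho>"] assms by (simp add: power2_eq_square algebra_simps)
  ultimately have "\<rho>' * (\<rho>' - \<rho>) \<le> max 0 (\<rho>'\<^sup>2 - (norm (x - x0))\<^sup>2)" by linarith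
  moreover have "0 \<le> \<rho>' * (\<rho>' - \<rho>)" using assms by simp
  ultimately have "(\<rho>' * (\<rho>' - \<rho>))\<^sup>2 \<le> (max 0 (\<rho>'\<^sup>2 - (norm (x - x0))\<^sup>2))\<^sup>2" by (intro power_mono)
  then show ?thesis by (simp add: power_mult_distrib)
qed

lemma rescale_bound:
  assumes r: "0 < \<rho>" "\<rho> < \<rho>'" "c \<ge> 0" and le: "ennreal (\<rho>'\<^sup>2 * (\<rho>' - \<rho>)\<^sup>2) * I \<le> ennreal c * (ennreal (K * \<rho>'\<^sup>2) * Y)"
  shows "I \<le> ennreal (c * K / (\<rho>' - \<rho>)\<^sup>2) * Y"
proof -
  define a where "a = \<rho>'\<^sup>2 * (\<rho>' - \<rho>)\<^sup>2"
  have a: "a > 0" using r by (simp add: a_def)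
  have "I = ennreal (1 / a) * (ennreal a * I)"
    using a by (simp add: mult.assoc[symmetric] ennreal_mult[symmetric])
  also have "\<dots> \<le> ennreal (1 / a) * (ennreal c * (ennreal (K * \<rho>'\<^sup>2) * Y))"
    using le unfolding a_def by (rule mult_left_mono) simp
  also have "\<dots> = ennreal (1 / a * (c * (K * \<rho>'\<^sup>2))) * Y"
    using a r K_pos by (simp add: mult.assoc[symmetric] ennreal_mult[symmetric])
  also have "1 / a * (c * (K * \<rho>'\<^sup>2)) = c * K / (\<rho>' - \<rho>)\<^sup>2"
    using r by (simp add: a_def)
  finally show ?thesis .
qed

lemma slice_bound:
  assumes r: "0 < \<rho>" "\<rho> < \<rho>'" "\<rho>' \<le> R" and s: "0 < s" "s < T"
  shows "AE t in lborel. t \<in> {0<..<s} \<longrightarrow>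
    (\<integral>\<^sup>+x\<in>ball x0 \<rho>. ennreal (h (x, t)) \<partial>lborel) \<le> ennreal (K / (\<rho>' - \<rho>)\<^sup>2) * Z \<rho>' s"
  using energy_slice[of \<rho>' s] r s
proof (simp, elim eventually_mono, intro impI)
  fix t
  let ?m = "\<lambda>x. max 0 (\<rho>'\<^sup>2 - (norm (x - x0))\<^sup>2)"
  assume t: "0 < t \<and> t < s"
  assume "0 < t \<and> t < s \<longrightarrow> (\<integral>\<^sup>+x. ennreal ((?m x)\<^sup>2 * H (v (x, t))) \<partial>lborel) \<le> ennreal (K * \<rho>'\<^sup>2) *
      (\<integral>\<^sup>+z\<in>ball x0 \<rho>' \<times> {0<..<s}. ennreal (H (v z) powr (1 + \<Lambda>)) \<partial>lborel)"
  with t have e: "(\<integral>\<^sup>+x. ennreal ((?m x)\<^sup>2 * h (x, t)) \<partial>lborel) \<le> ennreal (K * \<rho>'\<^sup>2) * Z \<rho>' s"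
    by (simp add: h_def Z_def)
  have "ennreal (\<rho>'\<^sup>2 * (\<rho>' - \<rho>)\<^sup>2) * (\<integral>\<^sup>+x\<in>ball x0 \<rho>. ennreal (h (x, t)) \<partial>lborel)
      = (\<integral>\<^sup>+x. ennreal (\<rho>'\<^sup>2 * (\<rho>' - \<rho>)\<^sup>2) * (ennreal (h (x, t)) * indicator (ball x0 \<rho>) x) \<partial>lborel)"
    by (rule nn_integral_cmult[symmetric]) measurable
  also have "\<dots> \<le> (\<integral>\<^sup>+x. ennreal ((?m x)\<^sup>2 * h (x, t)) \<partial>lborel)"
    using m_lower[OF r(1,2)] h_nonneg
    by (intro nn_integral_mono) (auto split: split_indicator simp: ennreal_mult[symmetric] intro!: ennreal_leI mult_right_mono)
  also note e
  finally show "(\<integral>\<^sup>+x\<in>ball x0 \<rho>. ennreal (h (x, t)) \<partial>lborel) \<le> ennreal (K / (\<rho>' - \<rho>)\<^sup>2) * Z \<rho>' s"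
    using rescale_bound[OF r(1,2), of 1] by simp
qed

text \<open>Combines \<open>W1^2 \<le> C2 F'\<close> with the weighted energy; where
  \<open>v = 0\<close> both sides vanish because \<open>W1 0 = 0\<close>.\<close>

lemma gradient_bound:
  assumes r: "0 < \<rho>" "\<rho> < \<rho>'" "\<rho>' \<le> R" and s: "0 < s" "s < T"
  shows "(\<integral>\<^sup>+z\<in>ball x0 \<rho> \<times> {0<..<s}. ennreal (g2 z) \<partial>lborel) \<le> ennreal (C2 * K / (\<rho>' - \<rho>)\<^sup>2) * Z \<rho>' s"
proof (rule rescale_bound[OF r(1,2)])
  let ?m = "\<lambda>x. max 0 (\<rho>'\<^sup>2 - (norm (x - x0))\<^sup>2)"
  let ?F = "\<lambda>z. if v z = 0 then 0 else deriv F (v z)"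
  have F: "(W1 (v z))\<^sup>2 \<le> C2 * ?F z" "?F z \<ge> 0" for z
    using W1_sq_le[of "v z"] F'_nonneg[of "v z"] v_bounds[of z] W1_0 by auto
  have [measurable]: "?F \<in> borel_measurable borel"
  proof -
    have "(\<lambda>y. indicator {0<..M} y *\<^sub>R deriv F y) \<in> borel_measurable borel"
      by (rule borel_measurable_continuous_on_indicator[OF _ F'_continuous]) simp
    then have "(\<lambda>z. indicator {0<..M} (v z) *\<^sub>R deriv F (v z)) \<in> borel_measurable borel"
      by (rule measurable_compose[OF v_borel])
    also have "(\<lambda>z. indicator {0<..M} (v z) *\<^sub>R deriv F (v z)) = ?F"
      using v_bounds by (auto simp: fun_eq_iff indicator_def less_le)
    finally show ?thesis .
  qed
  have "ennreal (\<rho>'\<^sup>2 * (\<rho>' - \<rho>)\<^sup>2) * (\<integral>\<^sup>+z\<in>ball x0 \<rho> \<times> {0<..<s}. ennreal (g2 z) \<partial>lborel)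
      = (\<integral>\<^sup>+z. ennreal (\<rho>'\<^sup>2 * (\<rho>' - \<rho>)\<^sup>2) * (ennreal (g2 z) * indicator (ball x0 \<rho> \<times> {0<..<s}) z) \<partial>lborel)"
    by (rule nn_integral_cmult[symmetric]) measurable
  also have "\<dots> \<le> (\<integral>\<^sup>+z. ennreal C2 * (ennreal ((?m (fst z))\<^sup>2 * ?F z * (norm (G z))\<^sup>2) * indicator (UNIV \<times> {0<..<s}) z) \<partial>lborel)"
  proof (rule nn_integral_mono)
    fix z :: "'a \<times> real"
    show "ennreal (\<rho>'\<^sup>2 * (\<rho>' - \<rho>)\<^sup>2) * (ennreal (g2 z) * indicator (ball x0 \<rho> \<times> {0<..<s}) z)
      \<le> ennreal C2 * (ennreal ((?m (fst z))\<^sup>2 * ?F z * (norm (G z))\<^sup>2) * indicator (UNIV \<times> {0<..<s}) z)"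
    proof (cases "z \<in> ball x0 \<rho> \<times> {0<..<s}")
      case True
      have "(\<rho>'\<^sup>2 * (\<rho>' - \<rho>)\<^sup>2) * g2 z \<le> (?m (fst z))\<^sup>2 * ((C2 * ?F z) * (norm (G z))\<^sup>2)"
        unfolding g2_def using True m_lower[OF r(1,2), of "fst z"] F[of z]
        by (intro mult_mono mult_right_mono) auto
      then have "ennreal ((\<rho>'\<^sup>2 * (\<rho>' - \<rho>)\<^sup>2) * g2 z) \<le> ennreal (C2 * ((?m (fst z))\<^sup>2 * ?F z * (norm (G z))\<^sup>2))"
        by (intro ennreal_leI) (simp add: mult_ac)
      also have "\<dots> = ennreal C2 * ennreal ((?m (fst z))\<^sup>2 * ?F z * (norm (G z))\<^sup>2)"
        using C2_pos F(2)[of z] by (intro ennreal_mult) auto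
      finally have "ennreal (\<rho>'\<^sup>2 * (\<rho>' - \<rho>)\<^sup>2) * ennreal (g2 z)
          \<le> ennreal C2 * ennreal ((?m (fst z))\<^sup>2 * ?F z * (norm (G z))\<^sup>2)"
        using g2_nonneg[of z] by (subst ennreal_mult[symmetric]) auto
      moreover have "z \<in> UNIV \<times> {0<..<s}" using True by auto
      ultimately show ?thesis using True by (simp only: indicator_simps mult_1_right)
    qed simp
  qed
  also have "\<dots> = ennreal C2 * (\<integral>\<^sup>+z\<in>UNIV \<times> {0<..<s}. ennreal ((?m (fst z))\<^sup>2 * ?F z * (norm (G z))\<^sup>2) \<partial>lborel)"
    by (rule nn_integral_cmult) measurable
  also have "\<dots> \<le> ennreal C2 * (ennreal (K * \<rho>'\<^sup>2) * Z \<rho>' s)"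
    unfolding Z_def using r s by (intro mult_left_mono energy_gradient) auto
  finally show "ennreal (\<rho>'\<^sup>2 * (\<rho>' - \<rho>)\<^sup>2) * (\<integral>\<^sup>+z\<in>ball x0 \<rho> \<times> {0<..<s}. ennreal (g2 z) \<partial>lborel)
    \<le> ennreal C2 * (ennreal (K * \<rho>'\<^sup>2) * Z \<rho>' s)" .
qed (use C2_pos in simp)


section \<open>Translations of \<open>w\<close> in space\<close>

lemma w_deriv: "y \<in> {0..M} \<Longrightarrow> ((\<lambda>s. H s powr p) has_real_derivative W1 y) (at y within {0..M})"
  using W_deriv[of y] by auto

lemma AE_increment:
  assumes r: "0 < \<rho>" "\<rho> < \<rho>'" "\<rho>' \<le> R" and s: "0 < s" "s < T" and y: "norm y \<le> \<rho>' - \<rho>"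
  shows "AE z in lborel. z \<in> ball x0 \<rho> \<times> {0<..<s} \<longrightarrow> ennreal ((w (z + (y, 0)) - w z)\<^sup>2)
    \<le> (\<integral>\<^sup>+\<tau>. ennreal (indicator {0..1} \<tau> * (W1 (v (z + \<tau> *\<^sub>R (y, 0))) * (G (z + \<tau> *\<^sub>R (y, 0)) \<bullet> y))\<^sup>2) \<partial>lborel)"
proof -
  let ?V = "(y, 0) :: 'a \<times> real"
  \<comment> \<open>Square integrability of \<open>G\<close> is available only for times bounded
    away from 0. The estimate is therefore proved on slabs starting at \<open>1 / (n + 1)\<close>,
    and countably many of them cover the cylinder.\<close>
  have "AE z in lborel. z \<in> ball x0 \<rho> \<times> {inverse (real (Suc n))<..<s} \<longrightarrow> ennreal ((w (z + ?V) - w z)\<^sup>2)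
    \<le> (\<integral>\<^sup>+\<tau>. ennreal (indicator {0..1} \<tau> * (W1 (v (z + \<tau> *\<^sub>R ?V)) * (G (z + \<tau> *\<^sub>R ?V) \<bullet> y))\<^sup>2) \<partial>lborel)" for n
  proof -
    define \<sigma> where "\<sigma> = inverse (real (Suc n))"
    have \<sigma>: "\<sigma> > 0" by (simp add: \<sigma>_def)
    define Q where "Q = cball x0 R \<times> {\<sigma>..s}"
    have Qc: "compact Q" unfolding Q_def by (intro compact_Times) auto
    have Q [measurable]: "Q \<in> sets borel" using Qc by (rule borel_compact)
    have Qfin: "emeasure lborel Q < \<infinity>" using Qc by (rule emeasure_compact_finite)
    have i1: "integrable lborel (indicator Q :: _ \<Rightarrow> real)"
      using Qfin by (intro integrable_real_indicator) auto
    \<comment> \<open>Truncation to the compact set \<open>Q\<close> makes the functions integrable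
      on the whole space. The weak identity survives because the admissible test functions vanish
      outside \<open>Q\<close>.\<close>
    define f where "f z = indicator Q z * v z" for z
    define k where "k z = indicator Q z * (G z \<bullet> y)" for z
    have fi: "integrable lborel f"
      unfolding f_def
      by (rule Bochner_Integration.integrable_bound[OF integrable_mult_right[OF i1, of M]])
        (use v_bounds M_pos in \<open>auto intro!: AE_I2 split: split_indicator\<close>)
    have ki: "integrable lborel k"
    proof (rule Bochner_Integration.integrable_bound)
      have "integrable lborel (\<lambda>z. indicator Q z *\<^sub>R (norm (G z))\<^sup>2)"
        using G_sq_integrable[OF \<sigma> s(2)] unfolding set_integrable_def Q_def .
      then show "integrable lborel (\<lambda>z. norm y * (indicator Q z + indicator Q z *\<^sub>R (norm (G z))\<^sup>2))"
        using i1 by (intro integrable_mult_right Bochner_Integration.integrable_add)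
      have "norm (k z) \<le> norm (norm y * (indicator Q z + indicator Q z *\<^sub>R (norm (G z))\<^sup>2))" for z
      proof (cases "z \<in> Q")
        case True
        have "norm (k z) \<le> norm (G z) * norm y"
          using True by (simp add: k_def Cauchy_Schwarz_ineq2)
        also have "\<dots> \<le> (1 + (norm (G z))\<^sup>2) * norm y"
          using zero_le_power2[of "norm (G z) - 1"] by (intro mult_right_mono norm_ge_zero)
            (simp add: power2_eq_square algebra_simps, use norm_ge_zero[of "G z"] in linarith)
        finally show ?thesis using True by (simp add: mult.commute)
      qed (simp add: k_def)
      then show "AE z in lborel. norm (k z) \<le> norm (norm y * (indicator Q z + indicator Q z *\<^sub>R (norm (G z))\<^sup>2))"
        by (rule AE_I2)
    qed (simp add: k_def[abs_def])
    have seg: "z + \<tau> *\<^sub>R ?V \<in> Q" if "z \<in> ball x0 \<rho> \<times> {\<sigma><..<s}" "0 \<le> \<tau>" "\<tau> \<le> 1" for z \<tau>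
    proof -
      have "norm (\<tau> *\<^sub>R y) \<le> norm y" using that by (simp add: mult_left_le_one_le)
      then have "dist x0 (fst z + \<tau> *\<^sub>R y) \<le> R"
        using that r y dist_triangle[of x0 "fst z + \<tau> *\<^sub>R y" "fst z"] by (auto simp: dist_norm)
      then show ?thesis using that by (auto simp: Q_def)
    qed
    have "AE z in lborel. z \<in> ball x0 \<rho> \<times> {\<sigma><..<s} \<longrightarrow> ennreal ((H (f (z + ?V)) powr p - H (f z) powr p)\<^sup>2)
      \<le> (\<integral>\<^sup>+\<tau>. ennreal (indicator {0..1} \<tau> * (W1 (f (z + \<tau> *\<^sub>R ?V)) * k (z + \<tau> *\<^sub>R ?V))\<^sup>2) \<partial>lborel)"
    proof (rule chain_rule_segment[OF fi ki _ _ seg _ w_deriv W1_continuous])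
      fix \<phi> \<phi>' assume \<phi>: "C1_derivative \<phi> \<phi>'" "\<And>z. z \<notin> Q \<Longrightarrow> \<phi> z = 0"
      \<comment> \<open>\<open>Q\<close> is closed, so \<open>\<phi>\<close> vanishes in a
        neighbourhood of each point outside it.\<close>
      have zero: "\<phi>' z ?V = 0" if "z \<notin> Q" for z
      proof -
        have "(\<phi> has_derivative blinfun_apply (\<phi>' z)) (at z)" using \<phi>(1) unfolding C1_derivative_def by blast
        moreover have "(\<phi> has_derivative (\<lambda>_. 0)) (at z)"
          by (rule has_derivative_transform_within_open[of "\<lambda>_. 0" _ z UNIV "- Q"])
            (use that \<phi>(2) compact_imp_closed[OF Qc] in \<open>auto simp: open_Compl\<close>)
        ultimately show ?thesis using has_derivative_unique by metis
      qed
      have "(\<integral>z. f z * \<phi>' z ?V \<partial>lborel) = (\<integral>z. v z * \<phi>' z ?V \<partial>lborel)"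
        using zero by (intro Bochner_Integration.integral_cong) (auto simp: f_def indicator_def)
      also have "\<dots> = - (\<integral>z. \<phi> z * (G z \<bullet> y) \<partial>lborel)"
        by (rule weak_gradient[OF \<sigma> s(2) \<phi>(1)]) (use \<phi>(2) in \<open>simp add: Q_def\<close>)
      also have "(\<integral>z. \<phi> z * (G z \<bullet> y) \<partial>lborel) = (\<integral>z. \<phi> z * k z \<partial>lborel)"
        using \<phi>(2) by (intro Bochner_Integration.integral_cong) (auto simp: k_def indicator_def)
      finally show "(\<integral>z. f z * \<phi>' z ?V \<partial>lborel) = - (\<integral>z. \<phi> z * k z \<partial>lborel)" .
    next
      show "open (ball x0 \<rho> \<times> {\<sigma><..<s})" by (intro open_Times) auto
      show "f z \<in> {0..M}" for z using v_bounds M_pos by (auto simp: f_def indicator_def)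
    qed
    then show ?thesis
      unfolding \<sigma>_def[symmetric]
    proof eventually_elim
      case (elim z)
      show ?case
      proof
        assume z: "z \<in> ball x0 \<rho> \<times> {\<sigma><..<s}"
        have "f (z + \<tau> *\<^sub>R ?V) = v (z + \<tau> *\<^sub>R ?V)" "k (z + \<tau> *\<^sub>R ?V) = G (z + \<tau> *\<^sub>R ?V) \<bullet> y" if "\<tau> \<in> {0..1}" for \<tau>
          using seg[OF z, of \<tau>] that by (auto simp: f_def k_def)
        then have "indicator {0..1} \<tau> * (W1 (f (z + \<tau> *\<^sub>R ?V)) * k (z + \<tau> *\<^sub>R ?V))\<^sup>2
            = indicator {0..1} \<tau> * (W1 (v (z + \<tau> *\<^sub>R ?V)) * (G (z + \<tau> *\<^sub>R ?V) \<bullet> y))\<^sup>2" for \<tau> :: real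
          by (cases "\<tau> \<in> {0..1}") simp_all
        moreover have "f (z + ?V) = v (z + ?V)" "f z = v z"
          using seg[OF z, of 1] seg[OF z, of 0] by (simp_all add: f_def zero_prod_def[symmetric])
        ultimately show "ennreal ((w (z + ?V) - w z)\<^sup>2)
          \<le> (\<integral>\<^sup>+\<tau>. ennreal (indicator {0..1} \<tau> * (W1 (v (z + \<tau> *\<^sub>R ?V)) * (G (z + \<tau> *\<^sub>R ?V) \<bullet> y))\<^sup>2) \<partial>lborel)"
          using elim[rule_format, OF z] unfolding w_def by (simp only:)
      qed
    qed
  qed
  then have "AE z in lborel. \<forall>n. z \<in> ball x0 \<rho> \<times> {inverse (real (Suc n))<..<s} \<longrightarrow> ennreal ((w (z + ?V) - w z)\<^sup>2)
    \<le> (\<integral>\<^sup>+\<tau>. ennreal (indicator {0..1} \<tau> * (W1 (v (z + \<tau> *\<^sub>R ?V)) * (G (z + \<tau> *\<^sub>R ?V) \<bullet> y))\<^sup>2) \<partial>lborel)"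
    by (rule AE_all_countable[THEN iffD2, rule_format])
  then show ?thesis
  proof eventually_elim
    case (elim z)
    show ?case
    proof
      assume z: "z \<in> ball x0 \<rho> \<times> {0<..<s}"
      then obtain n where "inverse (real (Suc n)) < snd z" using reals_Archimedean[of "snd z"] by auto
      then have "z \<in> ball x0 \<rho> \<times> {inverse (real (Suc n))<..<s}" using z by auto
      then show "ennreal ((w (z + ?V) - w z)\<^sup>2)
        \<le> (\<integral>\<^sup>+\<tau>. ennreal (indicator {0..1} \<tau> * (W1 (v (z + \<tau> *\<^sub>R ?V)) * (G (z + \<tau> *\<^sub>R ?V) \<bullet> y))\<^sup>2) \<partial>lborel)"
        using elim by blast
    qed
  qed
qed

text \<open>Integrating \<open>AE_increment\<close> and applying Tonelli, every translate by
  \<open>\<tau> y\<close> with \<open>\<tau>\<close> in \<open>[0, 1]\<close> contributes the same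
  integral; \<open>norm y \<le> \<delta>\<close> accounts for the factor \<open>\<delta>^2\<close>.
  The larger ball is needed to contain the translated points.\<close>

lemma translation_L2:
  assumes r: "0 < \<rho>" "\<rho> < \<rho>'" "\<rho>' \<le> R" and s: "0 < s" "s < T" and y: "norm y \<le> \<delta>" "\<delta> \<le> \<rho>' - \<rho>"
  shows "(\<integral>\<^sup>+z\<in>ball x0 \<rho> \<times> {0<..<s}. ennreal ((w (z + (y, 0)) - w z)\<^sup>2) \<partial>lborel)
    \<le> ennreal (\<delta>\<^sup>2) * (\<integral>\<^sup>+z\<in>ball x0 \<rho>' \<times> {0<..<s}. ennreal (g2 z) \<partial>lborel)"
proof -
  let ?V = "(y, 0) :: 'a \<times> real"
  let ?A = "ball x0 \<rho> \<times> {0<..<s}" and ?A' = "ball x0 \<rho>' \<times> {0<..<s}"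
  define q where "q z = ennreal ((W1 (v z) * (G z \<bullet> y))\<^sup>2) * indicator ?A' z" for z
  have [measurable]: "q \<in> borel_measurable borel" unfolding q_def by measurable
  have "(\<integral>\<^sup>+z\<in>?A. ennreal ((w (z + ?V) - w z)\<^sup>2) \<partial>lborel)
    \<le> (\<integral>\<^sup>+z. (\<integral>\<^sup>+\<tau>. indicator {0..1} \<tau> * q (z + \<tau> *\<^sub>R ?V) \<partial>lborel) \<partial>lborel)"
  proof (rule nn_integral_mono_AE)
    have "norm y \<le> \<rho>' - \<rho>" using y by simp
    from AE_increment[OF r s this]
    show "AE z in lborel. ennreal ((w (z + ?V) - w z)\<^sup>2) * indicator ?A z \<le> (\<integral>\<^sup>+\<tau>. indicator {0..1} \<tau> * q (z + \<tau> *\<^sub>R ?V) \<partial>lborel)"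
    proof eventually_elim
      case (elim z)
      show ?case
      proof (cases "z \<in> ?A")
        case True
        have "z + \<tau> *\<^sub>R ?V \<in> ?A'" if "\<tau> \<in> {0..1}" for \<tau>
        proof -
          have "norm (\<tau> *\<^sub>R y) \<le> norm y" using that by (simp add: mult_left_le_one_le)
          then have "dist x0 (fst z + \<tau> *\<^sub>R y) < \<rho>'"
            using True y dist_triangle[of x0 "fst z + \<tau> *\<^sub>R y" "fst z"] by (auto simp: dist_norm)
          then show ?thesis using True by auto
        qed
        then have "(\<integral>\<^sup>+\<tau>. ennreal (indicator {0..1} \<tau> * (W1 (v (z + \<tau> *\<^sub>R ?V)) * (G (z + \<tau> *\<^sub>R ?V) \<bullet> y))\<^sup>2) \<partial>lborel)
          = (\<integral>\<^sup>+\<tau>. indicator {0..1} \<tau> * q (z + \<tau> *\<^sub>R ?V) \<partial>lborel)"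
          by (intro nn_integral_cong) (auto simp: q_def split: split_indicator)
        then show ?thesis using elim True by simp
      qed simp
    qed
  qed
  also have "\<dots> = (\<integral>\<^sup>+\<tau>. (\<integral>\<^sup>+z. indicator {0..1} \<tau> * q (z + \<tau> *\<^sub>R ?V) \<partial>lborel) \<partial>lborel)"
    by (rule lborel_pair.Fubini'[symmetric]) measurable
  also have "\<dots> = (\<integral>\<^sup>+\<tau>. indicator {0..1::real} \<tau> * (\<integral>\<^sup>+z. q z \<partial>lborel) \<partial>lborel)"
    by (intro nn_integral_cong) (simp add: nn_integral_cmult nn_integral_lborel_translate)
  also have "\<dots> = (\<integral>\<^sup>+z. q z \<partial>lborel)"
    by (simp add: nn_integral_multc)
  also have "\<dots> \<le> (\<integral>\<^sup>+z. ennreal (\<delta>\<^sup>2) * (ennreal (g2 z) * indicator ?A' z) \<partial>lborel)"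
  proof (rule nn_integral_mono)
    fix z :: "'a \<times> real"
    have "\<bar>G z \<bullet> y\<bar> \<le> norm (G z) * \<delta>"
      using Cauchy_Schwarz_ineq2[of "G z" y] mult_left_mono[OF y(1), of "norm (G z)"] by simp
    then have "(G z \<bullet> y)\<^sup>2 \<le> (norm (G z) * \<delta>)\<^sup>2" by (metis abs_ge_zero power2_abs power_mono)
    then have "(W1 (v z) * (G z \<bullet> y))\<^sup>2 \<le> (W1 (v z))\<^sup>2 * (norm (G z) * \<delta>)\<^sup>2"
      unfolding power_mult_distrib[of "W1 (v z)"] by (rule mult_left_mono) simp
    then have "(W1 (v z) * (G z \<bullet> y))\<^sup>2 \<le> \<delta>\<^sup>2 * g2 z"
      by (simp add: g2_def power_mult_distrib mult_ac)
    then show "q z \<le> ennreal (\<delta>\<^sup>2) * (ennreal (g2 z) * indicator ?A' z)"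
      using g2_nonneg[of z] by (auto simp: q_def ennreal_mult[symmetric] ennreal_leI split: split_indicator)
  qed
  also have "\<dots> = ennreal (\<delta>\<^sup>2) * (\<integral>\<^sup>+z\<in>?A'. ennreal (g2 z) \<partial>lborel)"
    by (rule nn_integral_cmult) measurable
  finally show ?thesis .
qed


section \<open>Slicing in time and the Nash inequality\<close>

lemma nn_integral_cylinder:
  fixes f :: "'a \<times> real \<Rightarrow> ennreal"
  assumes [measurable]: "f \<in> borel_measurable borel"
  shows "(\<integral>\<^sup>+z\<in>ball x0 \<rho> \<times> {0<..<s}. f z \<partial>lborel)
    = (\<integral>\<^sup>+t\<in>{0<..<s}. (\<integral>\<^sup>+x\<in>ball x0 \<rho>. f (x, t) \<partial>lborel) \<partial>lborel)"
proof -
  have "(\<integral>\<^sup>+z\<in>ball x0 \<rho> \<times> {0<..<s}. f z \<partial>lborel)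
      = (\<integral>\<^sup>+z. f z * indicator (ball x0 \<rho> \<times> {0<..<s}) z \<partial>(lborel \<Otimes>\<^sub>M lborel))"
    by (simp add: lborel_prod)
  also have "\<dots> = (\<integral>\<^sup>+t. (\<integral>\<^sup>+x. f (x, t) * indicator (ball x0 \<rho> \<times> {0<..<s}) (x, t) \<partial>lborel) \<partial>lborel)"
    by (rule lborel_pair.nn_integral_snd[symmetric]) (simp add: lborel_prod)
  also have "\<dots> = (\<integral>\<^sup>+t\<in>{0<..<s}. (\<integral>\<^sup>+x\<in>ball x0 \<rho>. f (x, t) \<partial>lborel) \<partial>lborel)"
  proof (rule nn_integral_cong)
    fix t :: real
    show "(\<integral>\<^sup>+x. f (x, t) * indicator (ball x0 \<rho> \<times> {0<..<s}) (x, t) \<partial>lborel)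
      = (\<integral>\<^sup>+x\<in>ball x0 \<rho>. f (x, t) \<partial>lborel) * indicator {0<..<s} t"
      by (cases "t \<in> {0<..<s}") (auto intro!: nn_integral_cong simp: indicator_def)
  qed
  finally show ?thesis .
qed

lemma cylinder_le_of_slices:
  fixes f :: "'a \<times> real \<Rightarrow> ennreal"
  assumes f: "f \<in> borel_measurable borel" and s: "s > 0"
    and le: "AE t in lborel. t \<in> {0<..<s} \<longrightarrow> (\<integral>\<^sup>+x\<in>ball x0 \<rho>. f (x, t) \<partial>lborel) \<le> E"
  shows "(\<integral>\<^sup>+z\<in>ball x0 \<rho> \<times> {0<..<s}. f z \<partial>lborel) \<le> E * ennreal s"
proof -
  have "(\<integral>\<^sup>+z\<in>ball x0 \<rho> \<times> {0<..<s}. f z \<partial>lborel) \<le> (\<integral>\<^sup>+t\<in>{0<..<s}. E \<partial>lborel)"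
    unfolding nn_integral_cylinder[OF f]
    using le by (intro nn_integral_mono_AE) (auto elim!: eventually_mono simp: indicator_def)
  also have "\<dots> = E * ennreal s" using s by (simp add: nn_integral_cmult_indicator)
  finally show ?thesis .
qed

text \<open>After averaging over \<open>y\<close>, the product \<open>w(x) w(x + y)\<close>
  decouples: at a fixed time each factor integrates to at most the slice mass \<open>E\<close>,
  which leaves \<open>E^2\<close> per slice. The radius \<open>\<delta>\<close> stays free so that
  the two terms can later be balanced.\<close>

lemma nash:
  assumes r: "0 < \<rho>" "\<rho> < \<rho>'" "\<rho>' \<le> R" and s: "0 < s" "s < T" and \<delta>: "0 < \<delta>" "\<delta> \<le> \<rho>' - \<rho>"
    and X: "(\<integral>\<^sup>+z\<in>ball x0 \<rho>' \<times> {0<..<s}. ennreal (g2 z) \<partial>lborel) \<le> ennreal X" "X \<ge> 0"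
    and E: "AE t in lborel. t \<in> {0<..<s} \<longrightarrow> (\<integral>\<^sup>+x\<in>ball x0 \<rho>'. ennreal (w (x, t)) \<partial>lborel) \<le> ennreal E" "E \<ge> 0"
  shows "(\<integral>\<^sup>+z\<in>ball x0 \<rho> \<times> {0<..<s}. ennreal ((w z)\<^sup>2) \<partial>lborel)
    \<le> ennreal (\<delta>\<^sup>2 * X + 2 * E\<^sup>2 * s / (unit_ball_vol (DIM('a)) * \<delta> ^ DIM('a)))"
proof -
  define \<beta> where "\<beta> = unit_ball_vol (DIM('a)) * \<delta> ^ DIM('a)"
  have \<beta>: "\<beta> > 0" using \<delta> by (simp add: \<beta>_def)
  let ?A = "ball x0 \<rho> \<times> {0<..<s}"
  define Q where "Q = (\<integral>\<^sup>+z\<in>?A. ennreal ((w z)\<^sup>2) \<partial>lborel)"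
  have em: "emeasure lborel (ball (0::'a) \<delta>) = ennreal \<beta>"
    using \<delta> by (simp add: emeasure_ball \<beta>_def)
  \<comment> \<open>The left side does not depend on \<open>y\<close>, which is why the inequality
    may be averaged over the ball of radius \<open>\<delta>\<close>.\<close>
  have one: "Q \<le> ennreal (\<delta>\<^sup>2 * X) + 2 * (\<integral>\<^sup>+z\<in>?A. ennreal (w z) * ennreal (w (z + (y, 0))) \<partial>lborel)"
    if y: "y \<in> ball 0 \<delta>" for y
  proof -
    have "Q \<le> (\<integral>\<^sup>+z. ennreal ((w (z + (y, 0)) - w z)\<^sup>2) * indicator ?A z
        + 2 * (ennreal (w z) * ennreal (w (z + (y, 0))) * indicator ?A z) \<partial>lborel)"
      unfolding Q_def
    proof (rule nn_integral_mono)
      fix z :: "'a \<times> real"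
      have "(w z)\<^sup>2 \<le> (w (z + (y, 0)) - w z)\<^sup>2 + 2 * (w z * w (z + (y, 0)))"
        by (simp add: power2_diff)
      then have "ennreal ((w z)\<^sup>2) \<le> ennreal ((w (z + (y, 0)) - w z)\<^sup>2 + 2 * (w z * w (z + (y, 0))))"
        by (rule ennreal_leI)
      also have "\<dots> = ennreal ((w (z + (y, 0)) - w z)\<^sup>2) + ennreal (2 * (w z * w (z + (y, 0))))"
        using w_nonneg[of z] w_nonneg[of "z + (y, 0)"] by (intro ennreal_plus) simp_all
      also have "ennreal (2 * (w z * w (z + (y, 0)))) = 2 * (ennreal (w z) * ennreal (w (z + (y, 0))))"
        using w_nonneg by (simp add: ennreal_mult)
      finally show "ennreal ((w z)\<^sup>2) * indicator ?A z \<le> ennreal ((w (z + (y, 0)) - w z)\<^sup>2) * indicator ?A z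
        + 2 * (ennreal (w z) * ennreal (w (z + (y, 0))) * indicator ?A z)"
        by (auto split: split_indicator)
    qed
    also have "\<dots> = (\<integral>\<^sup>+z\<in>?A. ennreal ((w (z + (y, 0)) - w z)\<^sup>2) \<partial>lborel)
        + 2 * (\<integral>\<^sup>+z\<in>?A. ennreal (w z) * ennreal (w (z + (y, 0))) \<partial>lborel)"
      by (simp add: nn_integral_add nn_integral_cmult)
    also have "(\<integral>\<^sup>+z\<in>?A. ennreal ((w (z + (y, 0)) - w z)\<^sup>2) \<partial>lborel) \<le> ennreal (\<delta>\<^sup>2) * ennreal X"
      by (rule order_trans[OF translation_L2[OF r s _ \<delta>(2)] mult_left_mono[OF X(1)]]) (use y in simp_all)
    finally show ?thesis using X(2) by (simp add: ennreal_mult add_mono)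
  qed
  have wE: "AE t in lborel. t \<in> {0<..<s} \<longrightarrow> (\<integral>\<^sup>+x\<in>ball x0 \<rho>. ennreal (w (x, t)) * (\<integral>\<^sup>+y\<in>ball 0 \<delta>. ennreal (w (x + y, t)) \<partial>lborel) \<partial>lborel) \<le> ennreal (E\<^sup>2)"
    using E(1)
  proof eventually_elim
    case (elim t)
    show ?case
    proof
      assume "t \<in> {0<..<s}"
      with elim have Et: "(\<integral>\<^sup>+x\<in>ball x0 \<rho>'. ennreal (w (x, t)) \<partial>lborel) \<le> ennreal E" by simp
      have inner: "(\<integral>\<^sup>+y\<in>ball 0 \<delta>. ennreal (w (x + y, t)) \<partial>lborel) \<le> ennreal E" if x: "x \<in> ball x0 \<rho>" for x
      proof -
        have "(\<integral>\<^sup>+y\<in>ball 0 \<delta>. ennreal (w (x + y, t)) \<partial>lborel)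
          \<le> (\<integral>\<^sup>+y. ennreal (w (y + x, t)) * indicator (ball x0 \<rho>') (y + x) \<partial>lborel)"
        proof (rule nn_integral_mono)
          fix y
          have "y \<in> ball 0 \<delta> \<Longrightarrow> y + x \<in> ball x0 \<rho>'"
            using x \<delta>(2) dist_triangle[of x0 "y + x" x] by (simp add: dist_norm)
          then show "ennreal (w (x + y, t)) * indicator (ball 0 \<delta>) y \<le> ennreal (w (y + x, t)) * indicator (ball x0 \<rho>') (y + x)"
            by (auto split: split_indicator simp: add.commute)
        qed
        also have "\<dots> = (\<integral>\<^sup>+x\<in>ball x0 \<rho>'. ennreal (w (x, t)) \<partial>lborel)"
          by (rule nn_integral_lborel_translate) measurable
        finally show ?thesis using Et by simp
      qed
      have "(\<integral>\<^sup>+x\<in>ball x0 \<rho>. ennreal (w (x, t)) * (\<integral>\<^sup>+y\<in>ball 0 \<delta>. ennreal (w (x + y, t)) \<partial>lborel) \<partial>lborel)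
        \<le> (\<integral>\<^sup>+x. (ennreal (w (x, t)) * indicator (ball x0 \<rho>') x) * ennreal E \<partial>lborel)"
      proof (rule nn_integral_mono)
        fix x
        show "ennreal (w (x, t)) * (\<integral>\<^sup>+y\<in>ball 0 \<delta>. ennreal (w (x + y, t)) \<partial>lborel) * indicator (ball x0 \<rho>) x
          \<le> (ennreal (w (x, t)) * indicator (ball x0 \<rho>') x) * ennreal E"
        proof (cases "x \<in> ball x0 \<rho>")
          case True
          then have "x \<in> ball x0 \<rho>'" using r by auto
          then show ?thesis using inner[OF True] True by (simp add: mult_left_mono)
        qed simp
      qed
      also have "\<dots> = (\<integral>\<^sup>+x\<in>ball x0 \<rho>'. ennreal (w (x, t)) \<partial>lborel) * ennreal E"
        by (rule nn_integral_multc) measurable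
      also have "\<dots> \<le> ennreal E * ennreal E" using Et by (rule mult_right_mono) simp
      finally show "(\<integral>\<^sup>+x\<in>ball x0 \<rho>. ennreal (w (x, t)) * (\<integral>\<^sup>+y\<in>ball 0 \<delta>. ennreal (w (x + y, t)) \<partial>lborel) \<partial>lborel) \<le> ennreal (E\<^sup>2)"
        using E(2) by (simp add: ennreal_mult[symmetric] power2_eq_square)
    qed
  qed
  \<comment> \<open>The total of the product term over all shifts. Exchanging the integrals puts the
    shift innermost, where \<open>wE\<close> bounds it slice by slice.\<close>
  define L where "L = (\<integral>\<^sup>+y\<in>ball 0 \<delta>. (\<integral>\<^sup>+z\<in>?A. ennreal (w z) * ennreal (w (z + (y, 0))) \<partial>lborel) \<partial>lborel)"
  have "L = (\<integral>\<^sup>+y. (\<integral>\<^sup>+z. ennreal (w z) * ennreal (w (z + (y, 0))) * indicator ?A z * indicator (ball 0 \<delta>) y \<partial>lborel) \<partial>lborel)"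
    unfolding L_def by (intro nn_integral_cong nn_integral_multc[symmetric]) measurable
  also have "\<dots> = (\<integral>\<^sup>+z. (\<integral>\<^sup>+y. ennreal (w z) * ennreal (w (z + (y, 0))) * indicator ?A z * indicator (ball 0 \<delta>) y \<partial>lborel) \<partial>lborel)"
    by (rule lborel_pair.Fubini') measurable
  also have "\<dots> = (\<integral>\<^sup>+z\<in>?A. ennreal (w z) * (\<integral>\<^sup>+y\<in>ball 0 \<delta>. ennreal (w (fst z + y, snd z)) \<partial>lborel) \<partial>lborel)"
  proof (rule nn_integral_cong)
    fix z :: "'a \<times> real"
    have "(\<integral>\<^sup>+y. ennreal (w z) * ennreal (w (z + (y, 0))) * indicator ?A z * indicator (ball 0 \<delta>) y \<partial>lborel)
      = (\<integral>\<^sup>+y. (ennreal (w z) * indicator ?A z) * (ennreal (w (fst z + y, snd z)) * indicator (ball 0 \<delta>) y) \<partial>lborel)"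
      by (intro nn_integral_cong) (cases z, simp add: mult_ac)
    also have "\<dots> = (ennreal (w z) * indicator ?A z) * (\<integral>\<^sup>+y\<in>ball 0 \<delta>. ennreal (w (fst z + y, snd z)) \<partial>lborel)"
      by (rule nn_integral_cmult) measurable
    finally show "(\<integral>\<^sup>+y. ennreal (w z) * ennreal (w (z + (y, 0))) * indicator ?A z * indicator (ball 0 \<delta>) y \<partial>lborel)
      = ennreal (w z) * (\<integral>\<^sup>+y\<in>ball 0 \<delta>. ennreal (w (fst z + y, snd z)) \<partial>lborel) * indicator ?A z"
      by (simp add: mult_ac)
  qed
  also have "\<dots> \<le> ennreal (E\<^sup>2) * ennreal s"
    by (rule cylinder_le_of_slices[OF _ s(1)]) (use wE in simp_all)
  finally have L: "L \<le> ennreal (E\<^sup>2 * s)" using s by (simp add: ennreal_mult)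
  have "ennreal \<beta> * Q = (\<integral>\<^sup>+y\<in>ball (0::'a) \<delta>. Q \<partial>lborel)"
    by (simp add: nn_integral_cmult_indicator em mult.commute)
  also have "\<dots> \<le> (\<integral>\<^sup>+y. ennreal (\<delta>\<^sup>2 * X) * indicator (ball (0::'a) \<delta>) y
      + 2 * ((\<integral>\<^sup>+z\<in>?A. ennreal (w z) * ennreal (w (z + (y, 0))) \<partial>lborel) * indicator (ball 0 \<delta>) y) \<partial>lborel)"
    using one by (intro nn_integral_mono) (auto split: split_indicator)
  also have "\<dots> = ennreal (\<delta>\<^sup>2 * X) * ennreal \<beta> + 2 * L"
    unfolding L_def by (simp add: nn_integral_add nn_integral_cmult nn_integral_cmult_indicator em)
  also have "\<dots> \<le> ennreal (\<delta>\<^sup>2 * X) * ennreal \<beta> + 2 * ennreal (E\<^sup>2 * s)"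
    using L by (intro add_left_mono mult_left_mono) auto
  also have "\<dots> = ennreal (\<beta> * (\<delta>\<^sup>2 * X + 2 * E\<^sup>2 * s / \<beta>))"
  proof -
    have "2 * ennreal (E\<^sup>2 * s) = ennreal (2 * (E\<^sup>2 * s))" using s by (simp add: ennreal_mult)
    then show ?thesis using s X(2) \<beta>
      by (simp add: ennreal_mult[symmetric] ennreal_plus[symmetric] distrib_left mult_ac del: ennreal_plus)
  qed
  finally have "ennreal \<beta> * Q \<le> ennreal \<beta> * ennreal (\<delta>\<^sup>2 * X + 2 * E\<^sup>2 * s / \<beta>)"
    using \<beta> s X(2) by (simp add: ennreal_mult)
  then have "Q \<le> ennreal (\<delta>\<^sup>2 * X + 2 * E\<^sup>2 * s / \<beta>)"
    using \<beta> by (subst (asm) ennreal_mult_le_mult_iff) auto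
  then show ?thesis unfolding Q_def \<beta>_def .
qed


section \<open>Interpolation and the superlinear recursion\<close>

lemma interpolation:
  assumes \<eta>: "\<eta> > 0"
  shows "h z powr (1 + \<Lambda>) \<le> \<eta> powr \<Lambda> * h z + \<eta> powr (1 + \<Lambda> - 2 * p) * (w z)\<^sup>2"
proof -
  consider "h z = 0" | "0 < h z" "h z \<le> \<eta>" | "\<eta> < h z" using h_nonneg[of z] by linarith
  then show ?thesis
  proof cases
    case 1
    then show ?thesis using \<Lambda>_pos by simp
  next
    case 2
    have "h z powr (1 + \<Lambda>) = h z powr \<Lambda> * h z" using 2 by (simp add: powr_add)
    also have "\<dots> \<le> \<eta> powr \<Lambda> * h z"
      using 2 \<Lambda>_pos by (intro mult_right_mono powr_mono2) auto
    finally show ?thesis by (simp add: add_increasing2)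
  next
    case 3
    \<comment> \<open>Above the level the exponent \<open>1 + \<Lambda> - 2 p\<close> is negative,
      since \<open>p > 1 + \<Lambda>\<close>, so the power only grows when \<open>h z\<close> is
      replaced by \<open>\<eta>\<close>.\<close>
    have "h z powr (1 + \<Lambda>) = h z powr (1 + \<Lambda> - 2 * p) * (w z)\<^sup>2"
      by (simp add: w_eq power2_eq_square powr_add[symmetric])
    also have "\<dots> \<le> \<eta> powr (1 + \<Lambda> - 2 * p) * (w z)\<^sup>2"
      using 3 \<eta> p_ge \<Lambda>_pos by (intro mult_right_mono powr_mono2') auto
    finally show ?thesis using h_nonneg[of z] by (simp add: add_increasing)
  qed
qed

lemma Z_mono: "\<rho> \<le> \<rho>' \<Longrightarrow> Z \<rho> s \<le> Z \<rho>' s"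
  unfolding Z_def by (intro nn_integral_mono) (auto split: split_indicator)

text \<open>Measuring \<open>Z\<close> in units of the squared gap removes the gap from both energy
  bounds: slice masses and gradient energy become constant multiples of \<open>D\<close>. The gap
  reappears only through the Nash inequality, where the radius of averaging is proportional to
  it.\<close>

lemma iteration_step:
  obtains C \<kappa> where "C > 0" "\<kappa> > 0"
    "\<And>\<rho> \<rho>' s D. 0 < \<rho> \<Longrightarrow> \<rho> < \<rho>' \<Longrightarrow> \<rho>' \<le> R \<Longrightarrow> 0 < s \<Longrightarrow> s < T \<Longrightarrow> s \<le> 1 \<Longrightarrow> 0 < D \<Longrightarrow> D \<le> 1 \<Longrightarrow>
      Z \<rho>' s \<le> ennreal (D * (\<rho>' - \<rho>)\<^sup>2) \<Longrightarrow> Z \<rho> s \<le> ennreal (C / (\<rho>' - \<rho>) ^ DIM('a) * D powr (1 + \<kappa>))"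
proof -
  let ?N = "DIM('a)"
  obtain B where B: "B \<ge> 1" "\<And>z. h z \<le> B" using h_bounded by blast
  define B1 where "B1 = B powr (p - 1)"
  have B1: "B1 > 0" using B by (simp add: B1_def)
  have wh: "w z \<le> B1 * h z" for z
  proof (cases "h z = 0")
    case False
    then have h: "h z > 0" using h_nonneg[of z] by simp
    have "w z = h z powr (p - 1) * h z" using h by (simp add: w_eq powr_diff)
    also have "\<dots> \<le> B1 * h z"
      unfolding B1_def using h B p_ge \<Lambda>_pos by (intro mult_right_mono powr_mono2) auto
    finally show ?thesis .
  qed (use p_ge \<Lambda>_pos in \<open>simp add: w_eq\<close>)
  define \<beta>0 where "\<beta>0 = unit_ball_vol (real ?N)"
  have \<beta>0: "\<beta>0 > 0" by (simp add: \<beta>0_def)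
  \<comment> \<open>The gain of the Nash inequality: with mass and gradient energy of order
    \<open>D\<close>, the terms \<open>\<delta>^2 D\<close> and \<open>D^2 / \<delta>^N\<close>
    (here \<open>N\<close> is the dimension) are equal for \<open>\<delta> = D^(1/(N+2))\<close>,
    and both are then \<open>D^(1+\<kappa>0)\<close>.\<close>
  define \<kappa>0 where "\<kappa>0 = 2 / (real ?N + 2)"
  have \<kappa>0: "\<kappa>0 > 0" by (simp add: \<kappa>0_def)
  \<comment> \<open>Balances the two parts of the interpolation at level
    \<open>\<eta> = D^\<beta>\<close>: \<open>\<beta> \<Lambda> = \<beta> (1 + \<Lambda> - 2 p) +
    \<kappa>0\<close>, so both are of order \<open>D^(1+\<kappa>)\<close> with
    \<open>\<kappa> = \<beta> \<Lambda>\<close>.\<close>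
  define \<beta> where "\<beta> = \<kappa>0 / (2 * p - 1)"
  have p1: "2 * p - 1 > 0" using p_ge \<Lambda>_pos by simp
  have \<beta>: "\<beta> > 0" using \<kappa>0 p1 by (simp add: \<beta>_def)
  have \<beta>p: "\<beta> * (2 * p - 1) = \<kappa>0" using p1 by (simp add: \<beta>_def)
  define \<kappa> where "\<kappa> = \<beta> * \<Lambda>"
  \<comment> \<open>The two terms of \<open>nash\<close> with gradient energy
    \<open>4 C2 K D\<close> and slice mass \<open>4 K B1 D\<close>; the factors \<open>d^2\<close>
    and \<open>K\<close> are weakened to the common form \<open>1 / d^N\<close> by
    \<open>d \<le> R\<close>. The power \<open>2^N\<close> in \<open>C\<close> below undoes the
    halving of the gap.\<close>
  define C3 where "C3 = 4 * C2 * K * R ^ (?N + 2) + 32 * K\<^sup>2 * B1\<^sup>2 / \<beta>0"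
  have C3: "C3 > 0" using C2_pos K_pos R_pos B1 \<beta>0 by (simp add: C3_def add_pos_pos)
  define C where "C = 2 ^ ?N * (K * R ^ ?N + C3)"
  show ?thesis
  proof
    show "C > 0" using C3 K_pos R_pos by (simp add: C_def add_pos_pos)
    show "\<kappa> > 0" using \<beta> \<Lambda>_pos by (simp add: \<kappa>_def)
    fix \<rho> \<rho>' s D :: real
    assume r: "0 < \<rho>" "\<rho> < \<rho>'" "\<rho>' \<le> R" and s: "0 < s" "s < T" and s1: "s \<le> 1" and D: "0 < D" "D \<le> 1"
      and Z: "Z \<rho>' s \<le> ennreal (D * (\<rho>' - \<rho>)\<^sup>2)"
    \<comment> \<open>Half of the gap is spent on the energy bounds, from \<open>\<rho>'\<close> to
      \<open>\<rho>m\<close>, and half on the translations, from \<open>\<rho>m\<close> to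
      \<open>\<rho>\<close>.\<close>
    define d where "d = (\<rho>' - \<rho>) / 2"
    have d: "d > 0" "d \<le> R" "\<rho>' - \<rho> = 2 * d" using r by (auto simp: d_def)
    define \<rho>m where "\<rho>m = \<rho> + d"
    have rm: "0 < \<rho>m" "\<rho>m < \<rho>'" "\<rho> < \<rho>m" "\<rho>m \<le> R" "\<rho>' - \<rho>m = d" "\<rho>m - \<rho> = d"
      unfolding \<rho>m_def using r d by linarith+
    have Zc: "ennreal c * Z \<rho>' s \<le> ennreal (c * (D * (\<rho>' - \<rho>)\<^sup>2))" if "c \<ge> 0" for c
      using mult_left_mono[OF Z, of "ennreal c"] that D by (simp add: ennreal_mult)
    have slice_m: "AE t in lborel. t \<in> {0<..<s} \<longrightarrow> (\<integral>\<^sup>+x\<in>ball x0 \<rho>m. ennreal (w (x, t)) \<partial>lborel) \<le> ennreal (4 * K * B1 * D)"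
      using slice_bound[OF rm(1,2) r(3) s]
    proof eventually_elim
      case (elim t)
      show ?case
      proof
        assume "t \<in> {0<..<s}"
        with elim have "(\<integral>\<^sup>+x\<in>ball x0 \<rho>m. ennreal (h (x, t)) \<partial>lborel) \<le> ennreal (K / d\<^sup>2) * Z \<rho>' s" by (simp add: rm)
        also have "\<dots> \<le> ennreal (K / d\<^sup>2 * (D * (\<rho>' - \<rho>)\<^sup>2))" using K_pos by (intro Zc) simp
        also have "K / d\<^sup>2 * (D * (\<rho>' - \<rho>)\<^sup>2) = 4 * K * D" using d by (simp add: power_mult_distrib)
        finally have le: "(\<integral>\<^sup>+x\<in>ball x0 \<rho>m. ennreal (h (x, t)) \<partial>lborel) \<le> ennreal (4 * K * D)" .
        have "(\<integral>\<^sup>+x\<in>ball x0 \<rho>m. ennreal (w (x, t)) \<partial>lborel) \<le> (\<integral>\<^sup>+x. ennreal B1 * (ennreal (h (x, t)) * indicator (ball x0 \<rho>m) x) \<partial>lborel)"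
          using wh h_nonneg B1 by (intro nn_integral_mono) (auto simp: ennreal_mult[symmetric] ennreal_leI split: split_indicator)
        also have "\<dots> = ennreal B1 * (\<integral>\<^sup>+x\<in>ball x0 \<rho>m. ennreal (h (x, t)) \<partial>lborel)"
          by (rule nn_integral_cmult) measurable
        also have "\<dots> \<le> ennreal B1 * ennreal (4 * K * D)" by (rule mult_left_mono[OF le]) simp
        also have "\<dots> = ennreal (4 * K * B1 * D)" using B1 K_pos D by (simp add: ennreal_mult[symmetric] mult_ac)
        finally show "(\<integral>\<^sup>+x\<in>ball x0 \<rho>m. ennreal (w (x, t)) \<partial>lborel) \<le> ennreal (4 * K * B1 * D)" .
      qed
    qed
    have grad_m: "(\<integral>\<^sup>+z\<in>ball x0 \<rho>m \<times> {0<..<s}. ennreal (g2 z) \<partial>lborel) \<le> ennreal (4 * C2 * K * D)"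
    proof -
      have "(\<integral>\<^sup>+z\<in>ball x0 \<rho>m \<times> {0<..<s}. ennreal (g2 z) \<partial>lborel) \<le> ennreal (C2 * K / d\<^sup>2) * Z \<rho>' s"
        using gradient_bound[OF rm(1,2) r(3) s] by (simp add: rm)
      also have "\<dots> \<le> ennreal (C2 * K / d\<^sup>2 * (D * (\<rho>' - \<rho>)\<^sup>2))" using K_pos C2_pos by (intro Zc) simp
      also have "C2 * K / d\<^sup>2 * (D * (\<rho>' - \<rho>)\<^sup>2) = 4 * C2 * K * D" using d by (simp add: power_mult_distrib)
      finally show ?thesis .
    qed
    have h_int: "(\<integral>\<^sup>+z\<in>ball x0 \<rho> \<times> {0<..<s}. ennreal (h z) \<partial>lborel) \<le> ennreal (K * D)"
    proof -
      have "AE t in lborel. t \<in> {0<..<s} \<longrightarrow> (\<integral>\<^sup>+x\<in>ball x0 \<rho>. ennreal (h (x, t)) \<partial>lborel) \<le> ennreal (K * D)"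
        using slice_bound[OF r s]
      proof eventually_elim
        case (elim t)
        have "ennreal (K / (\<rho>' - \<rho>)\<^sup>2) * Z \<rho>' s \<le> ennreal (K / (\<rho>' - \<rho>)\<^sup>2 * (D * (\<rho>' - \<rho>)\<^sup>2))" using K_pos by (intro Zc) simp
        also have "K / (\<rho>' - \<rho>)\<^sup>2 * (D * (\<rho>' - \<rho>)\<^sup>2) = K * D" using r by simp
        finally show ?case using elim by auto
      qed
      then have "(\<integral>\<^sup>+z\<in>ball x0 \<rho> \<times> {0<..<s}. ennreal (h z) \<partial>lborel) \<le> ennreal (K * D) * ennreal s"
        by (intro cylinder_le_of_slices s) measurable
      also have "\<dots> \<le> ennreal (K * D)"
        using s s1 K_pos D by (simp add: ennreal_mult[symmetric] ennreal_leI mult_left_le)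
      finally show ?thesis .
    qed
    \<comment> \<open>The balancing radius scaled by the gap; \<open>D \<le> 1\<close> keeps the
      translates inside the ball of radius \<open>\<rho>m\<close>.\<close>
    define \<delta> where "\<delta> = d * D powr (1 / (real ?N + 2))"
    have D_le: "D powr (1 / (real ?N + 2)) \<le> 1" using D by (intro powr_le1) auto
    have \<delta>: "0 < \<delta>" "\<delta> \<le> \<rho>m - \<rho>"
      using d D D_le by (auto simp: \<delta>_def rm mult_left_le)
    have w_int: "(\<integral>\<^sup>+z\<in>ball x0 \<rho> \<times> {0<..<s}. ennreal ((w z)\<^sup>2) \<partial>lborel) \<le> ennreal (C3 / d ^ ?N * D powr (1 + \<kappa>0))"
    proof -
      have "(\<integral>\<^sup>+z\<in>ball x0 \<rho> \<times> {0<..<s}. ennreal ((w z)\<^sup>2) \<partial>lborel)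
        \<le> ennreal (\<delta>\<^sup>2 * (4 * C2 * K * D) + 2 * (4 * K * B1 * D)\<^sup>2 * s / (\<beta>0 * \<delta> ^ ?N))"
        unfolding \<beta>0_def
        by (rule nash[OF r(1) rm(3,4) s \<delta> grad_m _ slice_m]) (use C2_pos K_pos B1 D in auto)
      also have "\<dots> \<le> ennreal (C3 / d ^ ?N * D powr (1 + \<kappa>0))"
      proof (rule ennreal_leI)
        have dd: "d\<^sup>2 \<le> R ^ (?N + 2) / d ^ ?N"
        proof -
          have "d\<^sup>2 * d ^ ?N = d ^ (?N + 2)" by (simp add: power_add power2_eq_square)
          also have "\<dots> \<le> R ^ (?N + 2)" using d by (intro power_mono) auto
          finally show ?thesis using d by (simp add: pos_le_divide_eq)
        qed
        have e1: "(D powr (1 / (real ?N + 2)))\<^sup>2 * D = D powr (1 + \<kappa>0)"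
          using D by (simp add: power2_eq_square powr_add[symmetric] \<kappa>0_def powr_add)
        have "\<delta>\<^sup>2 * (4 * C2 * K * D) = 4 * C2 * K * d\<^sup>2 * D powr (1 + \<kappa>0)"
          unfolding e1[symmetric] by (simp add: \<delta>_def power_mult_distrib)
        also have "\<dots> \<le> 4 * C2 * K * (R ^ (?N + 2) / d ^ ?N) * D powr (1 + \<kappa>0)"
          using dd C2_pos K_pos by (intro mult_right_mono mult_left_mono) auto
        finally have t1: "\<delta>\<^sup>2 * (4 * C2 * K * D) \<le> 4 * C2 * K * R ^ (?N + 2) / d ^ ?N * D powr (1 + \<kappa>0)" by simp
        have e2: "D\<^sup>2 / (D powr (1 / (real ?N + 2))) ^ ?N = D powr (1 + \<kappa>0)"
        proof -
          have 1: "(D powr (1 / (real ?N + 2))) ^ ?N = D powr (real ?N / (real ?N + 2))"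
            using D by (simp add: powr_realpow[symmetric] powr_powr)
          have 2: "D\<^sup>2 = D powr 2" using D by (simp add: powr_numeral)
          have 3: "2 - real ?N / (real ?N + 2) = 1 + \<kappa>0"
            by (simp add: \<kappa>0_def field_simps)
          show ?thesis unfolding 1 2 3[symmetric] by (rule powr_diff[symmetric])
        qed
        have "2 * (4 * K * B1 * D)\<^sup>2 * s / (\<beta>0 * \<delta> ^ ?N) \<le> 2 * (4 * K * B1 * D)\<^sup>2 * 1 / (\<beta>0 * \<delta> ^ ?N)"
          using s1 \<beta>0 \<delta> by (intro divide_right_mono mult_left_mono) auto
        also have "\<dots> = 32 * K\<^sup>2 * B1\<^sup>2 / \<beta>0 / d ^ ?N * (D\<^sup>2 / (D powr (1 / (real ?N + 2))) ^ ?N)"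
          by (simp add: \<delta>_def power_mult_distrib)
        finally have t2: "2 * (4 * K * B1 * D)\<^sup>2 * s / (\<beta>0 * \<delta> ^ ?N) \<le> 32 * K\<^sup>2 * B1\<^sup>2 / \<beta>0 / d ^ ?N * D powr (1 + \<kappa>0)"
          unfolding e2 .
        from add_mono[OF t1 t2]
        show "\<delta>\<^sup>2 * (4 * C2 * K * D) + 2 * (4 * K * B1 * D)\<^sup>2 * s / (\<beta>0 * \<delta> ^ ?N) \<le> C3 / d ^ ?N * D powr (1 + \<kappa>0)"
          by (simp add: C3_def add_divide_distrib distrib_right)
      qed
      finally show ?thesis .
    qed
    \<comment> \<open>With this level both contributions to \<open>Z \<rho> s\<close> carry the
      power \<open>D powr (1 + \<kappa>)\<close>.\<close>
    define \<eta> where "\<eta> = D powr \<beta>"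
    have \<eta>: "\<eta> > 0" using D by (simp add: \<eta>_def)
    have "Z \<rho> s \<le> (\<integral>\<^sup>+z. ennreal (\<eta> powr \<Lambda>) * (ennreal (h z) * indicator (ball x0 \<rho> \<times> {0<..<s}) z)
        + ennreal (\<eta> powr (1 + \<Lambda> - 2 * p)) * (ennreal ((w z)\<^sup>2) * indicator (ball x0 \<rho> \<times> {0<..<s}) z) \<partial>lborel)"
      unfolding Z_def
    proof (rule nn_integral_mono)
      fix z :: "'a \<times> real"
      have "ennreal (h z powr (1 + \<Lambda>)) \<le> ennreal (\<eta> powr \<Lambda> * h z + \<eta> powr (1 + \<Lambda> - 2 * p) * (w z)\<^sup>2)"
        by (rule ennreal_leI[OF interpolation[OF \<eta>]])
      also have "\<dots> = ennreal (\<eta> powr \<Lambda>) * ennreal (h z) + ennreal (\<eta> powr (1 + \<Lambda> - 2 * p)) * ennreal ((w z)\<^sup>2)"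
        using h_nonneg[of z] by (simp add: ennreal_mult)
      finally show "ennreal (H (v z) powr (1 + \<Lambda>)) * indicator (ball x0 \<rho> \<times> {0<..<s}) z
        \<le> ennreal (\<eta> powr \<Lambda>) * (ennreal (h z) * indicator (ball x0 \<rho> \<times> {0<..<s}) z)
        + ennreal (\<eta> powr (1 + \<Lambda> - 2 * p)) * (ennreal ((w z)\<^sup>2) * indicator (ball x0 \<rho> \<times> {0<..<s}) z)"
        by (auto simp: h_def split: split_indicator)
    qed
    also have "\<dots> = ennreal (\<eta> powr \<Lambda>) * (\<integral>\<^sup>+z\<in>ball x0 \<rho> \<times> {0<..<s}. ennreal (h z) \<partial>lborel)
        + ennreal (\<eta> powr (1 + \<Lambda> - 2 * p)) * (\<integral>\<^sup>+z\<in>ball x0 \<rho> \<times> {0<..<s}. ennreal ((w z)\<^sup>2) \<partial>lborel)"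
      by (simp add: nn_integral_add nn_integral_cmult)
    also have "\<dots> \<le> ennreal (\<eta> powr \<Lambda>) * ennreal (K * D)
        + ennreal (\<eta> powr (1 + \<Lambda> - 2 * p)) * ennreal (C3 / d ^ ?N * D powr (1 + \<kappa>0))"
      by (intro add_mono mult_left_mono h_int w_int) auto
    also have "\<dots> = ennreal (\<eta> powr \<Lambda> * (K * D) + \<eta> powr (1 + \<Lambda> - 2 * p) * (C3 / d ^ ?N * D powr (1 + \<kappa>0)))"
      using K_pos D C3 d by (simp add: ennreal_mult[symmetric] ennreal_plus[symmetric] del: ennreal_plus)
    also have "\<eta> powr \<Lambda> * (K * D) = K * D powr (1 + \<kappa>)"
      using D by (simp add: \<eta>_def powr_powr \<kappa>_def powr_add)
    also have "\<eta> powr (1 + \<Lambda> - 2 * p) * (C3 / d ^ ?N * D powr (1 + \<kappa>0)) = C3 / d ^ ?N * D powr (1 + \<kappa>)"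
    proof -
      have "\<beta> * (1 + \<Lambda> - 2 * p) + (1 + \<kappa>0) = 1 + \<kappa>"
        unfolding \<beta>p[symmetric] \<kappa>_def by (simp add: algebra_simps)
      then have "D powr (\<beta> * (1 + \<Lambda> - 2 * p)) * D powr (1 + \<kappa>0) = D powr (1 + \<kappa>)"
        by (simp only: powr_add[symmetric])
      then show ?thesis by (simp add: \<eta>_def powr_powr mult.left_commute)
    qed
    also have "ennreal (K * D powr (1 + \<kappa>) + C3 / d ^ ?N * D powr (1 + \<kappa>)) \<le> ennreal (C / (\<rho>' - \<rho>) ^ ?N * D powr (1 + \<kappa>))"
    proof (rule ennreal_leI)
      have "K \<le> K * R ^ ?N / d ^ ?N"
        using d K_pos power_mono[of d R ?N] by (simp add: field_simps)
      then have "K * D powr (1 + \<kappa>) + C3 / d ^ ?N * D powr (1 + \<kappa>) \<le> K * R ^ ?N / d ^ ?N * D powr (1 + \<kappa>) + C3 / d ^ ?N * D powr (1 + \<kappa>)"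
        by (intro add_right_mono mult_right_mono) auto
      also have "\<dots> = C / (\<rho>' - \<rho>) ^ ?N * D powr (1 + \<kappa>)"
        using d by (simp add: C_def power_mult_distrib add_divide_distrib distrib_right)
      finally show "K * D powr (1 + \<kappa>) + C3 / d ^ ?N * D powr (1 + \<kappa>) \<le> C / (\<rho>' - \<rho>) ^ ?N * D powr (1 + \<kappa>)" .
    qed
    finally show "Z \<rho> s \<le> ennreal (C / (\<rho>' - \<rho>) ^ ?N * D powr (1 + \<kappa>))" .
  qed
qed

text \<open>On radii shrinking geometrically to \<open>r0\<close>, the superlinear power absorbs the
  growing gap factors once the first value is small enough, and \<open>Z\<close> decays
  geometrically. Boundedness of \<open>h\<close> makes that first value proportional to
  \<open>s\<close>.\<close>

lemma Z_eventually_zero: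
  assumes r0: "0 < r0" "r0 < R"
  obtains s where "0 < s" "s < T" "Z r0 s = 0"
proof -
  let ?N = "DIM('a)"
  obtain C \<kappa> where C: "C > 0" and \<kappa>: "\<kappa> > 0" and step: "\<And>\<rho> \<rho>' s D. 0 < \<rho> \<Longrightarrow> \<rho> < \<rho>' \<Longrightarrow> \<rho>' \<le> R \<Longrightarrow> 0 < s \<Longrightarrow> s < T \<Longrightarrow> s \<le> 1 \<Longrightarrow> 0 < D \<Longrightarrow> D \<le> 1 \<Longrightarrow>
      Z \<rho>' s \<le> ennreal (D * (\<rho>' - \<rho>)\<^sup>2) \<Longrightarrow> Z \<rho> s \<le> ennreal (C / (\<rho>' - \<rho>) ^ ?N * D powr (1 + \<kappa>))"
    using iteration_step by blast
  obtain B where B: "B \<ge> 1" "\<And>z. h z \<le> B" using h_bounded by blast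
  define a where "a = R - r0"
  have a: "a > 0" using r0 by (simp add: a_def)
  \<comment> \<open>\<open>l^\<kappa> = 2^(-(N+2))\<close>: one step of decay in \<open>D\<close>
    compensates the growth by \<open>2^N\<close> of the gap factor in the recursion and by
    \<open>2^2\<close> of the squared gap that converts \<open>Z\<close> into
    \<open>D\<close>.\<close>
  define l where "l = 2 powr (- (real ?N + 2) / \<kappa>)"
  have "l \<le> 2 powr 0" unfolding l_def using \<kappa> by (intro powr_mono divide_nonpos_pos) auto
  then have l: "0 < l" "l \<le> 1" by (auto simp: l_def)
  \<comment> \<open>The squared gap shrinks by 4 in each step, so \<open>D = y l^n\<close>
    corresponds to \<open>Z\<close> of order \<open>(l / 4)^n\<close>.\<close>
  define \<theta> where "\<theta> = l / 4"
  define C' where "C' = C * (2 / a) ^ ?N * (4 / a\<^sup>2)"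
  have C': "C' > 0" using C a by (simp add: C'_def)
  \<comment> \<open>The largest starting value, capped at 1, for which the constant of the recursion
    is at most \<open>\<theta>\<close>; the cap keeps \<open>D \<le> 1\<close>.\<close>
  define y where "y = min 1 ((\<theta> / C') powr (1 / \<kappa>))"
  have y: "0 < y" "y \<le> 1" using l C' by (auto simp: y_def \<theta>_def)
  have yk: "C' * y powr \<kappa> \<le> \<theta>"
  proof -
    have "y powr \<kappa> \<le> ((\<theta> / C') powr (1 / \<kappa>)) powr \<kappa>"
      using y \<kappa> by (intro powr_mono2) (auto simp: y_def)
    also have "\<dots> = \<theta> / C'" using \<kappa> l C' by (simp add: powr_powr \<theta>_def)
    finally show ?thesis using C' by (simp add: field_simps)
  qed
  define Y where "Y = y * a\<^sup>2 / 4"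
  have Y: "Y > 0" using y a by (simp add: Y_def)
  define C0 where "C0 = B powr (1 + \<Lambda>) * (unit_ball_vol (real ?N) * R ^ ?N)"
  have C0: "C0 > 0" using B R_pos by (simp add: C0_def)
  \<comment> \<open>\<open>C0 s\<close> bounds \<open>Z R s\<close> by the supremum of the integrand
    times the volume of the cylinder, so \<open>s \<le> Y / C0\<close> starts the induction.\<close>
  define s where "s = min (min 1 (T / 2)) (Y / C0)"
  have sT: "s \<le> T / 2" and sY: "s \<le> Y / C0" and s1: "s \<le> 1" unfolding s_def by linarith+
  have s0: "0 < s" using T_pos Y C0 by (simp add: s_def)
  have s: "0 < s" "s < T" "s \<le> 1" "C0 * s \<le> Y"
    using sT T_pos s0 s1 sY C0 by (simp_all add: pos_le_divide_eq mult.commute)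
  define \<rho> where "\<rho> n = r0 + a / 2 ^ n" for n :: nat
  have \<rho>: "0 < \<rho> n" "\<rho> (Suc n) < \<rho> n" "\<rho> n \<le> R" "\<rho> n - \<rho> (Suc n) = a / (2 * 2 ^ n)" for n
  proof -
    define b where "b = a / 2 ^ n"
    have b: "b > 0" "b \<le> a" "\<rho> n = r0 + b" "\<rho> (Suc n) = r0 + b / 2" "a / (2 * 2 ^ n) = b / 2"
      using a by (simp_all add: b_def \<rho>_def divide_le_eq)
    show "0 < \<rho> n" "\<rho> (Suc n) < \<rho> n" "\<rho> n \<le> R" "\<rho> n - \<rho> (Suc n) = a / (2 * 2 ^ n)"
      unfolding b(3-5) using b(1,2) r0 by (simp_all add: a_def)
  qed
  have bound: "Z (\<rho> n) s \<le> ennreal (Y * \<theta> ^ n)" for n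
  proof (induction n)
    case 0
    have "Z R s \<le> (\<integral>\<^sup>+z\<in>ball x0 R \<times> {0<..<s}. ennreal (B powr (1 + \<Lambda>)) \<partial>lborel)"
      unfolding Z_def h_def[symmetric] using B h_nonneg \<Lambda>_pos
      by (intro nn_integral_mono) (auto intro!: ennreal_leI powr_mono2 split: split_indicator)
    also have "\<dots> \<le> ennreal C0 * ennreal s"
    proof (rule cylinder_le_of_slices[OF _ s(1)])
      show "AE t in lborel. t \<in> {0<..<s} \<longrightarrow> (\<integral>\<^sup>+x\<in>ball x0 R. ennreal (B powr (1 + \<Lambda>)) \<partial>lborel) \<le> ennreal C0"
        using R_pos by (auto simp: nn_integral_cmult_indicator emeasure_ball C0_def ennreal_mult[symmetric])
    qed simp
    also have "\<dots> \<le> ennreal Y" using s C0 by (simp add: ennreal_mult[symmetric] ennreal_leI)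
    finally show ?case by (simp add: \<rho>_def a_def)
  next
    case (Suc n)
    define D where "D = y * l ^ n"
    have D: "0 < D" "D \<le> 1" using y l by (auto simp: D_def mult_le_one power_le_one)
    have YD: "Y * \<theta> ^ n = D * (\<rho> n - \<rho> (Suc n))\<^sup>2"
    proof -
      have "(2 * 2 ^ n :: real)\<^sup>2 = 4 * 4 ^ n"
        by (simp add: power_mult_distrib power2_eq_square flip: power_mult_distrib)
      then show ?thesis
        unfolding \<rho>(4) by (simp add: D_def Y_def \<theta>_def power_divide)
    qed
    have "Z (\<rho> (Suc n)) s \<le> ennreal (C / (\<rho> n - \<rho> (Suc n)) ^ ?N * D powr (1 + \<kappa>))"
      using Suc unfolding YD by (intro step \<rho> s D)
    also have "C / (\<rho> n - \<rho> (Suc n)) ^ ?N * D powr (1 + \<kappa>) \<le> Y * \<theta> ^ Suc n"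
    proof -
      \<comment> \<open>The cancellation for which \<open>l\<close> was chosen: the decay of
        \<open>D\<close> against all powers of \<open>2^n\<close> gathered in the step.\<close>
      have lk: "(l ^ n) powr \<kappa> * (2 ^ n) ^ (?N + 2) = 1"
      proof -
        have "(l ^ n) powr \<kappa> = 2 powr (- (real n * (real ?N + 2)))"
          using \<kappa> by (simp add: l_def powr_realpow[symmetric] powr_powr) (simp add: algebra_simps)
        moreover have "(2 ^ n :: real) ^ (?N + 2) = 2 powr (real n * (real ?N + 2))"
        proof -
          have "(2 ^ n :: real) ^ (?N + 2) = 2 ^ (n * (?N + 2))" by (rule power_mult[symmetric])
          also have "\<dots> = 2 powr real (n * (?N + 2))" by (rule powr_realpow[symmetric]) simp
          also have "real (n * (?N + 2)) = real n * (real ?N + 2)" by (simp add: algebra_simps)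
          finally show ?thesis .
        qed
        ultimately show ?thesis by (simp add: powr_add[symmetric])
      qed
      have e: "C / (\<rho> n - \<rho> (Suc n)) ^ ?N = C * (2 / a) ^ ?N * (2 ^ n) ^ ?N"
        unfolding \<rho>(4) using a by (simp add: power_divide power_mult_distrib)
      have D1: "D powr (1 + \<kappa>) = (Y * \<theta> ^ n) * (4 / a\<^sup>2) * (2 ^ n) ^ 2 * (y powr \<kappa> * (l ^ n) powr \<kappa>)"
      proof -
        have "D powr (1 + \<kappa>) = D * (y powr \<kappa> * (l ^ n) powr \<kappa>)"
          using D y l by (simp add: powr_add) (simp add: D_def powr_mult)
        moreover have "D = (Y * \<theta> ^ n) * (4 / a\<^sup>2) * (2 ^ n) ^ 2"
          unfolding YD \<rho>(4) using a by (simp add: power_divide power_mult_distrib)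
        ultimately show ?thesis by metis
      qed
      have "C / (\<rho> n - \<rho> (Suc n)) ^ ?N * D powr (1 + \<kappa>)
          = (Y * \<theta> ^ n) * (C' * y powr \<kappa>) * ((l ^ n) powr \<kappa> * (2 ^ n) ^ (?N + 2))"
        unfolding e D1 C'_def power_add by (simp only: mult_ac)
      also have "\<dots> \<le> (Y * \<theta> ^ n) * \<theta>"
        unfolding lk using mult_left_mono[OF yk, of "Y * \<theta> ^ n"] Y l by (simp add: \<theta>_def)
      finally show ?thesis by (simp add: mult_ac)
    qed
    then have "ennreal (C / (\<rho> n - \<rho> (Suc n)) ^ ?N * D powr (1 + \<kappa>)) \<le> ennreal (Y * \<theta> ^ Suc n)"
      by (rule ennreal_leI)
    finally show ?case .
  qed
  have "Z r0 s \<le> ennreal (Y * \<theta> ^ n)" for n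
    using bound[of n] Z_mono[of r0 "\<rho> n" s] a by (auto simp: \<rho>_def intro: order_trans)
  moreover have "(\<lambda>n. ennreal (Y * \<theta> ^ n)) \<longlonglongrightarrow> ennreal (Y * 0)"
    using l by (intro tendsto_ennrealI tendsto_mult tendsto_const LIMSEQ_realpow_zero) (auto simp: \<theta>_def)
  ultimately have "Z r0 s \<le> ennreal (Y * 0)"
    by (intro LIMSEQ_le_const[of _ _ "Z r0 s"]) auto
  then show ?thesis using s that by simp
qed

end

section \<open>Borel representatives and slices\<close>

text \<open>The definition of a solution speaks of Lebesgue measurable functions, whereas
  translations and product measures are handled on Borel functions. An almost everywhere equality
  suffices for the transfer, because completeness makes \<open>f\<close> measurable on
  \<open>E\<close>.\<close>

lemma lebesgue_set_integral_representative:
  fixes f f' :: "'a::euclidean_space \<Rightarrow> 'b::euclidean_space"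
  assumes E: "E \<in> sets borel" and f': "f' \<in> borel_measurable borel"
    and eq: "AE z in lborel. z \<in> E \<longrightarrow> f z = f' z"
  shows "set_integrable lebesgue E f \<longleftrightarrow> integrable lborel (\<lambda>z. indicator E z *\<^sub>R f' z)"
    and "(LINT z:E|lebesgue. f z) = (\<integral>z. indicator E z *\<^sub>R f' z \<partial>lborel)"
proof -
  have m: "(\<lambda>z. indicator E z *\<^sub>R f' z) \<in> borel_measurable lborel" using E f' by simp
  have m': "(\<lambda>z. indicator E z *\<^sub>R f' z) \<in> borel_measurable lebesgue" by (rule measurable_completion[OF m])
  have ae: "AE z in lebesgue. indicator E z *\<^sub>R f' z = indicator E z *\<^sub>R f z"
    by (rule AE_completion) (use eq in \<open>auto elim!: eventually_mono simp: indicator_def\<close>)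
  have mf: "(\<lambda>z. indicator E z *\<^sub>R f z) \<in> borel_measurable lebesgue" by (rule borel_measurable_AE[OF m' ae])
  show "set_integrable lebesgue E f \<longleftrightarrow> integrable lborel (\<lambda>z. indicator E z *\<^sub>R f' z)"
    unfolding set_integrable_def using integrable_cong_AE[OF m' mf ae] integrable_completion[OF m] by simp
  show "(LINT z:E|lebesgue. f z) = (\<integral>z. indicator E z *\<^sub>R f' z \<partial>lborel)"
    unfolding set_lebesgue_integral_def using integral_cong_AE[OF m' mf ae] integral_completion[OF m] by simp
qed

lemma borel_representative:
  fixes f :: "'a::euclidean_space \<Rightarrow> 'b::euclidean_space"
  assumes E: "E \<in> sets borel" and f: "f \<in> borel_measurable (lebesgue_on E)"
  obtains f' where "f' \<in> borel_measurable borel" "AE z in lborel. z \<in> E \<longrightarrow> f z = f' z"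
proof -
  have m: "(\<lambda>z. if z \<in> E then f z else 0) \<in> borel_measurable lebesgue"
    using E f by (subst borel_measurable_if) auto
  have "\<exists>g\<in>borel_measurable borel. AE z in lborel. (if z \<in> E then f z else 0) \<bullet> b = (g z :: real)" for b
  proof -
    have "(\<lambda>z. (if z \<in> E then f z else 0) \<bullet> b) \<in> borel_measurable (completion lborel)"
      using m by simp
    from completion_ex_borel_measurable_real[OF this] show ?thesis by simp
  qed
  then obtain g where g: "\<And>b. g b \<in> borel_measurable borel"
    "\<And>b. AE z in lborel. (if z \<in> E then f z else 0) \<bullet> b = (g b z :: real)" by metis
  have ae: "AE z in lborel. \<forall>b\<in>Basis. (if z \<in> E then f z else 0) \<bullet> b = g b z"
    using g(2) by (intro AE_finite_allI) auto
  show ?thesis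
  proof
    show "(\<lambda>z. \<Sum>b\<in>Basis. g b z *\<^sub>R b) \<in> borel_measurable borel"
      using g(1) by (intro borel_measurable_sum borel_measurable_scaleR borel_measurable_const)
    show "AE z in lborel. z \<in> E \<longrightarrow> f z = (\<Sum>b\<in>Basis. g b z *\<^sub>R b)"
      using ae
    proof eventually_elim
      case (elim z)
      have "z \<in> E \<Longrightarrow> (\<Sum>b\<in>Basis. g b z *\<^sub>R b) = (\<Sum>b\<in>Basis. (f z \<bullet> b) *\<^sub>R b)"
        using elim by (intro sum.cong) auto
      then show ?case by (simp add: euclidean_representation)
    qed
  qed
qed

text \<open>The exceptional set is first enlarged to a Borel null set; for it the product structure
  permits exchanging the order of the two almost-everywhere quantifiers.\<close>

lemma AE_slices:
  fixes P :: "'a::euclidean_space \<times> real \<Rightarrow> bool"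
  assumes "AE z in lborel. P z"
  shows "AE t in lborel. AE x in lborel. P (x, t)"
proof -
  obtain N where N: "{z \<in> space lborel. \<not> P z} \<subseteq> N" "N \<in> null_sets lborel"
    using assms unfolding eventually_ae_filter by auto
  have Nb [measurable]: "N \<in> sets borel" using N(2) by auto
  have "AE z in lborel \<Otimes>\<^sub>M lborel. z \<notin> N" unfolding lborel_prod by (rule AE_not_in[OF N(2)])
  then have "AE x in lborel. AE t in lborel. (x, t) \<notin> N" by (rule lborel_pair.AE_pair)
  moreover have "{z \<in> space (lborel \<Otimes>\<^sub>M lborel). (fst z, snd z) \<notin> N} \<in> sets (lborel \<Otimes>\<^sub>M lborel :: ('a \<times> real) measure)"
    unfolding lborel_prod using sets.compl_sets[of N borel] Nb by (simp add: Compl_eq[symmetric] Compl_eq_Diff_UNIV)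
  ultimately have "AE t in lborel. AE x in lborel. (x, t) \<notin> N"
    using lborel_pair.AE_commute[of "\<lambda>x t. (x, t) \<notin> N"] by simp
  then show ?thesis
  proof eventually_elim
    case (elim t)
    then show ?case by eventually_elim (use N(1) in auto)
  qed
qed

text \<open>On the part of \<open>K\<close> where \<open>u(s)\<close> and \<open>u(t)\<close> are
  close, uniform continuity controls the integrand. The rest has small measure by convergence in
  measure, and there boundedness of \<open>f\<close> is enough.\<close>

lemma slice_integral_tendsto:
  fixes u :: "'a::euclidean_space \<times> real \<Rightarrow> real" and f :: "real \<Rightarrow> real" and \<psi> :: "'a \<Rightarrow> real"
  assumes u: "continuous_L0_loc \<Omega> T u" and \<Omega>: "open \<Omega>"
    and K: "compact K" "K \<subseteq> \<Omega>" and \<psi>: "\<psi> \<in> borel_measurable borel" "\<And>x. x \<notin> K \<Longrightarrow> \<psi> x = 0" "\<And>x. \<bar>\<psi> x\<bar> \<le> P"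
    and f: "uniformly_continuous_on UNIV f" "\<And>y. \<bar>f y\<bar> \<le> B"
    and t: "t \<in> {0..T}"
  shows "((\<lambda>s. \<integral>x. \<psi> x * f (u (x, s)) \<partial>lebesgue) \<longlongrightarrow> (\<integral>x. \<psi> x * f (u (x, t)) \<partial>lebesgue)) (at t within {0..T})"
proof (rule tendstoI)
  fix e :: real assume e: "e > 0"
  have P0: "P \<ge> 0" using order_trans[OF abs_ge_zero \<psi>(3)[of undefined]] .
  have B0: "B \<ge> 0" using order_trans[OF abs_ge_zero f(2)[of undefined]] .
  have fm: "f \<in> borel_measurable borel"
    by (rule borel_measurable_continuous_onI[OF uniformly_continuous_imp_continuous[OF f(1)]])
  have Kl: "K \<in> lmeasurable" using K(1) by (rule lmeasurable_compact)
  define \<mu> where "\<mu> = measure lebesgue K"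
  have \<mu>: "\<mu> \<ge> 0" by (simp add: \<mu>_def)
  \<comment> \<open>Each of the two error sources receives a share of \<open>e / 2\<close>; the
    added 1 avoids division by zero.\<close>
  define e1 where "e1 = e / (2 * (P * \<mu> + 1))"
  define e2 where "e2 = e / (2 * (2 * B * P + 1))"
  have e1: "e1 > 0" and e2: "e2 > 0"
    using e P0 B0 \<mu> by (auto simp: e1_def e2_def intro!: divide_pos_pos add_nonneg_pos)
  obtain \<delta> where \<delta>: "\<delta> > 0" "\<And>y y'. dist y' y < \<delta> \<Longrightarrow> dist (f y') (f y) < e1"
    using f(1) e1 unfolding uniformly_continuous_on_def by (metis UNIV_I)
  have um: "(\<lambda>x. if x \<in> \<Omega> then u (x, s) else 0) \<in> borel_measurable lebesgue" if "s \<in> {0..T}" for s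
    using u that \<Omega> unfolding continuous_L0_loc_def by (subst borel_measurable_if) auto
  have \<psi>m: "\<psi> \<in> borel_measurable lebesgue" using \<psi>(1) by (simp add: measurable_completion)
  have int: "integrable lebesgue (\<lambda>x. \<psi> x * f (u (x, s)))" if s: "s \<in> {0..T}" for s
  proof (rule Bochner_Integration.integrable_bound[of _ "\<lambda>x. indicator K x * (P * B)"])
    show "integrable lebesgue (\<lambda>x. indicator K x * (P * B))"
      using Kl by (intro integrable_mult_left integrable_real_indicator) (auto simp: fmeasurable_def)
    have "(\<lambda>x. \<psi> x * f (if x \<in> \<Omega> then u (x, s) else 0)) \<in> borel_measurable lebesgue"
      by (intro borel_measurable_times \<psi>m measurable_compose[OF um[OF s] fm])
    moreover have "(\<lambda>x. \<psi> x * f (if x \<in> \<Omega> then u (x, s) else 0)) = (\<lambda>x. \<psi> x * f (u (x, s)))"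
      using \<psi>(2) K(2) by (auto simp: fun_eq_iff)
    ultimately show "(\<lambda>x. \<psi> x * f (u (x, s))) \<in> borel_measurable lebesgue" by simp
    have "norm (\<psi> x * f (u (x, s))) \<le> norm (indicator K x * (P * B))" for x
    proof (cases "x \<in> K")
      case True
      then show ?thesis using mult_mono[OF \<psi>(3)[of x] f(2)[of "u (x, s)"]] P0 B0 by (simp add: abs_mult)
    qed (simp add: \<psi>(2))
    then show "AE x in lebesgue. norm (\<psi> x * f (u (x, s))) \<le> norm (indicator K x * (P * B))" by simp
  qed
  \<comment> \<open>The threshold \<open>\<delta> / 2\<close> makes the distance strictly less than
    \<open>\<delta>\<close> on the complement in \<open>K\<close>.\<close>
  define bad where "bad s = {x\<in>K. \<bar>u (x, s) - u (x, t)\<bar> > \<delta> / 2}" for s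
  have "((\<lambda>s. measure lebesgue (bad s)) \<longlongrightarrow> 0) (at t within {0..T})"
    using u[unfolded continuous_L0_loc_def, THEN conjunct2, rule_format, OF t, of K "\<delta> / 2"] K \<delta>(1)
    unfolding bad_def by simp
  then have "\<forall>\<^sub>F s in at t within {0..T}. measure lebesgue (bad s) < e2"
    using e2 by (auto dest!: tendstoD elim!: eventually_mono)
  moreover have "\<forall>\<^sub>F s in at t within {0..T}. s \<in> {0..T}" by (simp add: eventually_at_filter)
  ultimately show "\<forall>\<^sub>F s in at t within {0..T}. dist (\<integral>x. \<psi> x * f (u (x, s)) \<partial>lebesgue) (\<integral>x. \<psi> x * f (u (x, t)) \<partial>lebesgue) < e"
  proof eventually_elim
    case (elim s)
    have "bad s = K \<inter> {x. \<bar>(if x \<in> \<Omega> then u (x, s) else 0) - (if x \<in> \<Omega> then u (x, t) else 0)\<bar> > \<delta> / 2}"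
      using K(2) by (auto simp: bad_def)
    also have "\<dots> \<in> sets lebesgue"
    proof (rule sets.Int)
      show "K \<in> sets lebesgue" using Kl by (simp add: fmeasurableD)
      have "{x \<in> space lebesgue. \<delta> / 2 < \<bar>(if x \<in> \<Omega> then u (x, s) else 0) - (if x \<in> \<Omega> then u (x, t) else 0)\<bar>} \<in> sets lebesgue"
        using um[OF elim(2)] um[OF t] by (intro borel_measurable_less borel_measurable_const borel_measurable_abs borel_measurable_diff)
      then show "{x. \<delta> / 2 < \<bar>(if x \<in> \<Omega> then u (x, s) else 0) - (if x \<in> \<Omega> then u (x, t) else 0)\<bar>} \<in> sets lebesgue" by simp
    qed
    finally have bl: "bad s \<in> lmeasurable"
      by (intro fmeasurableI2[OF Kl]) (auto simp: bad_def)
    have iK: "integrable lebesgue (\<lambda>x. indicator K x * (P * e1))"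
      and iB: "integrable lebesgue (\<lambda>x. indicator (bad s) x * (2 * B * P))"
      using Kl bl by (auto intro!: integrable_mult_left integrable_real_indicator simp: fmeasurable_def)
    note ib = Bochner_Integration.integrable_add[OF iK iB]
    have "\<bar>(\<integral>x. \<psi> x * f (u (x, s)) \<partial>lebesgue) - (\<integral>x. \<psi> x * f (u (x, t)) \<partial>lebesgue)\<bar>
      = \<bar>\<integral>x. \<psi> x * f (u (x, s)) - \<psi> x * f (u (x, t)) \<partial>lebesgue\<bar>"
      using int[OF elim(2)] int[OF t] by simp
    also have "\<dots> \<le> (\<integral>x. indicator K x * (P * e1) + indicator (bad s) x * (2 * B * P) \<partial>lebesgue)"
    proof (rule Bochner_Integration.integral_abs_bound_integral)
      show "integrable lebesgue (\<lambda>x. \<psi> x * f (u (x, s)) - \<psi> x * f (u (x, t)))"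
        using int[OF elim(2)] int[OF t] by simp
      fix x
      show "\<bar>\<psi> x * f (u (x, s)) - \<psi> x * f (u (x, t))\<bar> \<le> indicator K x * (P * e1) + indicator (bad s) x * (2 * B * P)"
      proof (cases "x \<in> K")
        case True
        have d: "\<bar>f (u (x, s)) - f (u (x, t))\<bar> \<le> e1 + indicator (bad s) x * (2 * B)"
        proof (cases "x \<in> bad s")
          case True
          then show ?thesis using f(2)[of "u (x, s)"] f(2)[of "u (x, t)"] e1 by simp
        next
          case False
          then have "dist (u (x, s)) (u (x, t)) < \<delta>"
            using \<open>x \<in> K\<close> \<delta>(1) by (auto simp: bad_def dist_real_def)
          from \<delta>(2)[OF this] show ?thesis using False by (simp add: dist_real_def)
        qed
        have "\<bar>\<psi> x * f (u (x, s)) - \<psi> x * f (u (x, t))\<bar> = \<bar>\<psi> x\<bar> * \<bar>f (u (x, s)) - f (u (x, t))\<bar>"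
          by (simp add: abs_mult[symmetric] right_diff_distrib)
        also have "\<dots> \<le> P * (e1 + indicator (bad s) x * (2 * B))"
          by (rule mult_mono[OF \<psi>(3) d P0]) simp
        finally show ?thesis using True by (simp add: algebra_simps)
      qed (auto simp: \<psi>(2) bad_def)
    qed (rule ib)
    also have "\<dots> = \<mu> * (P * e1) + measure lebesgue (bad s) * (2 * B * P)"
      unfolding Bochner_Integration.integral_add[OF iK iB] by (simp add: \<mu>_def)
    also have "\<dots> < e / 2 + e / 2"
    proof (rule add_less_le_mono)
      have "(P * \<mu>) * e < (P * \<mu> + 1) * e" using e by (intro mult_strict_right_mono) auto
      moreover have "P * \<mu> + 1 > 0" using P0 \<mu> by (simp add: add_nonneg_pos)
      ultimately show "\<mu> * (P * e1) < e / 2"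
        unfolding e1_def by (simp add: field_simps)
      have "measure lebesgue (bad s) * (2 * B * P) \<le> e2 * (2 * B * P)"
        using elim(1) B0 P0 by (intro mult_right_mono) auto
      also have "\<dots> \<le> e2 * (2 * B * P + 1)" using e2 by (intro mult_left_mono) auto
      also have "\<dots> = e / 2"
      proof -
        have "2 * B * P + 1 > 0" using B0 P0 by (simp add: add_nonneg_pos)
        then show ?thesis by (simp add: e2_def field_simps)
      qed
      finally show "measure lebesgue (bad s) * (2 * B * P) \<le> e / 2" .
    qed
    finally show ?case by (simp add: dist_real_def)
  qed
qed

section \<open>The energy inequality\<close>

text \<open>\<open>v\<close> and \<open>G\<close> are Borel representatives of \<open>u\<close> and
  \<open>g\<close> on the cylinder, extended by 0, with bounds valid at every point. The function
  \<open>u\<close> is kept beside them: its individual slices carry the continuity in time and the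
  initial condition, which a space-time representative does not see.\<close>

locale weak_solution = entropy_structure H F W1 M \<Lambda> p C1 C2
  for H F W1 :: "real \<Rightarrow> real" and M \<Lambda> p C1 C2 +
  fixes \<Omega> :: "'a::euclidean_space set" and T :: real and u v :: "'a \<times> real \<Rightarrow> real" and g G :: "'a \<times> real \<Rightarrow> 'a"
    and x0 :: 'a and R :: real
  assumes \<Omega>: "open \<Omega>" and T_pos: "T > 0" and R_pos: "R > 0" and R_\<Omega>: "cball x0 R \<subseteq> \<Omega>"
    and u_cont: "continuous_L0_loc \<Omega> T u"
    and u_init: "AE x in lborel. x \<in> cball x0 R \<longrightarrow> u (x, 0) = 0"
    and grad: "weak_space_grad_L2loc (\<Omega> \<times> {0<..<T}) u g"
    and ineq: "\<And>\<phi>. \<phi> \<in> Lip_c (\<Omega> \<times> {0<..<T}) \<Longrightarrow> (\<And>z. \<phi> z \<ge> 0) \<Longrightarrow>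
          set_integrable lebesgue (\<Omega> \<times> {0<..<T}) (diffusion_term F u g \<phi>) \<and>
          (LINT z:\<Omega> \<times> {0<..<T}|lebesgue. diffusion_term F u g \<phi> z)
            \<le> (LINT z:\<Omega> \<times> {0<..<T}|lebesgue. time_deriv \<phi> z * H (u z))"
    and v_borel [measurable]: "v \<in> borel_measurable borel" and G_borel [measurable]: "G \<in> borel_measurable borel"
    and v_bounds: "0 \<le> v z" "v z \<le> M"
    and v_outside: "z \<notin> \<Omega> \<times> {0<..<T} \<Longrightarrow> v z = 0" and G_outside: "z \<notin> \<Omega> \<times> {0<..<T} \<Longrightarrow> G z = 0"
    and u_v: "AE z in lborel. z \<in> \<Omega> \<times> {0<..<T} \<longrightarrow> u z = v z"
    and g_G: "AE z in lborel. z \<in> \<Omega> \<times> {0<..<T} \<longrightarrow> g z = G z"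
begin

abbreviation "E \<equiv> \<Omega> \<times> {0<..<T}"

lemma E_borel: "E \<in> sets borel"
  using \<Omega> by (intro borel_open open_Times) auto

lemma Q_props:
  assumes "0 < \<sigma>" "s < T" "\<rho> \<le> R"
  shows "compact (cball x0 \<rho> \<times> {\<sigma>..s})" "cball x0 \<rho> \<times> {\<sigma>..s} \<subseteq> E"
proof -
  show "compact (cball x0 \<rho> \<times> {\<sigma>..s})" by (intro compact_Times) auto
  have "cball x0 \<rho> \<subseteq> \<Omega>" using R_\<Omega> assms(3) by (meson order_trans subset_cball)
  then show "cball x0 \<rho> \<times> {\<sigma>..s} \<subseteq> E" using assms by auto
qed

lemma gradient_sq_integrable:
  assumes "0 < \<sigma>" "s < T"
  shows "set_integrable lborel (cball x0 R \<times> {\<sigma>..s}) (\<lambda>z. (norm (G z))\<^sup>2)"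
proof -
  note Q = Q_props[OF assms order_refl]
  have "set_integrable lebesgue (cball x0 R \<times> {\<sigma>..s}) (\<lambda>z. (norm (g z))\<^sup>2)"
    using grad Q unfolding weak_space_grad_L2loc_def by blast
  moreover have "AE z in lborel. z \<in> cball x0 R \<times> {\<sigma>..s} \<longrightarrow> (norm (g z))\<^sup>2 = (norm (G z))\<^sup>2"
    using g_G by eventually_elim (use Q(2) in auto)
  ultimately show ?thesis
    using lebesgue_set_integral_representative(1)[OF borel_compact[OF Q(1)], of "\<lambda>z. (norm (G z))\<^sup>2" "\<lambda>z. (norm (g z))\<^sup>2"]
    by (simp add: set_integrable_def)
qed

lemma space_grad_inner:
  fixes \<phi> :: "'a \<times> real \<Rightarrow> real"
  assumes "C1_derivative \<phi> \<phi>'"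
  shows "space_grad \<phi> z \<bullet> y = \<phi>' z (y, 0)"
proof -
  have d: "deriv (\<lambda>h. \<phi> (fst z + h *\<^sub>R b, snd z)) 0 = \<phi>' z (b, 0)" for b :: 'a
  proof -
    have "((\<lambda>h. (fst z + h *\<^sub>R b, snd z)) has_derivative (\<lambda>h. (h *\<^sub>R b, 0))) (at 0)"
      by (auto intro!: derivative_eq_intros)
    moreover have "(\<phi> has_derivative blinfun_apply (\<phi>' z)) (at (fst z + 0 *\<^sub>R b, snd z))"
    proof -
      have "(\<phi> has_derivative blinfun_apply (\<phi>' z)) (at z)" using assms unfolding C1_derivative_def by blast
      then show ?thesis by simp
    qed
    ultimately have "((\<lambda>h. \<phi> (fst z + h *\<^sub>R b, snd z)) has_derivative (\<lambda>h. \<phi>' z (h *\<^sub>R b, 0))) (at 0)"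
      by (rule has_derivative_compose)
    moreover have "(\<lambda>h. \<phi>' z (h *\<^sub>R b, 0)) = (*) (\<phi>' z (b, 0))"
    proof
      fix h :: real
      have "(h *\<^sub>R b, 0::real) = h *\<^sub>R (b, 0)" by simp
      then show "\<phi>' z (h *\<^sub>R b, 0) = \<phi>' z (b, 0) * h" by (simp only: blinfun.scaleR_right) simp
    qed
    ultimately show ?thesis
      by (intro DERIV_imp_deriv) (simp add: has_field_derivative_def)
  qed
  have "space_grad \<phi> z \<bullet> y = (\<Sum>b\<in>Basis. (y \<bullet> b) * \<phi>' z (b, 0))"
    by (simp only: space_grad_def d inner_sum_left inner_scaleR_left) (simp only: inner_commute mult.commute)
  also have "\<dots> = \<phi>' z (\<Sum>b\<in>Basis. (y \<bullet> b) *\<^sub>R (b, 0))"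
    by (simp only: blinfun.sum_right blinfun.scaleR_right real_scaleR_def)
  also have "(\<Sum>b\<in>Basis. (y \<bullet> b) *\<^sub>R (b, 0::real)) = (y, 0)"
    by (simp add: prod_eq_iff fst_sum snd_sum euclidean_representation)
  finally show ?thesis .
qed

text \<open>The vector-valued identity in the definition of the weak gradient, paired with
  \<open>y\<close>. Integrability is checked first so that the inner product may be taken outside
  the integrals; the zero extensions turn integrals over \<open>E\<close> into integrals over the
  whole space.\<close>

lemma weak_gradient_identity:
  fixes \<phi> :: "'a \<times> real \<Rightarrow> real"
  assumes s: "0 < \<sigma>" "s < T" and \<phi>: "C1_derivative \<phi> \<phi>'" and supp: "\<And>z. z \<notin> cball x0 R \<times> {\<sigma>..s} \<Longrightarrow> \<phi> z = 0"
  shows "(\<integral>z. v z * \<phi>' z (y, 0) \<partial>lborel) = - (\<integral>z. \<phi> z * (G z \<bullet> y) \<partial>lborel)"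
proof -
  define Q where "Q = cball x0 R \<times> {\<sigma>..s}"
  note Q = Q_props[OF s order_refl, folded Q_def]
  have Qb [measurable]: "Q \<in> sets borel" by (rule borel_compact[OF Q(1)])
  have iQ: "integrable lborel (indicator Q :: _ \<Rightarrow> real)"
    using emeasure_compact_finite[OF Q(1)] by (intro integrable_real_indicator) auto
  have \<phi>c: "continuous_on UNIV \<phi>" by (rule C1_derivative_continuous[OF \<phi>])
  have [measurable]: "\<phi> \<in> borel_measurable borel" by (rule borel_measurable_continuous_onI[OF \<phi>c])
  have \<phi>'c: "continuous_on UNIV \<phi>'" and \<phi>d: "\<And>z. (\<phi> has_derivative blinfun_apply (\<phi>' z)) (at z)"
    using \<phi> unfolding C1_derivative_def by blast+
  have sg: "space_grad \<phi> z = (\<Sum>b\<in>Basis. \<phi>' z (b, 0) *\<^sub>R b)" for z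
    by (rule euclidean_eqI) (simp add: space_grad_inner[OF \<phi>] inner_sum_left_Basis)
  have sgc: "continuous_on UNIV (space_grad \<phi>)"
    unfolding sg[abs_def] by (intro continuous_intros \<phi>'c)
  have [measurable]: "space_grad \<phi> \<in> borel_measurable borel" by (rule borel_measurable_continuous_onI[OF sgc])
  have zero: "space_grad \<phi> z = 0" if "z \<notin> Q" for z
  proof -
    have "(\<phi> has_derivative (\<lambda>_. 0)) (at z)"
      by (rule has_derivative_transform_within_open[of "\<lambda>_. 0" _ z UNIV "- Q"])
        (use that supp compact_imp_closed[OF Q(1)] in \<open>auto simp: open_Compl Q_def\<close>)
    then have "blinfun_apply (\<phi>' z) = (\<lambda>_. 0)" using has_derivative_unique[OF \<phi>d] by blast
    then show ?thesis by (simp add: sg)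
  qed
  obtain Bs where Bs: "\<And>z. z \<in> Q \<Longrightarrow> norm (space_grad \<phi> z) \<le> Bs"
  proof -
    have "bounded (space_grad \<phi> ` Q)"
      by (rule compact_imp_bounded, rule compact_continuous_image[OF continuous_on_subset[OF sgc] Q(1)]) simp
    then show ?thesis using that unfolding bounded_iff by blast
  qed
  obtain B\<phi> where B\<phi>: "\<And>z. z \<in> Q \<Longrightarrow> norm (\<phi> z) \<le> B\<phi>"
  proof -
    have "bounded (\<phi> ` Q)"
      by (rule compact_imp_bounded, rule compact_continuous_image[OF continuous_on_subset[OF \<phi>c] Q(1)]) simp
    then show ?thesis using that unfolding bounded_iff by blast
  qed
  have int1: "integrable lborel (\<lambda>z. v z *\<^sub>R space_grad \<phi> z)"
  proof (rule Bochner_Integration.integrable_bound[OF integrable_mult_left[OF iQ, of "M * Bs"]])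
    have "norm (v z *\<^sub>R space_grad \<phi> z) \<le> norm (indicator Q z * (M * Bs))" for z
    proof (cases "z \<in> Q")
      case True
      have "norm (v z *\<^sub>R space_grad \<phi> z) \<le> M * Bs"
        using v_bounds[of z] Bs[OF True] by (simp add: mult_mono)
      then show ?thesis using True by simp
    qed (simp add: zero)
    then show "AE z in lborel. norm (v z *\<^sub>R space_grad \<phi> z) \<le> norm (indicator Q z * (M * Bs))" by simp
  qed measurable
  have int2: "integrable lborel (\<lambda>z. \<phi> z *\<^sub>R G z)"
  proof (rule Bochner_Integration.integrable_bound)
    show "integrable lborel (\<lambda>z. B\<phi> * (indicator Q z + indicator Q z *\<^sub>R (norm (G z))\<^sup>2))"
      using gradient_sq_integrable[OF s] iQ unfolding set_integrable_def Q_def[symmetric]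
      by (intro integrable_mult_right Bochner_Integration.integrable_add)
    have "norm (\<phi> z *\<^sub>R G z) \<le> norm (B\<phi> * (indicator Q z + indicator Q z *\<^sub>R (norm (G z))\<^sup>2))" for z
    proof (cases "z \<in> Q")
      case True
      have "norm (G z) \<le> 1 + (norm (G z))\<^sup>2"
        using zero_le_power2[of "norm (G z) - 1"] norm_ge_zero[of "G z"]
        unfolding power2_eq_square by (simp only: algebra_simps)
      moreover have "0 \<le> B\<phi>" using B\<phi>[OF True] norm_ge_zero[of "\<phi> z"] by linarith
      ultimately have "norm (\<phi> z *\<^sub>R G z) \<le> B\<phi> * (1 + (norm (G z))\<^sup>2)"
        using B\<phi>[OF True] by (simp add: mult_mono)
      also have "\<dots> \<le> norm (B\<phi> * (1 + (norm (G z))\<^sup>2))" by simp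
      finally show ?thesis using True by simp
    qed (use supp in \<open>simp add: Q_def\<close>)
    then show "AE z in lborel. norm (\<phi> z *\<^sub>R G z) \<le> norm (B\<phi> * (indicator Q z + indicator Q z *\<^sub>R (norm (G z))\<^sup>2))" by simp
  qed measurable
  have "\<phi> \<in> C1_c E"
    unfolding C1_c_def compact_supp_in_def using \<phi>d \<phi>'c Q supp unfolding Q_def by blast
  then have "(LINT z:E|lebesgue. u z *\<^sub>R space_grad \<phi> z) = - (LINT z:E|lebesgue. \<phi> z *\<^sub>R g z)"
    using grad unfolding weak_space_grad_L2loc_def by blast
  moreover have "(LINT z:E|lebesgue. u z *\<^sub>R space_grad \<phi> z) = (\<integral>z. indicator E z *\<^sub>R (v z *\<^sub>R space_grad \<phi> z) \<partial>lborel)"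
    by (rule lebesgue_set_integral_representative(2)[OF E_borel]) (measurable, use u_v in eventually_elim, auto)
  moreover have "(LINT z:E|lebesgue. \<phi> z *\<^sub>R g z) = (\<integral>z. indicator E z *\<^sub>R (\<phi> z *\<^sub>R G z) \<partial>lborel)"
    by (rule lebesgue_set_integral_representative(2)[OF E_borel]) (measurable, use g_G in eventually_elim, auto)
  moreover have "indicator E z *\<^sub>R (v z *\<^sub>R space_grad \<phi> z) = v z *\<^sub>R space_grad \<phi> z" for z
    by (cases "z \<in> E"; simp only: not_False_eq_True indicator_simps v_outside scaleR_zero_left scaleR_one)
  moreover have "indicator E z *\<^sub>R (\<phi> z *\<^sub>R G z) = \<phi> z *\<^sub>R G z" for z
    by (cases "z \<in> E"; simp only: not_False_eq_True indicator_simps G_outside scaleR_zero_left scaleR_zero_right scaleR_one)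
  ultimately have eq: "(\<integral>z. v z *\<^sub>R space_grad \<phi> z \<partial>lborel) = - (\<integral>z. \<phi> z *\<^sub>R G z \<partial>lborel)"
    by (simp only:)
  have "(\<integral>z. v z * \<phi>' z (y, 0) \<partial>lborel) = (\<integral>z. (v z *\<^sub>R space_grad \<phi> z) \<bullet> y \<partial>lborel)"
    by (simp add: space_grad_inner[OF \<phi>])
  also have "\<dots> = (\<integral>z. v z *\<^sub>R space_grad \<phi> z \<partial>lborel) \<bullet> y" by (rule integral_inner_left[OF int1])
  also have "\<dots> = - ((\<integral>z. \<phi> z *\<^sub>R G z \<partial>lborel) \<bullet> y)" unfolding eq by simp
  also have "(\<integral>z. \<phi> z *\<^sub>R G z \<partial>lborel) \<bullet> y = (\<integral>z. (\<phi> z *\<^sub>R G z) \<bullet> y \<partial>lborel)"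
    by (rule integral_inner_left[OF int2, symmetric])
  finally show ?thesis by simp
qed

end

section \<open>Cutoff functions in space and time\<close>

definition parabola_cutoff :: "'a::real_normed_vector \<Rightarrow> real \<Rightarrow> 'a \<Rightarrow> real" where
  "parabola_cutoff x0 \<rho> x = max 0 (\<rho>\<^sup>2 - (norm (x - x0))\<^sup>2)"

text \<open>Rises from 0 to 1 on \<open>[\<tau>, 2 \<tau>]\<close>, stays at 1 up to
  \<open>t - \<tau>\<close> and falls to 0 at \<open>t\<close> (for
  \<open>3 \<tau> \<le> t\<close>). The slopes \<open>1 / \<tau>\<close> turn the time derivative
  into averages near time 0 and near time \<open>t\<close>, while the support stays away from
  0.\<close>

definition trapezoid :: "real \<Rightarrow> real \<Rightarrow> real \<Rightarrow> real" where
  "trapezoid \<tau> t \<sigma> = max 0 (min 1 (min ((\<sigma> - \<tau>) / \<tau>) ((t - \<sigma>) / \<tau>)))"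

lemma parabola_cutoff_bounds:
  "0 \<le> parabola_cutoff x0 \<rho> x" "parabola_cutoff x0 \<rho> x \<le> \<rho>\<^sup>2"
  by (auto simp: parabola_cutoff_def)

lemma parabola_cutoff_outside: "0 < \<rho> \<Longrightarrow> x \<notin> ball x0 \<rho> \<Longrightarrow> parabola_cutoff x0 \<rho> x = 0"
  by (auto simp: parabola_cutoff_def dist_norm norm_minus_commute intro!: max_absorb1 power_mono)

text \<open>With \<open>r\<close> the distance to \<open>x0\<close> capped at \<open>\<rho>\<close>,
  the cutoff is \<open>\<rho>^2 - r^2\<close>. The difference of squares then gives the constant,
  since \<open>r\<close> is 1-Lipschitz and at most \<open>\<rho>\<close>.\<close>

lemma parabola_cutoff_lipschitz:
  assumes \<rho>: "\<rho> > 0"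
  shows "\<bar>parabola_cutoff x0 \<rho> x - parabola_cutoff x0 \<rho> y\<bar> \<le> 2 * \<rho> * dist x y"
proof -
  define r where "r x = min \<rho> (norm (x - x0))" for x
  have r: "0 \<le> r x" "r x \<le> \<rho>" for x using \<rho> by (auto simp: r_def)
  have e: "parabola_cutoff x0 \<rho> x = \<rho>\<^sup>2 - (r x)\<^sup>2" for x
  proof (cases "norm (x - x0) \<le> \<rho>")
    case True
    then show ?thesis by (simp add: parabola_cutoff_def r_def power_mono)
  next
    case False
    then have "\<rho>\<^sup>2 \<le> (norm (x - x0))\<^sup>2" using \<rho> by (intro power_mono) auto
    then show ?thesis using False by (simp add: parabola_cutoff_def r_def)
  qed
  have "\<bar>parabola_cutoff x0 \<rho> x - parabola_cutoff x0 \<rho> y\<bar> = \<bar>r x - r y\<bar> * (r x + r y)"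
  proof -
    have "parabola_cutoff x0 \<rho> x - parabola_cutoff x0 \<rho> y = (r y - r x) * (r x + r y)"
      unfolding e by (simp add: power2_eq_square algebra_simps)
    then show ?thesis using r[of x] r[of y] by (simp add: abs_mult abs_minus_commute)
  qed
  also have "\<dots> \<le> dist x y * (2 * \<rho>)"
  proof (rule mult_mono)
    have "\<bar>r x - r y\<bar> \<le> \<bar>norm (x - x0) - norm (y - x0)\<bar>" by (simp add: r_def min_def)
    also have "\<dots> \<le> dist x y" using norm_triangle_ineq3[of "x - x0" "y - x0"] by (simp add: dist_norm)
    finally show "\<bar>r x - r y\<bar> \<le> dist x y" .
  qed (use r[of x] r[of y] in auto)
  finally show ?thesis by (simp add: mult_ac)
qed

lemma trapezoid_bounds: "0 \<le> trapezoid \<tau> t \<sigma>" "trapezoid \<tau> t \<sigma> \<le> 1"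
  by (auto simp: trapezoid_def)

lemma trapezoid_outside: "0 < \<tau> \<Longrightarrow> \<sigma> \<notin> {\<tau>..t} \<Longrightarrow> trapezoid \<tau> t \<sigma> = 0"
  by (auto simp: trapezoid_def not_le max_def min_def divide_simps)

lemma trapezoid_eq_1: "0 < \<tau> \<Longrightarrow> \<sigma> \<in> {2 * \<tau>..t - \<tau>} \<Longrightarrow> trapezoid \<tau> t \<sigma> = 1"
  by (auto simp: trapezoid_def max_def min_def divide_simps)

lemma trapezoid_lipschitz:
  assumes "\<tau> > 0"
  shows "\<bar>trapezoid \<tau> t \<sigma> - trapezoid \<tau> t \<sigma>'\<bar> \<le> dist \<sigma> \<sigma>' / \<tau>"
proof -
  have "\<bar>(\<sigma> - \<tau>) / \<tau> - (\<sigma>' - \<tau>) / \<tau>\<bar> = dist \<sigma> \<sigma>' / \<tau>" "\<bar>(t - \<sigma>) / \<tau> - (t - \<sigma>') / \<tau>\<bar> = dist \<sigma> \<sigma>' / \<tau>"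
    using assms by (simp_all add: dist_real_def diff_divide_distrib[symmetric] abs_minus_commute)
  then show ?thesis unfolding trapezoid_def by linarith
qed

lemma trapezoid_deriv:
  assumes \<tau>: "0 < \<tau>" "3 * \<tau> \<le> t" and \<sigma>: "\<sigma> \<notin> {\<tau>, 2 * \<tau>, t - \<tau>, t}"
  shows "(trapezoid \<tau> t has_real_derivative (indicator {\<tau><..<2 * \<tau>} \<sigma> - indicator {t - \<tau><..<t} \<sigma>) / \<tau>) (at \<sigma>)"
proof -
  have aff: "((\<lambda>\<sigma>. (\<sigma> - \<tau>) / \<tau>) has_real_derivative 1 / \<tau>) (at \<sigma>)"
    "((\<lambda>\<sigma>. (t - \<sigma>) / \<tau>) has_real_derivative (- 1) / \<tau>) (at \<sigma>)"
    using \<tau> by (auto intro!: derivative_eq_intros)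
  have const: "((\<lambda>_. c) has_real_derivative 0) (at \<sigma>)" for c by simp
  consider "\<sigma> < \<tau>" | "\<tau> < \<sigma>" "\<sigma> < 2 * \<tau>" | "2 * \<tau> < \<sigma>" "\<sigma> < t - \<tau>" | "t - \<tau> < \<sigma>" "\<sigma> < t" | "t < \<sigma>"
    using \<sigma> by fastforce
  then show ?thesis
  proof cases
    case 1
    have "(trapezoid \<tau> t has_real_derivative 0) (at \<sigma>)"
      by (rule has_field_derivative_transform_within_open[OF const[of 0], of "{..<\<tau>}"])
        (use 1 \<tau> in \<open>auto simp: trapezoid_outside\<close>)
    then show ?thesis using 1 \<tau> by simp
  next
    case 2
    have "(trapezoid \<tau> t has_real_derivative 1 / \<tau>) (at \<sigma>)"
      by (rule has_field_derivative_transform_within_open[OF aff(1), of "{\<tau><..<2 * \<tau>}"])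
        (use 2 \<tau> in \<open>auto simp: trapezoid_def max_def min_def divide_simps\<close>)
    then show ?thesis using 2 \<tau> by simp
  next
    case 3
    have "(trapezoid \<tau> t has_real_derivative 0) (at \<sigma>)"
      by (rule has_field_derivative_transform_within_open[OF const[of 1], of "{2 * \<tau><..<t - \<tau>}"])
        (use 3 \<tau> in \<open>auto simp: trapezoid_eq_1\<close>)
    then show ?thesis using 3 \<tau> by simp
  next
    case 4
    have "(trapezoid \<tau> t has_real_derivative (- 1) / \<tau>) (at \<sigma>)"
      by (rule has_field_derivative_transform_within_open[OF aff(2), of "{t - \<tau><..<t}"])
        (use 4 \<tau> in \<open>auto simp: trapezoid_def max_def min_def divide_simps\<close>)
    then show ?thesis using 4 \<tau> by simp
  next
    case 5
    have "(trapezoid \<tau> t has_real_derivative 0) (at \<sigma>)"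
      by (rule has_field_derivative_transform_within_open[OF const[of 0], of "{t<..}"])
        (use 5 \<tau> in \<open>auto simp: trapezoid_outside\<close>)
    then show ?thesis using 5 \<tau> by simp
  qed
qed

text \<open>The gradient of the squared cutoff is \<open>- 4 m (x - x0)\<close>, where
  \<open>m\<close> is the cutoff. The factor \<open>m\<close> left in it is exactly what allows the
  mixed term to be absorbed into \<open>m^2 F' |\<nabla>u|^2\<close>; moreover the square is
  differentiable at the boundary of the ball.\<close>

definition test_fun :: "'a::euclidean_space \<Rightarrow> real \<Rightarrow> real \<Rightarrow> real \<Rightarrow> 'a \<times> real \<Rightarrow> real" where
  "test_fun x0 \<rho> \<tau> t z = (parabola_cutoff x0 \<rho> (fst z))\<^sup>2 * trapezoid \<tau> t (snd z)"

lemma test_fun_nonneg: "test_fun x0 \<rho> \<tau> t z \<ge> 0"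
  by (simp add: test_fun_def trapezoid_bounds)

lemma test_fun_outside: "0 < \<rho> \<Longrightarrow> 0 < \<tau> \<Longrightarrow> z \<notin> cball x0 \<rho> \<times> {\<tau>..t} \<Longrightarrow> test_fun x0 \<rho> \<tau> t z = 0"
  using parabola_cutoff_outside[of \<rho> "fst z" x0] trapezoid_outside[of \<tau> "snd z" t]
  by (cases "fst z \<in> cball x0 \<rho>") (auto simp: test_fun_def mem_Times_iff)

lemma test_fun_lipschitz:
  fixes x0 :: "'a::euclidean_space"
  assumes \<rho>: "0 < \<rho>" and \<tau>: "0 < \<tau>"
  shows "\<exists>L. L-lipschitz_on UNIV (test_fun x0 \<rho> \<tau> t)"
proof (intro exI lipschitz_onI)
  let ?m = "parabola_cutoff x0 \<rho>" and ?\<theta> = "trapezoid \<tau> t"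
  let ?L = "4 * \<rho>\<^sup>2 * \<rho> + (\<rho>\<^sup>2)\<^sup>2 / \<tau>"
  show "0 \<le> ?L" using \<rho> \<tau> by simp
  fix z z' :: "'a \<times> real"
  have d: "dist (fst z) (fst z') \<le> dist z z'" "dist (snd z) (snd z') \<le> dist z z'"
    by (rule dist_fst_le dist_snd_le)+
  have m2: "\<bar>(?m x)\<^sup>2 - (?m y)\<^sup>2\<bar> \<le> 4 * \<rho>\<^sup>2 * \<rho> * dist x y" for x y
  proof -
    have "(?m x)\<^sup>2 - (?m y)\<^sup>2 = (?m x + ?m y) * (?m x - ?m y)"
      by (simp add: power2_eq_square algebra_simps)
    then have "\<bar>(?m x)\<^sup>2 - (?m y)\<^sup>2\<bar> = (?m x + ?m y) * \<bar>?m x - ?m y\<bar>"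
      using parabola_cutoff_bounds[of x0 \<rho>] by (simp add: abs_mult)
    also have "\<dots> \<le> (2 * \<rho>\<^sup>2) * (2 * \<rho> * dist x y)"
      using parabola_cutoff_bounds[of x0 \<rho> x] parabola_cutoff_bounds[of x0 \<rho> y] \<rho>
      by (intro mult_mono parabola_cutoff_lipschitz) auto
    finally show ?thesis by simp
  qed
  have "test_fun x0 \<rho> \<tau> t z - test_fun x0 \<rho> \<tau> t z'
    = ((?m (fst z))\<^sup>2 - (?m (fst z'))\<^sup>2) * ?\<theta> (snd z) + (?m (fst z'))\<^sup>2 * (?\<theta> (snd z) - ?\<theta> (snd z'))"
    by (simp add: test_fun_def algebra_simps)
  then have "dist (test_fun x0 \<rho> \<tau> t z) (test_fun x0 \<rho> \<tau> t z')
    \<le> \<bar>(?m (fst z))\<^sup>2 - (?m (fst z'))\<^sup>2\<bar> * \<bar>?\<theta> (snd z)\<bar> + \<bar>(?m (fst z'))\<^sup>2\<bar> * \<bar>?\<theta> (snd z) - ?\<theta> (snd z')\<bar>"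
    by (simp only: dist_real_def abs_mult[symmetric] abs_triangle_ineq)
  also have "\<dots> \<le> (4 * \<rho>\<^sup>2 * \<rho> * dist z z') * 1 + (\<rho>\<^sup>2)\<^sup>2 * (dist z z' / \<tau>)"
  proof (intro add_mono mult_mono)
    show "\<bar>(?m (fst z))\<^sup>2 - (?m (fst z'))\<^sup>2\<bar> \<le> 4 * \<rho>\<^sup>2 * \<rho> * dist z z'"
      by (rule order_trans[OF m2 mult_left_mono[OF d(1)]]) (use \<rho> in simp)
    show "\<bar>?\<theta> (snd z)\<bar> \<le> 1" using trapezoid_bounds[of \<tau> t "snd z"] by simp
    show "\<bar>(?m (fst z'))\<^sup>2\<bar> \<le> (\<rho>\<^sup>2)\<^sup>2"
      using power_mono[OF parabola_cutoff_bounds(2,1)[of x0 \<rho> "fst z'"], of 2] by simp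
    show "\<bar>?\<theta> (snd z) - ?\<theta> (snd z')\<bar> \<le> dist z z' / \<tau>"
      by (rule order_trans[OF trapezoid_lipschitz[OF \<tau>] divide_right_mono[OF d(2)]]) (use \<tau> in simp)
  qed (use \<rho> \<tau> in auto)
  finally show "dist (test_fun x0 \<rho> \<tau> t z) (test_fun x0 \<rho> \<tau> t z') \<le> ?L * dist z z'"
    by (simp add: algebra_simps)
qed

lemma test_fun_Lip_c:
  assumes "0 < \<rho>" "0 < \<tau>" "compact (cball x0 \<rho> \<times> {\<tau>..t})" "cball x0 \<rho> \<times> {\<tau>..t} \<subseteq> E"
  shows "test_fun x0 \<rho> \<tau> t \<in> Lip_c E"
  using test_fun_lipschitz[OF assms(1,2), of x0 t] assms(3,4) test_fun_outside[OF assms(1,2), of _ x0 t]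
  unfolding Lip_c_def compact_supp_in_def by blast

lemma space_grad_test_fun:
  fixes x0 :: "'a::euclidean_space"
  shows "space_grad (test_fun x0 \<rho> \<tau> t) z
    = - (4 * trapezoid \<tau> t (snd z) * parabola_cutoff x0 \<rho> (fst z)) *\<^sub>R (fst z - x0)"
proof -
  let ?m = "parabola_cutoff x0 \<rho>" and ?\<theta> = "trapezoid \<tau> t"
  have "deriv (\<lambda>h. test_fun x0 \<rho> \<tau> t (fst z + h *\<^sub>R b, snd z)) 0 = - (4 * ?\<theta> (snd z) * ?m (fst z)) * ((fst z - x0) \<bullet> b)" for b :: 'a
  proof (rule DERIV_imp_deriv)
    let ?q = "\<lambda>h. \<rho>\<^sup>2 - (norm (fst z + h *\<^sub>R b - x0))\<^sup>2"
    have q: "(?q has_real_derivative - (2 * ((fst z - x0) \<bullet> b))) (at 0)"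
      unfolding power2_norm_eq_inner
      by (auto intro!: derivative_eq_intros has_derivative_imp_has_field_derivative simp: inner_commute algebra_simps)
    from DERIV_chain2[where f = "\<lambda>y. (max 0 y)\<^sup>2" and g = ?q and x = 0, OF has_real_derivative_pos_part_sq q]
    have "((\<lambda>h. (max 0 (?q h))\<^sup>2) has_real_derivative 2 * max 0 (?q 0) * - (2 * ((fst z - x0) \<bullet> b))) (at 0)" .
    from DERIV_cmult_right[OF this, of "?\<theta> (snd z)"]
    show "((\<lambda>h. test_fun x0 \<rho> \<tau> t (fst z + h *\<^sub>R b, snd z)) has_real_derivative - (4 * ?\<theta> (snd z) * ?m (fst z)) * ((fst z - x0) \<bullet> b)) (at 0)"
      by (simp add: test_fun_def parabola_cutoff_def mult_ac)
  qed
  then have "space_grad (test_fun x0 \<rho> \<tau> t) z = (\<Sum>b\<in>Basis. (- (4 * ?\<theta> (snd z) * ?m (fst z)) * ((fst z - x0) \<bullet> b)) *\<^sub>R b)"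
    unfolding space_grad_def by simp
  also have "\<dots> = - (4 * ?\<theta> (snd z) * ?m (fst z)) *\<^sub>R (\<Sum>b\<in>Basis. ((fst z - x0) \<bullet> b) *\<^sub>R b)"
    by (simp only: scaleR_sum_right scaleR_scaleR)
  finally show ?thesis by (simp only: euclidean_representation)
qed

lemma time_deriv_test_fun:
  assumes "0 < \<tau>" "3 * \<tau> \<le> t" "snd z \<notin> {\<tau>, 2 * \<tau>, t - \<tau>, t}"
  shows "time_deriv (test_fun x0 \<rho> \<tau> t) z
    = (parabola_cutoff x0 \<rho> (fst z))\<^sup>2 * ((indicator {\<tau><..<2 * \<tau>} (snd z) - indicator {t - \<tau><..<t} (snd z)) / \<tau>)"
  unfolding time_deriv_def test_fun_def fst_conv snd_conv
  by (intro DERIV_imp_deriv DERIV_cmult trapezoid_deriv assms)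

lemma integrable_bounded_compact_support:
  fixes f :: "'a::euclidean_space \<Rightarrow> real"
  assumes f: "f \<in> borel_measurable borel" and Q: "compact Q"
    and C: "\<And>z. \<bar>f z\<bar> \<le> C" and zero: "\<And>z. z \<notin> Q \<Longrightarrow> f z = 0"
  shows "integrable lborel f"
proof (rule Bochner_Integration.integrable_bound)
  show "integrable lborel (\<lambda>z. indicator Q z * C)"
    using emeasure_compact_finite[OF Q] borel_compact[OF Q]
    by (intro integrable_mult_left integrable_real_indicator) auto
  have "norm (f z) \<le> norm (indicator Q z * C)" for z
    using C[of z] zero[of z] by (cases "z \<in> Q") auto
  then show "AE z in lborel. norm (f z) \<le> norm (indicator Q z * C)" by simp
qed (use f in simp)

lemma AE_snd_neq: "AE z in (lborel :: ('a::euclidean_space \<times> real) measure). snd z \<noteq> c"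
proof -
  have "AE z in lborel \<Otimes>\<^sub>M lborel. snd z \<noteq> c"
  proof (rule lborel_pair.AE_pair_measure)
    show "{z \<in> space (lborel \<Otimes>\<^sub>M lborel). snd z \<noteq> c} \<in> sets (lborel \<Otimes>\<^sub>M lborel)" by measurable
    show "AE x in lborel. AE y in lborel. snd (x, y) \<noteq> c" using AE_lborel_singleton[of c] by simp
  qed
  then show ?thesis by (simp only: lborel_prod)
qed

text \<open>From \<open>(a - 4 b)^2 \<ge> 0\<close> with \<open>a = X sqrt q\<close> and
  \<open>b = \<rho> sqrt S\<close>, that is \<open>4 a b \<le> a^2 / 2 + 8 b^2\<close>. The weight
  is chosen so that half of the gradient term is left over.\<close>

lemma young_inequality:
  fixes S q X \<rho> f :: real
  assumes "S \<ge> 0" "q \<ge> 0" "\<rho> \<ge> 0" "X \<ge> 0" "f\<^sup>2 \<le> S * q"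
  shows "4 * X * \<rho> * \<bar>f\<bar> \<le> X\<^sup>2 * q / 2 + 8 * \<rho>\<^sup>2 * S"
proof -
  have "\<bar>f\<bar> \<le> sqrt (S * q)" using assms(5) by (simp add: real_le_rsqrt)
  then have "4 * X * \<rho> * \<bar>f\<bar> \<le> 4 * X * \<rho> * sqrt (S * q)" using assms by (intro mult_left_mono) auto
  also have "\<dots> = 4 * (X * sqrt q) * (\<rho> * sqrt S)" by (simp add: real_sqrt_mult)
  also have "\<dots> \<le> (X * sqrt q)\<^sup>2 / 2 + 8 * (\<rho> * sqrt S)\<^sup>2"
    using zero_le_power2[of "X * sqrt q - 4 * (\<rho> * sqrt S)"] by (simp add: power2_diff)
  also have "\<dots> = X\<^sup>2 * q / 2 + 8 * \<rho>\<^sup>2 * S" using assms by (simp add: power_mult_distrib)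
  finally show ?thesis .
qed

section \<open>The energy estimate for fixed time cutoff\<close>

context weak_solution
begin

definition hv where "hv z = H (v z)"
definition qF where "qF z = (if v z = 0 then 0 else deriv F (v z))"
abbreviation "m \<equiv> parabola_cutoff x0"
definition Jv where "Jv \<rho> \<sigma> = (\<integral>x. (m \<rho> x)\<^sup>2 * hv (x, \<sigma>) \<partial>lborel)"
definition Zr where "Zr \<rho> t = (\<integral>z. indicator (ball x0 \<rho> \<times> {0<..<t}) z * hv z powr (1 + \<Lambda>) \<partial>lborel)"

lemma v_in: "v z \<in> {0..M}" using v_bounds[of z] by simp

lemma hv_borel [measurable]: "hv \<in> borel_measurable borel"
  unfolding hv_def[abs_def] by (rule borel_measurable_continuous_on_compose[OF H_continuous _ v_borel v_in]) simp

lemma hv_nonneg: "hv z \<ge> 0"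
  using H_pos[of "v z"] H_0 v_bounds[of z] by (cases "v z = 0") (auto simp: hv_def)

lemma H_bounded: obtains B where "B \<ge> 0" "\<And>y. y \<in> {0..M} \<Longrightarrow> \<bar>H y\<bar> \<le> B"
proof -
  have "bounded (H ` {0..M})"
    by (rule compact_imp_bounded, rule compact_continuous_image[OF H_continuous]) simp
  then obtain B where B: "\<forall>y\<in>H ` {0..M}. norm y \<le> B" unfolding bounded_iff by blast
  then have *: "\<bar>H y\<bar> \<le> B" if "y \<in> {0..M}" for y using that by auto
  from order_trans[OF abs_ge_zero this[of 0]] have "B \<ge> 0" using M_pos by simp
  then show ?thesis using that * by blast
qed

lemma hv_bounded: obtains B where "B \<ge> 0" "\<And>z. hv z \<le> B"
proof -
  obtain B where B: "B \<ge> 0" "\<And>y. y \<in> {0..M} \<Longrightarrow> \<bar>H y\<bar> \<le> B" using H_bounded by blast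
  have "hv z \<le> B" for z using B(2)[OF v_in[of z]] by (simp add: hv_def)
  then show ?thesis using that B(1) by blast
qed

lemma hv_outside: "z \<notin> E \<Longrightarrow> hv z = 0"
  by (metis hv_def v_outside H_0)

lemma qF_nonneg: "qF z \<ge> 0"
  using F'_nonneg[of "v z"] v_bounds[of z] by (auto simp: qF_def)

lemma qF_borel [measurable]: "qF \<in> borel_measurable borel"
proof -
  have "(\<lambda>y. indicator {0<..M} y *\<^sub>R deriv F y) \<in> borel_measurable borel"
    by (rule borel_measurable_continuous_on_indicator[OF _ F'_continuous]) simp
  then have "(\<lambda>z. indicator {0<..M} (v z) *\<^sub>R deriv F (v z)) \<in> borel_measurable borel"
    by (rule measurable_compose[OF v_borel])
  also have "(\<lambda>z. indicator {0<..M} (v z) *\<^sub>R deriv F (v z)) = qF"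
    using v_bounds by (auto simp: fun_eq_iff indicator_def less_le qF_def)
  finally show ?thesis .
qed

lemma fst_borel [measurable]: "fst \<in> borel_measurable (borel :: ('a \<times> real) measure)"
  and snd_borel [measurable]: "snd \<in> borel_measurable (borel :: ('a \<times> real) measure)"
  by (intro borel_measurable_continuous_onI continuous_intros)+

lemma m_borel [measurable]: "m \<rho> \<in> borel_measurable borel"
  unfolding parabola_cutoff_def[abs_def] by measurable

lemma trapezoid_borel [measurable]: "trapezoid \<tau> t \<in> borel_measurable borel"
  unfolding trapezoid_def[abs_def] by measurable

lemma ball_borel [measurable]: "ball (c :: 'b::metric_space) e \<in> sets borel"
  by simp

lemma pair_sets [measurable]: "A \<in> sets borel \<Longrightarrow> B \<in> sets borel \<Longrightarrow> A \<times> B \<in> sets (borel :: ('a \<times> real) measure)"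
  by (rule borel_Times)

lemma integrable_Zr: "integrable lborel (\<lambda>z. indicator (ball x0 \<rho> \<times> {0<..<t}) z * hv z powr (1 + \<Lambda>))"
proof -
  obtain B where B: "B \<ge> 0" "\<And>z. hv z \<le> B" using hv_bounded by blast
  show ?thesis
  proof (rule integrable_bounded_compact_support[of _ "cball x0 \<rho> \<times> {0..t}" "B powr (1 + \<Lambda>)"])
    show "compact (cball x0 \<rho> \<times> {0..t})" by (intro compact_Times) auto
    show "\<bar>indicator (ball x0 \<rho> \<times> {0<..<t}) z * hv z powr (1 + \<Lambda>)\<bar> \<le> B powr (1 + \<Lambda>)" for z
      using powr_mono2[of "1 + \<Lambda>" "hv z" B] B hv_nonneg[of z] \<Lambda>_pos by (auto simp: indicator_def)
  qed (measurable, auto simp: indicator_def)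
qed

lemma integrable_slab:
  assumes "0 < \<rho>"
  shows "integrable lborel (\<lambda>z. indicator {a<..<b} (snd z) * ((m \<rho> (fst z))\<^sup>2 * hv z))"
proof -
  obtain B where B: "B \<ge> 0" "\<And>z. hv z \<le> B" using hv_bounded by blast
  show ?thesis
  proof (rule integrable_bounded_compact_support[of _ "cball x0 \<rho> \<times> {a..b}" "(\<rho>\<^sup>2)\<^sup>2 * B"])
    show "compact (cball x0 \<rho> \<times> {a..b})" by (intro compact_Times) auto
    show "\<bar>indicator {a<..<b} (snd z) * ((m \<rho> (fst z))\<^sup>2 * hv z)\<bar> \<le> (\<rho>\<^sup>2)\<^sup>2 * B" for z
      using mult_mono[OF power_mono[OF parabola_cutoff_bounds(2,1)[of x0 \<rho> "fst z"], of 2] B(2)[of z]] B(1) hv_nonneg[of z]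
      by (auto simp: indicator_def abs_mult)
    show "indicator {a<..<b} (snd z) * ((m \<rho> (fst z))\<^sup>2 * hv z) = 0" if "z \<notin> cball x0 \<rho> \<times> {a..b}" for z
      using that parabola_cutoff_outside[OF assms, of "fst z" x0] by (cases z) (auto simp: indicator_def)
  qed measurable
qed

lemma slab_integral:
  assumes "0 < \<rho>"
  shows "integrable lborel (\<lambda>\<sigma>. indicator {a<..<b} \<sigma> * Jv \<rho> \<sigma>)"
    "(\<integral>z. indicator {a<..<b} (snd z) * ((m \<rho> (fst z))\<^sup>2 * hv z) \<partial>lborel) = (\<integral>\<sigma>. indicator {a<..<b} \<sigma> * Jv \<rho> \<sigma> \<partial>lborel)"
proof -
  have i: "integrable (lborel \<Otimes>\<^sub>M lborel) (\<lambda>(x, \<sigma>). indicator {a<..<b} \<sigma> * ((m \<rho> x)\<^sup>2 * hv (x, \<sigma>)))"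
    using integrable_slab[OF assms, of a b] by (simp add: lborel_prod case_prod_unfold)
  show "integrable lborel (\<lambda>\<sigma>. indicator {a<..<b} \<sigma> * Jv \<rho> \<sigma>)"
    using lborel_pair.integrable_snd[OF i] by (simp add: Jv_def)
  show "(\<integral>z. indicator {a<..<b} (snd z) * ((m \<rho> (fst z))\<^sup>2 * hv z) \<partial>lborel) = (\<integral>\<sigma>. indicator {a<..<b} \<sigma> * Jv \<rho> \<sigma> \<partial>lborel)"
    using lborel_pair.integral_snd[OF i] by (simp add: Jv_def lborel_prod case_prod_unfold)
qed

text \<open>The mixed term is at most \<open>4 \<theta> m \<rho> |F| |G|\<close> with
  \<open>m\<close> and \<open>\<theta>\<close> the two cutoffs. Young's inequality with
  \<open>F^2 \<le> C1 H^(1+\<Lambda>) F'\<close> uses up half of the gradient term and leaves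
  \<open>8 \<rho>^2 C1 H^(1+\<Lambda>)\<close>, in which \<open>\<theta> \<le> 1\<close> is
  dropped.\<close>

lemma diffusion_lower_bound:
  assumes \<rho>: "0 < \<rho>" and \<tau>: "0 < \<tau>"
  shows "test_fun x0 \<rho> \<tau> t z * qF z * (norm (G z))\<^sup>2 / 2
    \<le> diffusion_term F v G (test_fun x0 \<rho> \<tau> t) z
      + 8 * \<rho>\<^sup>2 * C1 * (indicator (ball x0 \<rho> \<times> {0<..<t}) z * hv z powr (1 + \<Lambda>))"
proof -
  let ?\<theta> = "trapezoid \<tau> t (snd z)" and ?m = "m \<rho> (fst z)" and ?I = "indicator (ball x0 \<rho> \<times> {0<..<t}) z :: real"
  have \<theta>: "0 \<le> ?\<theta>" "?\<theta> \<le> 1" by (rule trapezoid_bounds)+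
  have D: "diffusion_term F v G (test_fun x0 \<rho> \<tau> t) z
      = ?m\<^sup>2 * ?\<theta> * qF z * (norm (G z))\<^sup>2 - 4 * ?\<theta> * ?m * (F (v z) * (G z \<bullet> (fst z - x0)))"
    by (simp add: diffusion_term_def space_grad_test_fun qF_def test_fun_def)
  have nn: "0 \<le> 8 * \<rho>\<^sup>2 * C1 * (?I * hv z powr (1 + \<Lambda>))" using C1_pos by simp
  show ?thesis
  \<comment> \<open>In the degenerate cases the diffusion term itself vanishes: at
    \<open>v z = 0\<close> by its convention together with \<open>F 0 = 0\<close>, otherwise because
    a cutoff is 0.\<close>
  proof (cases "v z = 0 \<or> ?m = 0 \<or> ?\<theta> = 0")
    case True
    then show ?thesis unfolding D test_fun_def using nn F_0 by (auto simp: qF_def)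
  next
    case False
    then have v0: "0 < v z" using v_bounds[of z] by auto
    have x: "fst z \<in> ball x0 \<rho>" using False parabola_cutoff_outside[OF \<rho>] by blast
    have "snd z \<in> {\<tau>..t}" using False trapezoid_outside[OF \<tau>] by blast
    moreover have "snd z \<noteq> t" using False by (auto simp: trapezoid_def)
    ultimately have I: "?I = 1" using x \<tau> by (cases z) auto
    define S where "S = C1 * hv z powr (1 + \<Lambda>)"
    have S: "S \<ge> 0" using C1_pos by (simp add: S_def)
    have f: "(F (v z))\<^sup>2 \<le> S * qF z"
      using F_sq_le[OF v0] v_bounds[of z] v0 by (simp add: S_def qF_def hv_def)
    have m0: "?m \<ge> 0" by (rule parabola_cutoff_bounds)
    have "norm (fst z - x0) \<le> \<rho>" using x by (simp add: dist_norm norm_minus_commute)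
    then have "\<bar>G z \<bullet> (fst z - x0)\<bar> \<le> norm (G z) * \<rho>"
      using Cauchy_Schwarz_ineq2[of "G z" "fst z - x0"] mult_left_mono[of "norm (fst z - x0)" \<rho> "norm (G z)"] by simp
    then have "\<bar>F (v z)\<bar> * \<bar>G z \<bullet> (fst z - x0)\<bar> \<le> \<bar>F (v z)\<bar> * (norm (G z) * \<rho>)" by (rule mult_left_mono) simp
    then have "F (v z) * (G z \<bullet> (fst z - x0)) \<le> norm (G z) * \<rho> * \<bar>F (v z)\<bar>"
      using abs_ge_self[of "F (v z) * (G z \<bullet> (fst z - x0))"] by (simp add: abs_mult mult_ac)
    then have "4 * ?m * (F (v z) * (G z \<bullet> (fst z - x0))) \<le> 4 * ?m * (norm (G z) * \<rho> * \<bar>F (v z)\<bar>)"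
      using m0 by (intro mult_left_mono) auto
    also have "\<dots> = 4 * (?m * norm (G z)) * \<rho> * \<bar>F (v z)\<bar>" by simp
    also have "\<dots> \<le> (?m * norm (G z))\<^sup>2 * qF z / 2 + 8 * \<rho>\<^sup>2 * S"
      using S qF_nonneg \<rho> m0 f by (intro young_inequality) auto
    finally have "?\<theta> * (4 * ?m * (F (v z) * (G z \<bullet> (fst z - x0)))) \<le> ?\<theta> * ((?m * norm (G z))\<^sup>2 * qF z / 2 + 8 * \<rho>\<^sup>2 * S)"
      by (rule mult_left_mono) (rule \<theta>)
    moreover have "?\<theta> * (8 * \<rho>\<^sup>2 * S) \<le> 8 * \<rho>\<^sup>2 * S" using \<theta> S by (intro mult_left_le_one_le) auto
    ultimately show ?thesis
      unfolding D I test_fun_def S_def by (simp add: power_mult_distrib algebra_simps)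
  qed
qed

lemma energy_estimate:
  assumes \<rho>: "0 < \<rho>" "\<rho> \<le> R" and \<tau>: "0 < \<tau>" "3 * \<tau> \<le> t" "t < T"
  defines "A \<equiv> ((\<integral>\<sigma>. indicator {\<tau><..<2 * \<tau>} \<sigma> * Jv \<rho> \<sigma> \<partial>lborel) - (\<integral>\<sigma>. indicator {t - \<tau><..<t} \<sigma> * Jv \<rho> \<sigma> \<partial>lborel)) / \<tau>
    + 8 * \<rho>\<^sup>2 * C1 * Zr \<rho> t"
  shows "0 \<le> A" "(\<integral>\<^sup>+z. ennreal (test_fun x0 \<rho> \<tau> t z * qF z * (norm (G z))\<^sup>2 / 2) \<partial>lborel) \<le> ennreal A"
proof -
  let ?\<phi> = "test_fun x0 \<rho> \<tau> t"
  let ?D = "\<lambda>z. indicator E z *\<^sub>R diffusion_term F u g ?\<phi> z"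
  let ?Y = "\<lambda>z. indicator (ball x0 \<rho> \<times> {0<..<t}) z * hv z powr (1 + \<Lambda>)"
  let ?c = "8 * \<rho>\<^sup>2 * C1"
  have "?\<phi> \<in> Lip_c E" using Q_props[OF \<tau>(1,3) \<rho>(2)] by (intro test_fun_Lip_c \<rho> \<tau>)
  from ineq[OF this test_fun_nonneg]
  have Di: "integrable lebesgue ?D"
    and le: "(\<integral>z. ?D z \<partial>lebesgue) \<le> (LINT z:E|lebesgue. time_deriv ?\<phi> z * H (u z))"
    unfolding set_integrable_def set_lebesgue_integral_def by auto
  have Yi: "integrable lebesgue ?Y" using integrable_Zr[of \<rho> t] by (simp add: integrable_completion)
  have Yint: "(\<integral>z. ?Y z \<partial>lebesgue) = Zr \<rho> t" unfolding Zr_def by (rule integral_completion) measurable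
  have pw: "AE z in lebesgue. ?\<phi> z * qF z * (norm (G z))\<^sup>2 / 2 \<le> ?D z + ?c * ?Y z"
  proof (rule AE_completion)
    show "AE z in lborel. ?\<phi> z * qF z * (norm (G z))\<^sup>2 / 2 \<le> ?D z + ?c * ?Y z"
      using u_v g_G
    proof eventually_elim
      case (elim z)
      show ?case
      proof (cases "z \<in> E")
        case True
        then have "diffusion_term F u g ?\<phi> z = diffusion_term F v G ?\<phi> z"
          using elim by (simp only: diffusion_term_def mp)
        then show ?thesis using diffusion_lower_bound[OF \<rho>(1) \<tau>(1), of t z] True by (simp only: indicator_simps scaleR_one)
      next
        case False
        then have "G z = 0" by (rule G_outside)
        then show ?thesis using False C1_pos by (simp only: indicator_simps) simp
      qed
    qed
  qed
  have nnl: "0 \<le> ?\<phi> z * qF z * (norm (G z))\<^sup>2 / 2" for z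
    using test_fun_nonneg[of x0 \<rho> \<tau> t z] qF_nonneg[of z] by simp
  have DYi: "integrable lebesgue (\<lambda>z. ?D z + ?c * ?Y z)" using Di Yi by (intro Bochner_Integration.integrable_add integrable_mult_right)
  have DYint: "(\<integral>z. ?D z + ?c * ?Y z \<partial>lebesgue) = (\<integral>z. ?D z \<partial>lebesgue) + ?c * Zr \<rho> t"
    unfolding Yint[symmetric] using Bochner_Integration.integral_add[OF Di integrable_mult_right[OF Yi, of ?c]] by simp
  \<comment> \<open>Nonnegativity comes from the pointwise lower bound. It lets the Bochner
    integral, which the inequality controls, be read as a nonnegative integral, and it yields
    \<open>0 \<le> A\<close>.\<close>
  have DY0: "AE z in lebesgue. 0 \<le> ?D z + ?c * ?Y z"
    using pw by eventually_elim (use nnl order_trans in blast)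
  have rhs: "(LINT z:E|lebesgue. time_deriv ?\<phi> z * H (u z))
    = ((\<integral>\<sigma>. indicator {\<tau><..<2 * \<tau>} \<sigma> * Jv \<rho> \<sigma> \<partial>lborel) - (\<integral>\<sigma>. indicator {t - \<tau><..<t} \<sigma> * Jv \<rho> \<sigma> \<partial>lborel)) / \<tau>"
  proof -
    let ?f1 = "\<lambda>z. indicator {\<tau><..<2 * \<tau>} (snd z) * ((m \<rho> (fst z))\<^sup>2 * hv z)"
    let ?f2 = "\<lambda>z. indicator {t - \<tau><..<t} (snd z) * ((m \<rho> (fst z))\<^sup>2 * hv z)"
    have "(LINT z:E|lebesgue. time_deriv ?\<phi> z * H (u z)) = (\<integral>z. indicator E z *\<^sub>R ((?f1 z - ?f2 z) / \<tau>) \<partial>lborel)"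
    proof (rule lebesgue_set_integral_representative(2)[OF E_borel])
      show "AE z in lborel. z \<in> E \<longrightarrow> time_deriv ?\<phi> z * H (u z) = (?f1 z - ?f2 z) / \<tau>"
        \<comment> \<open>The test function fails to be differentiable in time at most at the four
          corner times of the trapezoid, which form a null set.\<close>
        using u_v AE_snd_neq[of \<tau>] AE_snd_neq[of "2 * \<tau>"] AE_snd_neq[of "t - \<tau>"] AE_snd_neq[of t]
      proof eventually_elim
        case (elim z)
        have td: "time_deriv ?\<phi> z = (m \<rho> (fst z))\<^sup>2 * ((indicator {\<tau><..<2 * \<tau>} (snd z) - indicator {t - \<tau><..<t} (snd z)) / \<tau>)"
          by (rule time_deriv_test_fun[OF \<tau>(1,2)]) (use elim in auto)
        show ?case
        proof
          assume "z \<in> E"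
          with elim have "H (u z) = hv z" by (simp only: hv_def mp)
          then show "time_deriv ?\<phi> z * H (u z) = (?f1 z - ?f2 z) / \<tau>"
            unfolding td by (simp add: diff_divide_distrib algebra_simps)
        qed
      qed
    qed measurable
    also have "(\<lambda>z. indicator E z *\<^sub>R ((?f1 z - ?f2 z) / \<tau>)) = (\<lambda>z. (?f1 z - ?f2 z) / \<tau>)"
    proof
      fix z
      show "indicator E z *\<^sub>R ((?f1 z - ?f2 z) / \<tau>) = (?f1 z - ?f2 z) / \<tau>"
        by (cases "z \<in> E") (simp_all only: not_False_eq_True indicator_simps scaleR_one hv_outside mult_zero_right diff_self div_0 scaleR_zero_right)
    qed
    also have "(\<integral>z. (?f1 z - ?f2 z) / \<tau> \<partial>lborel) = ((\<integral>z. ?f1 z \<partial>lborel) - (\<integral>z. ?f2 z \<partial>lborel)) / \<tau>"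
      using integrable_slab[OF \<rho>(1), of \<tau> "2 * \<tau>"] integrable_slab[OF \<rho>(1), of "t - \<tau>" t] by simp
    finally show ?thesis by (simp only: slab_integral(2)[OF \<rho>(1)])
  qed
  have DA: "(\<integral>z. ?D z + ?c * ?Y z \<partial>lebesgue) \<le> A" unfolding DYint A_def using le rhs by simp
  have "0 \<le> (\<integral>z. ?D z + ?c * ?Y z \<partial>lebesgue)" by (rule integral_nonneg_AE[OF DY0])
  then show "0 \<le> A" using DA by simp
  have "(\<integral>\<^sup>+z. ennreal (?\<phi> z * qF z * (norm (G z))\<^sup>2 / 2) \<partial>lborel) = (\<integral>\<^sup>+z. ennreal (?\<phi> z * qF z * (norm (G z))\<^sup>2 / 2) \<partial>lebesgue)"
    by (rule nn_integral_completion[symmetric])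
  also have "\<dots> \<le> (\<integral>\<^sup>+z. ennreal (?D z + ?c * ?Y z) \<partial>lebesgue)"
    by (rule nn_integral_mono_AE) (use pw in eventually_elim, rule ennreal_leI)
  also have "\<dots> = ennreal (\<integral>z. ?D z + ?c * ?Y z \<partial>lebesgue)" by (rule nn_integral_eq_integral[OF DYi DY0])
  also have "\<dots> \<le> ennreal A" by (rule ennreal_leI[OF DA])
  finally show "(\<integral>\<^sup>+z. ennreal (?\<phi> z * qF z * (norm (G z))\<^sup>2 / 2) \<partial>lborel) \<le> ennreal A" .
qed


section \<open>Passage to the limit in the time cutoff\<close>

definition Hc where "Hc y = H (max 0 (min M y))"
text \<open>Built from the slices of \<open>u\<close> at every single time, hence continuous in
  time, whereas \<open>Jv\<close> uses the Borel representative; the two agree at almost every time.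
  A slice of \<open>u\<close> may leave \<open>[0, M]\<close>, so the clamped \<open>Hc\<close>
  replaces \<open>H\<close>; it is bounded and uniformly continuous on the whole line.\<close>

definition J where "J \<rho> \<sigma> = (\<integral>x. (m \<rho> x)\<^sup>2 * Hc (u (x, \<sigma>)) \<partial>lebesgue)"

lemma clamp_in: "max 0 (min M y) \<in> {0..M}" using M_pos by auto

lemma J_tendsto:
  assumes \<rho>: "0 < \<rho>" "\<rho> \<le> R" and t: "t \<in> {0..T}"
  shows "(J \<rho> \<longlongrightarrow> J \<rho> t) (at t within {0..T})"
proof -
  obtain B where B: "\<And>y. y \<in> {0..M} \<Longrightarrow> \<bar>H y\<bar> \<le> B" using H_bounded by blast
  have "cball x0 \<rho> \<subseteq> \<Omega>" using R_\<Omega> \<rho>(2) by (meson order_trans subset_cball)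
  moreover have "uniformly_continuous_on UNIV Hc"
    unfolding uniformly_continuous_on_def
  proof (intro allI impI)
    fix e :: real assume "e > 0"
    moreover have "uniformly_continuous_on {0..M} H"
      by (rule compact_uniformly_continuous[OF H_continuous]) simp
    ultimately obtain d where d: "d > 0" "\<And>y y'. y \<in> {0..M} \<Longrightarrow> y' \<in> {0..M} \<Longrightarrow> dist y' y < d \<Longrightarrow> dist (H y') (H y) < e"
      unfolding uniformly_continuous_on_def by blast
    have "dist (Hc y') (Hc y) < e" if "dist y' y < d" for y y'
      unfolding Hc_def
    proof (rule d(2)[OF clamp_in clamp_in])
      have "dist (max 0 (min M y')) (max 0 (min M y)) \<le> dist y' y" unfolding dist_real_def by linarith
      then show "dist (max 0 (min M y')) (max 0 (min M y)) < d" using that by linarith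
    qed
    then show "\<exists>d>0. \<forall>x\<in>UNIV. \<forall>x'\<in>UNIV. dist x' x < d \<longrightarrow> dist (Hc x') (Hc x) < e" using d(1) by blast
  qed
  moreover have "\<bar>Hc y\<bar> \<le> B" for y unfolding Hc_def by (rule B[OF clamp_in])
  moreover have "(m \<rho> x)\<^sup>2 = 0" if "x \<notin> cball x0 \<rho>" for x
    using that parabola_cutoff_outside[OF \<rho>(1), of x x0] by auto
  moreover have "\<bar>(m \<rho> x)\<^sup>2\<bar> \<le> (\<rho>\<^sup>2)\<^sup>2" for x
    using power_mono[OF parabola_cutoff_bounds(2,1)[of x0 \<rho> x], of 2] by simp
  ultimately show ?thesis
    unfolding J_def[abs_def] by (intro slice_integral_tendsto[OF u_cont \<Omega> compact_cball _ _ _ _ _ _ t]) measurable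
qed

lemma J_eq_Jv: "AE \<sigma> in lborel. \<sigma> \<in> {0<..<T} \<longrightarrow> 0 < \<rho> \<longrightarrow> \<rho> \<le> R \<longrightarrow> J \<rho> \<sigma> = Jv \<rho> \<sigma>"
  using AE_slices[OF u_v]
proof eventually_elim
  case (elim \<sigma>)
  show ?case
  proof (intro impI)
    assume \<sigma>: "\<sigma> \<in> {0<..<T}" and \<rho>: "0 < \<rho>" "\<rho> \<le> R"
    have "(LINT x:UNIV|lebesgue. (m \<rho> x)\<^sup>2 * Hc (u (x, \<sigma>))) = (\<integral>x. indicator UNIV x *\<^sub>R ((m \<rho> x)\<^sup>2 * hv (x, \<sigma>)) \<partial>lborel)"
    proof (rule lebesgue_set_integral_representative(2))
      show "AE x in lborel. x \<in> UNIV \<longrightarrow> (m \<rho> x)\<^sup>2 * Hc (u (x, \<sigma>)) = (m \<rho> x)\<^sup>2 * hv (x, \<sigma>)"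
        using elim
      proof eventually_elim
        case (elim x)
        show ?case
        proof (cases "x \<in> ball x0 \<rho>")
          case True
          then have "x \<in> cball x0 R" using \<rho>(2) by auto
          then have "(x, \<sigma>) \<in> E" using R_\<Omega> \<sigma> by blast
          with elim have "u (x, \<sigma>) = v (x, \<sigma>)" by blast
          then show ?thesis using v_bounds[of "(x, \<sigma>)"] by (simp add: Hc_def hv_def)
        next
          case False
          then show ?thesis using parabola_cutoff_outside[OF \<rho>(1) False] by simp
        qed
      qed
    qed measurable
    then show "J \<rho> \<sigma> = Jv \<rho> \<sigma>" by (simp add: J_def Jv_def set_lebesgue_integral_def)
  qed
qed

lemma J_0:
  assumes \<rho>: "0 < \<rho>" "\<rho> \<le> R"
  shows "J \<rho> 0 = 0"
proof -
  have "J \<rho> 0 = (LINT x:UNIV|lebesgue. (m \<rho> x)\<^sup>2 * Hc (u (x, 0)))" by (simp add: J_def set_lebesgue_integral_def)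
  also have "\<dots> = (\<integral>x. indicator UNIV x *\<^sub>R 0 \<partial>(lborel :: 'a measure))"
  proof (rule lebesgue_set_integral_representative(2))
    show "AE x in lborel. x \<in> UNIV \<longrightarrow> (m \<rho> x)\<^sup>2 * Hc (u (x, 0)) = 0"
      using u_init
    proof eventually_elim
      case (elim x)
      show ?case
      proof (cases "x \<in> ball x0 \<rho>")
        case True
        then have "u (x, 0) = 0" using elim \<rho>(2) by auto
        then show ?thesis using M_pos by (simp add: Hc_def H_0)
      qed (use parabola_cutoff_outside[OF \<rho>(1), of x x0] in simp)
    qed
  qed auto
  finally show ?thesis by simp
qed

lemma Hc_nonneg: "Hc y \<ge> 0"
proof -
  have "H x \<ge> 0" if "x \<in> {0..M}" for x using H_pos[of x] H_0 that by (cases "x = 0") auto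
  from this[OF clamp_in] show ?thesis unfolding Hc_def .
qed

lemma J_nonneg: "J \<rho> \<sigma> \<ge> 0"
  unfolding J_def using Hc_nonneg by (intro integral_nonneg_AE) auto

text \<open>As \<open>\<tau>\<close> tends to 0, the averages in \<open>energy_estimate\<close>
  approach \<open>J \<rho> 0 = 0\<close> and \<open>J \<rho> t\<close>; each is off by at most
  \<open>e\<close>, whence \<open>2 e\<close>. The right side is uniform in small
  \<open>\<tau>\<close>, which the exhaustion in \<open>gradient_energy\<close> relies on.\<close>

lemma energy_limit:
  assumes \<rho>: "0 < \<rho>" "\<rho> \<le> R" and t: "0 < t" "t < T" and e: "e > 0"
  obtains \<tau>0 where "\<tau>0 > 0" "0 \<le> 2 * e - J \<rho> t + 8 * \<rho>\<^sup>2 * C1 * Zr \<rho> t"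
    "\<And>\<tau>. 0 < \<tau> \<Longrightarrow> \<tau> \<le> \<tau>0 \<Longrightarrow> (\<integral>\<^sup>+z. ennreal (test_fun x0 \<rho> \<tau> t z * qF z * (norm (G z))\<^sup>2 / 2) \<partial>lborel)
        \<le> ennreal (2 * e - J \<rho> t + 8 * \<rho>\<^sup>2 * C1 * Zr \<rho> t)"
proof -
  have near: "\<exists>d>0. \<forall>\<sigma>\<in>{0..T}. \<sigma> \<noteq> c \<longrightarrow> dist \<sigma> c < d \<longrightarrow> dist (J \<rho> \<sigma>) (J \<rho> c) < e" if "c \<in> {0..T}" for c
    using tendstoD[OF J_tendsto[OF \<rho> that] e] unfolding eventually_at by blast
  obtain d1 where d1: "d1 > 0" "\<And>\<sigma>. \<sigma> \<in> {0..T} \<Longrightarrow> \<sigma> \<noteq> 0 \<Longrightarrow> dist \<sigma> 0 < d1 \<Longrightarrow> dist (J \<rho> \<sigma>) (J \<rho> 0) < e"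
    using near[of 0] T_pos by auto
  obtain d2 where d2: "d2 > 0" "\<And>\<sigma>. \<sigma> \<in> {0..T} \<Longrightarrow> \<sigma> \<noteq> t \<Longrightarrow> dist \<sigma> t < d2 \<Longrightarrow> dist (J \<rho> \<sigma>) (J \<rho> t) < e"
    using near[of t] t by auto
  \<comment> \<open>\<open>t / 3\<close> secures \<open>3 \<tau> \<le> t\<close>;
    \<open>d1 / 2\<close> is needed because the first ramp extends up to
    \<open>2 \<tau>\<close>.\<close>
  define \<tau>0 where "\<tau>0 = min (t / 3) (min (d1 / 2) d2)"
  have \<tau>0: "\<tau>0 > 0" "\<tau>0 \<le> t / 3" "\<tau>0 \<le> d1 / 2" "\<tau>0 \<le> d2"
    using t d1(1) d2(1) unfolding \<tau>0_def by linarith+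
  have le: "((\<integral>\<sigma>. indicator {\<tau><..<2 * \<tau>} \<sigma> * Jv \<rho> \<sigma> \<partial>lborel) - (\<integral>\<sigma>. indicator {t - \<tau><..<t} \<sigma> * Jv \<rho> \<sigma> \<partial>lborel)) / \<tau> \<le> 2 * e - J \<rho> t"
    if \<tau>: "0 < \<tau>" "\<tau> \<le> \<tau>0" for \<tau>
  proof -
    have meas: "(\<integral>\<sigma>. indicator {a<..<a + \<tau>} \<sigma> * c \<partial>lborel) = \<tau> * c"
      and icst: "integrable lborel (\<lambda>\<sigma>::real. indicator {a<..<a + \<tau>} \<sigma> * c)" for a c :: real
      using \<tau>(1) by (auto intro!: integrable_mult_left integrable_real_indicator)
    have "(\<integral>\<sigma>. indicator {\<tau><..<2 * \<tau>} \<sigma> * Jv \<rho> \<sigma> \<partial>lborel) \<le> (\<integral>\<sigma>. indicator {\<tau><..<\<tau> + \<tau>} \<sigma> * e \<partial>lborel)"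
    proof (rule integral_mono_AE[OF slab_integral(1)[OF \<rho>(1)] icst])
      show "AE \<sigma> in lborel. indicator {\<tau><..<2 * \<tau>} \<sigma> * Jv \<rho> \<sigma> \<le> indicator {\<tau><..<\<tau> + \<tau>} \<sigma> * e"
        using J_eq_Jv[of \<rho>]
      proof eventually_elim
        case (elim \<sigma>)
        show ?case
        proof (cases "\<sigma> \<in> {\<tau><..<2 * \<tau>}")
          case True
          then have "\<sigma> \<in> {0<..<T}" "dist \<sigma> 0 < d1" using \<tau> \<tau>0 t by (auto simp: dist_real_def)
          then have "J \<rho> \<sigma> \<le> e" using d1(2)[of \<sigma>] J_0[OF \<rho>] by (auto simp: dist_real_def)
          then show ?thesis using True elim \<rho> \<open>\<sigma> \<in> {0<..<T}\<close> by simp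
        qed simp
      qed
    qed
    also have "\<dots> = \<tau> * e" by (rule meas)
    finally have 1: "(\<integral>\<sigma>. indicator {\<tau><..<2 * \<tau>} \<sigma> * Jv \<rho> \<sigma> \<partial>lborel) \<le> \<tau> * e" .
    have "(\<integral>\<sigma>. indicator {t - \<tau><..<t - \<tau> + \<tau>} \<sigma> * (J \<rho> t - e) \<partial>lborel) \<le> (\<integral>\<sigma>. indicator {t - \<tau><..<t} \<sigma> * Jv \<rho> \<sigma> \<partial>lborel)"
    proof (rule integral_mono_AE[OF icst slab_integral(1)[OF \<rho>(1)]])
      show "AE \<sigma> in lborel. indicator {t - \<tau><..<t - \<tau> + \<tau>} \<sigma> * (J \<rho> t - e) \<le> indicator {t - \<tau><..<t} \<sigma> * Jv \<rho> \<sigma>"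
        using J_eq_Jv[of \<rho>]
      proof eventually_elim
        case (elim \<sigma>)
        show ?case
        proof (cases "\<sigma> \<in> {t - \<tau><..<t}")
          case True
          then have "\<sigma> \<in> {0<..<T}" "dist \<sigma> t < d2" "\<sigma> \<noteq> t" using \<tau> \<tau>0 t by (auto simp: dist_real_def)
          then have "J \<rho> t - e \<le> J \<rho> \<sigma>" using d2(2)[of \<sigma>] by (auto simp: dist_real_def)
          then show ?thesis using True elim \<rho> \<open>\<sigma> \<in> {0<..<T}\<close> by simp
        qed simp
      qed
    qed
    then have 2: "\<tau> * (J \<rho> t - e) \<le> (\<integral>\<sigma>. indicator {t - \<tau><..<t} \<sigma> * Jv \<rho> \<sigma> \<partial>lborel)" unfolding meas .
    have "(\<integral>\<sigma>. indicator {\<tau><..<2 * \<tau>} \<sigma> * Jv \<rho> \<sigma> \<partial>lborel) - (\<integral>\<sigma>. indicator {t - \<tau><..<t} \<sigma> * Jv \<rho> \<sigma> \<partial>lborel) \<le> (2 * e - J \<rho> t) * \<tau>"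
      using 1 2 by (simp add: algebra_simps)
    then show ?thesis using \<tau>(1) by (simp only: pos_divide_le_eq)
  qed
  show ?thesis
  proof (rule that[OF \<tau>0(1)])
    have "3 * \<tau>0 \<le> t" using \<tau>0 by linarith
    from energy_estimate(1)[OF \<rho> \<tau>0(1) this t(2)] le[OF \<tau>0(1) order_refl]
    show "0 \<le> 2 * e - J \<rho> t + 8 * \<rho>\<^sup>2 * C1 * Zr \<rho> t" by linarith
    fix \<tau> assume \<tau>: "0 < \<tau>" "\<tau> \<le> \<tau>0"
    then have "3 * \<tau> \<le> t" using \<tau>0 by linarith
    note est = energy_estimate[OF \<rho> \<tau>(1) this t(2)]
    show "(\<integral>\<^sup>+z. ennreal (test_fun x0 \<rho> \<tau> t z * qF z * (norm (G z))\<^sup>2 / 2) \<partial>lborel)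
        \<le> ennreal (2 * e - J \<rho> t + 8 * \<rho>\<^sup>2 * C1 * Zr \<rho> t)"
      by (rule order_trans[OF est(2) ennreal_leI]) (use le[OF \<tau>] in linarith)
  qed
qed

lemma Zr_ennreal: "ennreal (Zr \<rho> t) = (\<integral>\<^sup>+z\<in>ball x0 \<rho> \<times> {0<..<t}. ennreal (hv z powr (1 + \<Lambda>)) \<partial>lborel)"
proof -
  have "ennreal (Zr \<rho> t) = (\<integral>\<^sup>+z. ennreal (indicator (ball x0 \<rho> \<times> {0<..<t}) z * hv z powr (1 + \<Lambda>)) \<partial>lborel)"
    unfolding Zr_def by (rule nn_integral_eq_integral[symmetric, OF integrable_Zr]) simp
  also have "\<dots> = (\<integral>\<^sup>+z\<in>ball x0 \<rho> \<times> {0<..<t}. ennreal (hv z powr (1 + \<Lambda>)) \<partial>lborel)"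
    by (intro nn_integral_cong) (simp split: split_indicator)
  finally show ?thesis .
qed

lemma Zr_nonneg: "Zr \<rho> t \<ge> 0"
  unfolding Zr_def by (intro integral_nonneg_AE) simp

text \<open>The nonnegativity in \<open>energy_limit\<close> already says
  \<open>J \<rho> t \<le> 2 e + 8 \<rho>^2 C1 Zr \<rho> t\<close> for every \<open>e\<close>. The
  bound is stated with \<open>Z\<close> up to the later time \<open>s\<close>, so that it is the
  same for all slices.\<close>

lemma slice_energy:
  assumes \<rho>: "0 < \<rho>" "\<rho> \<le> R" and s: "0 < s" "s < T"
  shows "AE t in lborel. t \<in> {0<..<s} \<longrightarrow> (\<integral>\<^sup>+x. ennreal ((m \<rho> x)\<^sup>2 * hv (x, t)) \<partial>lborel)
    \<le> ennreal (16 * C1 * \<rho>\<^sup>2) * (\<integral>\<^sup>+z\<in>ball x0 \<rho> \<times> {0<..<s}. ennreal (hv z powr (1 + \<Lambda>)) \<partial>lborel)"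
  using J_eq_Jv[of \<rho>]
proof eventually_elim
  case (elim t)
  show ?case
  proof
    assume ts: "t \<in> {0<..<s}"
    then have t: "0 < t" "t < T" "t \<in> {0<..<T}" using s by auto
    have "J \<rho> t \<le> 8 * \<rho>\<^sup>2 * C1 * Zr \<rho> t"
    proof (rule field_le_epsilon)
      fix e :: real assume "e > 0"
      then have "e / 2 > 0" by simp
      from energy_limit[OF \<rho> t(1,2) this]
      have "0 \<le> 2 * (e / 2) - J \<rho> t + 8 * \<rho>\<^sup>2 * C1 * Zr \<rho> t" by metis
      then show "J \<rho> t \<le> 8 * \<rho>\<^sup>2 * C1 * Zr \<rho> t + e" by simp
    qed
    \<comment> \<open>The constant is doubled to match the gradient bound, so that both share one
      \<open>K\<close>.\<close>
    also have "\<dots> \<le> (16 * C1 * \<rho>\<^sup>2) * Zr \<rho> t" using C1_pos Zr_nonneg[of \<rho> t] by simp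
    finally have J: "J \<rho> t \<le> (16 * C1 * \<rho>\<^sup>2) * Zr \<rho> t" .
    obtain B where B: "B \<ge> 0" "\<And>z. hv z \<le> B" using hv_bounded by blast
    have "integrable lborel (\<lambda>x. (m \<rho> x)\<^sup>2 * hv (x, t))"
    proof (rule integrable_bounded_compact_support[of _ "cball x0 \<rho>" "(\<rho>\<^sup>2)\<^sup>2 * B"])
      show "\<bar>(m \<rho> x)\<^sup>2 * hv (x, t)\<bar> \<le> (\<rho>\<^sup>2)\<^sup>2 * B" for x
        using mult_mono[OF power_mono[OF parabola_cutoff_bounds(2,1)[of x0 \<rho> x], of 2] B(2)[of "(x, t)"]] hv_nonneg[of "(x, t)"]
        by (simp add: abs_mult)
      show "(m \<rho> x)\<^sup>2 * hv (x, t) = 0" if "x \<notin> cball x0 \<rho>" for x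
        using that parabola_cutoff_outside[OF \<rho>(1), of x x0] by auto
      show "(\<lambda>x. (m \<rho> x)\<^sup>2 * hv (x, t)) \<in> borel_measurable borel" by measurable
    qed (rule compact_cball)
    then have "(\<integral>\<^sup>+x. ennreal ((m \<rho> x)\<^sup>2 * hv (x, t)) \<partial>lborel) = ennreal (Jv \<rho> t)"
      unfolding Jv_def using hv_nonneg by (intro nn_integral_eq_integral) auto
    also have "\<dots> \<le> ennreal ((16 * C1 * \<rho>\<^sup>2) * Zr \<rho> t)" using J elim t(3) \<rho> by (intro ennreal_leI) simp
    also have "\<dots> = ennreal (16 * C1 * \<rho>\<^sup>2) * (\<integral>\<^sup>+z\<in>ball x0 \<rho> \<times> {0<..<t}. ennreal (hv z powr (1 + \<Lambda>)) \<partial>lborel)"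
      unfolding Zr_ennreal[symmetric] using C1_pos Zr_nonneg by (intro ennreal_mult) auto
    also have "\<dots> \<le> ennreal (16 * C1 * \<rho>\<^sup>2) * (\<integral>\<^sup>+z\<in>ball x0 \<rho> \<times> {0<..<s}. ennreal (hv z powr (1 + \<Lambda>)) \<partial>lborel)"
      using ts by (intro mult_left_mono nn_integral_mono) (auto split: split_indicator)
    finally show "(\<integral>\<^sup>+x. ennreal ((m \<rho> x)\<^sup>2 * hv (x, t)) \<partial>lborel)
      \<le> ennreal (16 * C1 * \<rho>\<^sup>2) * (\<integral>\<^sup>+z\<in>ball x0 \<rho> \<times> {0<..<s}. ennreal (hv z powr (1 + \<Lambda>)) \<partial>lborel)" .
  qed
qed

text \<open>Trapezoids equal 1 on time intervals exhausting \<open>(0, s)\<close>, and there the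
  bound does not depend on \<open>\<tau>\<close>. Continuity from below of the measure with the
  gradient term as density then gives the whole interval, up to the initial time.\<close>

lemma gradient_energy:
  assumes \<rho>: "0 < \<rho>" "\<rho> \<le> R" and s: "0 < s" "s < T"
  shows "(\<integral>\<^sup>+z\<in>UNIV \<times> {0<..<s}. ennreal ((m \<rho> (fst z))\<^sup>2 * qF z * (norm (G z))\<^sup>2) \<partial>lborel)
    \<le> ennreal (16 * C1 * \<rho>\<^sup>2) * (\<integral>\<^sup>+z\<in>ball x0 \<rho> \<times> {0<..<s}. ennreal (hv z powr (1 + \<Lambda>)) \<partial>lborel)"
proof -
  define \<nu> where "\<nu> = density lborel (\<lambda>z. ennreal ((m \<rho> (fst z))\<^sup>2 * qF z * (norm (G z))\<^sup>2 / 2))"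
  \<comment> \<open>Contained in the set where the trapezoid equals 1 as soon as
    \<open>\<tau> \<le> 1 / (n + 1)\<close>.\<close>
  define A where "A n = (UNIV :: 'a set) \<times> {2 / real (Suc n)..s - 1 / real (Suc n)}" for n
  let ?c = "8 * \<rho>\<^sup>2 * C1 * Zr \<rho> s"
  have em: "emeasure \<nu> X = (\<integral>\<^sup>+z\<in>X. ennreal ((m \<rho> (fst z))\<^sup>2 * qF z * (norm (G z))\<^sup>2 / 2) \<partial>lborel)"
    if "X \<in> sets borel" for X using that unfolding \<nu>_def by (subst emeasure_density) auto
  have Am: "A n \<in> sets borel" for n unfolding A_def by (intro pair_sets) auto
  have Ainc: "incseq A"
    unfolding A_def incseq_def
    by (intro allI impI Sigma_mono atLeastatMost_subset_iff[THEN iffD2] disjI2 conjI diff_mono divide_left_mono order_refl) auto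
  have bound: "emeasure \<nu> (A n) \<le> ennreal ?c" for n
  proof (rule ennreal_le_epsilon)
    fix e :: real assume e: "0 < e"
    then have "e / 2 > 0" by simp
    from energy_limit[OF \<rho> s this] obtain \<tau>0 :: real where \<tau>0: "\<tau>0 > 0"
      "\<And>\<tau>. 0 < \<tau> \<Longrightarrow> \<tau> \<le> \<tau>0 \<Longrightarrow> (\<integral>\<^sup>+z. ennreal (test_fun x0 \<rho> \<tau> s z * qF z * (norm (G z))\<^sup>2 / 2) \<partial>lborel)
        \<le> ennreal (2 * (e / 2) - J \<rho> s + ?c)" by blast
    define \<tau> where "\<tau> = min \<tau>0 (1 / real (Suc n))"
    have \<tau>: "0 < \<tau>" "\<tau> \<le> \<tau>0" "\<tau> \<le> 1 / real (Suc n)" using \<tau>0(1) by (auto simp: \<tau>_def)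
    have "emeasure \<nu> (A n) \<le> (\<integral>\<^sup>+z. ennreal (test_fun x0 \<rho> \<tau> s z * qF z * (norm (G z))\<^sup>2 / 2) \<partial>lborel)"
      unfolding em[OF Am]
    proof (rule nn_integral_mono)
      fix z :: "'a \<times> real"
      show "ennreal ((m \<rho> (fst z))\<^sup>2 * qF z * (norm (G z))\<^sup>2 / 2) * indicator (A n) z
        \<le> ennreal (test_fun x0 \<rho> \<tau> s z * qF z * (norm (G z))\<^sup>2 / 2)"
      proof (cases "z \<in> A n")
        case True
        then have "snd z \<in> {2 * \<tau>..s - \<tau>}" using \<tau>(3) by (auto simp: A_def)
        then have "test_fun x0 \<rho> \<tau> s z = (m \<rho> (fst z))\<^sup>2"
          by (simp only: test_fun_def trapezoid_eq_1[OF \<tau>(1)] mult_1_right)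
        then show ?thesis using True by simp
      qed simp
    qed
    also have "\<dots> \<le> ennreal (2 * (e / 2) - J \<rho> s + ?c)" by (rule \<tau>0(2)[OF \<tau>(1,2)])
    also have "\<dots> \<le> ennreal (?c + e)" using J_nonneg[of \<rho> s] by (intro ennreal_leI) simp
    also have "\<dots> = ennreal ?c + ennreal e" using e C1_pos Zr_nonneg by (intro ennreal_plus) auto
    finally show "emeasure \<nu> (A n) \<le> ennreal ?c + ennreal e" .
  qed
  have "(\<Union>n. A n) = UNIV \<times> {0<..<s}"
  proof (intro equalityI subsetI)
    fix z assume "z \<in> (\<Union>n. A n)"
    then obtain n where "z \<in> A n" by auto
    then have "2 / real (Suc n) \<le> snd z" "snd z \<le> s - 1 / real (Suc n)"
      unfolding A_def by (auto simp del: of_nat_Suc)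
    moreover have "2 / real (Suc n) > 0" "1 / real (Suc n) > 0" by simp_all
    ultimately have "0 < snd z" "snd z < s" by linarith+
    then show "z \<in> UNIV \<times> {0<..<s}" by (cases z) simp
  next
    fix z :: "'a \<times> real" assume z: "z \<in> UNIV \<times> {0<..<s}"
    then have "min (snd z / 2) (s - snd z) > 0" by (cases z) simp
    then obtain n where "inverse (real (Suc n)) < min (snd z / 2) (s - snd z)" using reals_Archimedean by blast
    then have "z \<in> A n" unfolding A_def by (cases z) (simp add: inverse_eq_divide del: of_nat_Suc)
    then show "z \<in> (\<Union>n. A n)" by blast
  qed
  moreover have "range A \<subseteq> sets \<nu>" using Am by (auto simp: \<nu>_def)
  ultimately have "emeasure \<nu> (UNIV \<times> {0<..<s}) = (SUP n. emeasure \<nu> (A n))"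
    using SUP_emeasure_incseq[OF _ Ainc, of \<nu>] by simp
  also have "\<dots> \<le> ennreal ?c" by (intro SUP_least bound)
  finally have half: "(\<integral>\<^sup>+z\<in>UNIV \<times> {0<..<s}. ennreal ((m \<rho> (fst z))\<^sup>2 * qF z * (norm (G z))\<^sup>2 / 2) \<partial>lborel) \<le> ennreal ?c"
    by (subst (asm) em) auto
  \<comment> \<open>Undoes the factor 1/2 left by Young's inequality; this is how 8 becomes
    16.\<close>
  have "(\<integral>\<^sup>+z\<in>UNIV \<times> {0<..<s}. ennreal ((m \<rho> (fst z))\<^sup>2 * qF z * (norm (G z))\<^sup>2) \<partial>lborel)
    = (\<integral>\<^sup>+z. 2 * (ennreal ((m \<rho> (fst z))\<^sup>2 * qF z * (norm (G z))\<^sup>2 / 2) * indicator (UNIV \<times> {0<..<s}) z) \<partial>lborel)"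
  proof (rule nn_integral_cong)
    fix z :: "'a \<times> real"
    have "ennreal ((m \<rho> (fst z))\<^sup>2 * qF z * (norm (G z))\<^sup>2) = ennreal (2 * ((m \<rho> (fst z))\<^sup>2 * qF z * (norm (G z))\<^sup>2 / 2))" by simp
    also have "\<dots> = 2 * ennreal ((m \<rho> (fst z))\<^sup>2 * qF z * (norm (G z))\<^sup>2 / 2)"
      using qF_nonneg[of z] by (subst ennreal_mult) auto
    finally show "ennreal ((m \<rho> (fst z))\<^sup>2 * qF z * (norm (G z))\<^sup>2) * indicator (UNIV \<times> {0<..<s}) z
      = 2 * (ennreal ((m \<rho> (fst z))\<^sup>2 * qF z * (norm (G z))\<^sup>2 / 2) * indicator (UNIV \<times> {0<..<s}) z)"
      by (simp only: mult.assoc)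
  qed
  also have "\<dots> = 2 * (\<integral>\<^sup>+z\<in>UNIV \<times> {0<..<s}. ennreal ((m \<rho> (fst z))\<^sup>2 * qF z * (norm (G z))\<^sup>2 / 2) \<partial>lborel)"
    by (rule nn_integral_cmult) measurable
  also have "\<dots> \<le> 2 * ennreal ?c" by (rule mult_left_mono[OF half]) simp
  also have "\<dots> = ennreal (16 * C1 * \<rho>\<^sup>2) * ennreal (Zr \<rho> s)"
  proof -
    have "2 * ennreal ?c = ennreal (2 * ?c)" using C1_pos Zr_nonneg by (subst ennreal_mult) auto
    also have "2 * ?c = (16 * C1 * \<rho>\<^sup>2) * Zr \<rho> s" by simp
    also have "ennreal \<dots> = ennreal (16 * C1 * \<rho>\<^sup>2) * ennreal (Zr \<rho> s)" using C1_pos Zr_nonneg by (intro ennreal_mult) auto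
    finally show ?thesis .
  qed
  finally show ?thesis unfolding Zr_ennreal .
qed

lemma local_solution: "local_solution H F W1 M \<Lambda> p C1 C2 v G x0 R T (16 * C1)"
proof (unfold_locales)
  show "AE t in lborel. t \<in> {0<..<s} \<longrightarrow> (\<integral>\<^sup>+x. ennreal ((max 0 (\<rho>\<^sup>2 - (norm (x - x0))\<^sup>2))\<^sup>2 * H (v (x, t))) \<partial>lborel)
      \<le> ennreal (16 * C1 * \<rho>\<^sup>2) * (\<integral>\<^sup>+z\<in>ball x0 \<rho> \<times> {0<..<s}. ennreal (H (v z) powr (1 + \<Lambda>)) \<partial>lborel)"
    if "0 < \<rho>" "\<rho> \<le> R" "0 < s" "s < T" for \<rho> s
    using slice_energy[OF that] unfolding hv_def parabola_cutoff_def .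
  show "(\<integral>\<^sup>+z\<in>UNIV \<times> {0<..<s}. ennreal ((max 0 (\<rho>\<^sup>2 - (norm (fst z - x0))\<^sup>2))\<^sup>2
              * (if v z = 0 then 0 else deriv F (v z)) * (norm (G z))\<^sup>2) \<partial>lborel)
      \<le> ennreal (16 * C1 * \<rho>\<^sup>2) * (\<integral>\<^sup>+z\<in>ball x0 \<rho> \<times> {0<..<s}. ennreal (H (v z) powr (1 + \<Lambda>)) \<partial>lborel)"
    if "0 < \<rho>" "\<rho> \<le> R" "0 < s" "s < T" for \<rho> s
    using gradient_energy[OF that] unfolding hv_def qF_def parabola_cutoff_def .
  show "(\<integral>z. v z * \<phi>' z (y, 0) \<partial>lborel) = - (\<integral>z. \<phi> z * (G z \<bullet> y) \<partial>lborel)"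
    if "0 < \<sigma>" "s < T" "C1_derivative \<phi> \<phi>'" "\<And>z. z \<notin> cball x0 R \<times> {\<sigma>..s} \<Longrightarrow> \<phi> z = 0" for \<sigma> s \<phi> \<phi>' y
    using that by (rule weak_gradient_identity)
qed (use v_borel G_borel v_bounds R_pos T_pos C1_pos gradient_sq_integrable in auto)

end

section \<open>Finite propagation speed\<close>

text \<open>Where \<open>u(\<sigma>)\<close> vanishes on \<open>K\<close>, the set where
  \<open>u(\<sigma>)\<close> and \<open>u(t)\<close> differ by more than \<open>\<delta>\<close> is,
  up to a null set, the set where \<open>u(t)\<close> exceeds \<open>\<delta>\<close>. Its measure
  is thus independent of \<open>\<sigma>\<close>, yet tends to 0 as \<open>\<sigma>\<close> tends to
  \<open>t\<close>.\<close>

lemma vanishing_slices: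
  fixes u :: "'a::euclidean_space \<times> real \<Rightarrow> real"
  assumes u: "continuous_L0_loc \<Omega> T u" and \<Omega>: "open \<Omega>" and K: "compact K" "K \<subseteq> \<Omega>"
    and s: "0 < s" "s \<le> T" and t: "t \<in> {0..s}"
    and zero: "AE \<sigma> in lborel. \<sigma> \<in> {0<..<s} \<longrightarrow> (AE x in lborel. x \<in> K \<longrightarrow> u (x, \<sigma>) = 0)"
  shows "AE x in lborel. x \<in> K \<longrightarrow> u (x, t) = 0"
proof -
  have tT: "t \<in> {0..T}" using s t by auto
  have Kl: "K \<in> lmeasurable" using K(1) by (rule lmeasurable_compact)
  have um: "(\<lambda>x. if x \<in> \<Omega> then u (x, \<sigma>) else 0) \<in> borel_measurable lebesgue" if "\<sigma> \<in> {0..T}" for \<sigma>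
    using u that \<Omega> unfolding continuous_L0_loc_def by (subst borel_measurable_if) auto
  have sets: "K \<inter> {x. \<delta> < \<bar>f x\<bar>} \<in> sets lebesgue" if f: "f \<in> borel_measurable lebesgue" for f :: "'a \<Rightarrow> real" and \<delta>
  proof (rule sets.Int[OF fmeasurableD[OF Kl]])
    have "{x \<in> space lebesgue. \<delta> < \<bar>f x\<bar>} \<in> sets lebesgue"
      using f by (intro borel_measurable_less borel_measurable_const borel_measurable_abs)
    then show "{x. \<delta> < \<bar>f x\<bar>} \<in> sets lebesgue" by simp
  qed
  have null: "{x \<in> K. \<delta> < \<bar>u (x, t)\<bar>} \<in> null_sets lebesgue" if \<delta>: "\<delta> > 0" for \<delta>
  proof -
    let ?S = "{x \<in> K. \<delta> < \<bar>u (x, t)\<bar>}"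
    let ?b = "\<lambda>\<sigma>. {x \<in> K. \<bar>u (x, \<sigma>) - u (x, t)\<bar> > \<delta>}"
    have Seq: "?S = K \<inter> {x. \<delta> < \<bar>if x \<in> \<Omega> then u (x, t) else 0\<bar>}" using K(2) by auto
    have Sl: "?S \<in> lmeasurable"
      by (rule fmeasurableI2[OF Kl]) (auto simp only: Seq sets[OF um[OF tT]])
    have beq: "?b \<sigma> = K \<inter> {x. \<delta> < \<bar>(if x \<in> \<Omega> then u (x, \<sigma>) else 0) - (if x \<in> \<Omega> then u (x, t) else 0)\<bar>}" for \<sigma>
      using K(2) by auto
    have meq: "measure lebesgue (?b \<sigma>) = measure lebesgue ?S"
      if "\<sigma> \<in> {0..T}" "AE x in lborel. x \<in> K \<longrightarrow> u (x, \<sigma>) = 0" for \<sigma>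
    proof (rule measure_eq_AE)
      show "AE x in lebesgue. x \<in> ?b \<sigma> \<longleftrightarrow> x \<in> ?S"
        using AE_completion[OF that(2)] by eventually_elim auto
      show "?b \<sigma> \<in> sets lebesgue" unfolding beq by (intro sets borel_measurable_diff um that(1) tT)
      show "?S \<in> sets lebesgue" by (rule fmeasurableD[OF Sl])
    qed
    have "measure lebesgue ?S = 0"
    proof (rule ccontr)
      assume "measure lebesgue ?S \<noteq> 0"
      then have pos: "measure lebesgue ?S > 0" by (simp add: zero_less_measure_iff)
      have "((\<lambda>\<sigma>. measure lebesgue (?b \<sigma>)) \<longlongrightarrow> 0) (at t within {0..T})"
        using u[unfolded continuous_L0_loc_def, THEN conjunct2, rule_format, OF tT, of K \<delta>] K \<delta> by simp
      from tendstoD[OF this pos] obtain d where d: "d > 0"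
        "\<And>\<sigma>. \<sigma> \<in> {0..T} \<Longrightarrow> \<sigma> \<noteq> t \<Longrightarrow> dist \<sigma> t < d \<Longrightarrow> measure lebesgue (?b \<sigma>) < measure lebesgue ?S"
        unfolding eventually_at by (auto simp: dist_real_def)
      \<comment> \<open>The times of \<open>(0, s)\<close> within distance \<open>d\<close> of
        \<open>t\<close>; this interval is nondegenerate also when \<open>t\<close> is an
        endpoint.\<close>
      define p where "p = max 0 (t - d)"
      define q where "q = min s (t + d)"
      have pq: "p < q" using d(1) t s by (auto simp: p_def q_def max_def min_def)
      have "AE \<sigma> in lborel. \<sigma> \<notin> {p<..<q}"
        using zero AE_lborel_singleton[of t]
      proof eventually_elim
        case (elim \<sigma>)
        show ?case
        proof
          assume \<sigma>: "\<sigma> \<in> {p<..<q}"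
          then have "\<sigma> \<in> {0<..<s}" "\<sigma> \<in> {0..T}" "dist \<sigma> t < d" using s by (auto simp: p_def q_def dist_real_def)
          then show False using elim meq[of \<sigma>] d(2)[of \<sigma>] by auto
        qed
      qed
      then have "{p<..<q} \<in> null_sets lborel" by (subst AE_iff_null_sets) simp_all
      then have "emeasure lborel {p<..<q} = 0" by (rule null_setsD1)
      then show False using pq by simp
    qed
    then show ?thesis
      using Sl by (simp add: null_sets_def fmeasurableD emeasure_eq_measure2)
  qed
  have "AE x in lebesgue. \<forall>n. x \<notin> {x \<in> K. inverse (real (Suc n)) < \<bar>u (x, t)\<bar>}"
    unfolding AE_all_countable by (intro allI AE_not_in null) simp
  then have "AE x in lborel. \<forall>n. x \<notin> {x \<in> K. inverse (real (Suc n)) < \<bar>u (x, t)\<bar>}"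
    by (simp only: AE_completion_iff)
  then show ?thesis
  proof eventually_elim
    case (elim x)
    show ?case
    proof (intro impI, rule ccontr)
      assume "x \<in> K" "u (x, t) \<noteq> 0"
      then obtain n where "inverse (real (Suc n)) < \<bar>u (x, t)\<bar>" using reals_Archimedean[of "\<bar>u (x, t)\<bar>"] by auto
      then show False using elim \<open>x \<in> K\<close> by auto
    qed
  qed
qed

lemma degenerate_coefficient_of_sup:
  assumes a_cont: "continuous_on {0..} a" and a_pos: "\<forall>s>0. a s > 0"
    and I_finite: "\<forall>s>0. set_integrable lborel {s..} (\<lambda>v. 1 / (v * a v))"
    and c: "c > 0" "\<mu> > 0" and dec: "\<forall>s v. 0 < s \<and> s < v \<longrightarrow> a s * tailI a s powr \<mu> \<ge> c * (a v * tailI a v powr \<mu>)"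
    and \<Lambda>_pos: "0 < \<Lambda>"
    and \<Lambda>_less: "ereal \<Lambda> < 1 / max (SUP s\<in>{0<..}. ereal (a s * tailI a s)) 0"
  obtains A where "degenerate_coefficient a \<Lambda> A c \<mu>"
proof -
  define S where "S = (SUP s\<in>{0<..}. ereal (a s * tailI a s))"
  have up: "ereal (a s * tailI a s) \<le> S" if "s > 0" for s
    unfolding S_def using that by (intro SUP_upper) auto
  have "a 1 * tailI a 1 > 0" using a_pos tailI_pos[OF a_pos I_finite] by simp
  then have "0 < ereal (a 1 * tailI a 1)" by simp
  also have "\<dots> \<le> S" by (rule up) simp
  finally have S0: "0 < S" .
  then have less: "ereal \<Lambda> < 1 / S" using \<Lambda>_less unfolding S_def[symmetric] by (simp add: max_absorb1 less_imp_le)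
  \<comment> \<open>An infinite supremum would give \<open>1 / S = 0\<close>, contradicting
    \<open>0 < \<Lambda>\<close>; hence the supremum is a real number and serves as
    \<open>A\<close>.\<close>
  then obtain A where A: "S = ereal A" using S0 \<Lambda>_pos by (cases S) auto
  then have "A > 0" "\<Lambda> < 1 / A" using S0 less by (auto simp: one_ereal_def)
  then have "A * \<Lambda> < 1" by (simp add: field_simps)
  then have "degenerate_coefficient a \<Lambda> A c \<mu>"
    using assms up by unfold_locales (auto simp: A)
  then show ?thesis by (rule that)
qed

text \<open>Assembles the chain: Borel representatives make \<open>u\<close> a
  \<open>weak_solution\<close>, the energy estimate makes it a \<open>local_solution\<close>, the
  iteration gives \<open>Z r0 s = 0\<close>, and positivity of \<open>H\<close> off 0 turns this
  into \<open>u = 0\<close> almost everywhere on the smaller cylinder.\<close>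

lemma finite_propagation:
  fixes u :: "'a::euclidean_space \<times> real \<Rightarrow> real"
  assumes dc: "degenerate_coefficient a \<Lambda> A c \<mu>" and \<Omega>: "open \<Omega>" and T: "T > 0"
    and sol: "pos_bdd_weak_solution (Ffun a \<Lambda>) (Hfun a \<Lambda>) \<Omega> T u"
    and r: "r > 0" "ball x0 r \<subseteq> \<Omega>" and \<epsilon>: "0 < \<epsilon>" "\<epsilon> < 1"
    and init: "AE x in lebesgue_on (ball x0 r). u (x, 0) = 0"
  obtains s where "0 < s" "s \<le> T" "\<And>t. t \<in> {0..s} \<Longrightarrow> AE x in lebesgue_on (ball x0 (\<epsilon> * r)). u (x, t) = 0"
proof -
  define E where "E = \<Omega> \<times> {0<..<T}"
  have Eb [measurable]: "E \<in> sets borel" unfolding E_def using \<Omega> by (intro borel_open open_Times) auto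
  then have El: "E \<inter> space lebesgue \<in> sets lebesgue" by simp
  have ae_E: "AE z in lborel. z \<in> E \<longrightarrow> P z" if "AE z in lebesgue_on E. P z" for P
    using that unfolding AE_restrict_space_iff[OF El] AE_completion_iff .
  obtain M0 g where um: "u \<in> borel_measurable (lebesgue_on E)"
    and M0: "AE z in lebesgue_on E. \<bar>u z\<bar> \<le> M0" and u0: "AE z in lebesgue_on E. u z \<ge> 0"
    and uc: "continuous_L0_loc \<Omega> T u" and g: "weak_space_grad_L2loc E u g"
    and ineq: "\<forall>\<phi> \<in> Lip_c E. (\<forall>z. \<phi> z \<ge> 0) \<longrightarrow>
          set_integrable lebesgue E (diffusion_term (Ffun a \<Lambda>) u g \<phi>) \<and>
          (LINT z:E|lebesgue. diffusion_term (Ffun a \<Lambda>) u g \<phi> z)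
            \<le> (LINT z:E|lebesgue. time_deriv \<phi> z * Hfun a \<Lambda> (u z))"
    using sol unfolding pos_bdd_weak_solution_def Let_def E_def[symmetric] by blast
  define M where "M = max 1 M0"
  have M: "M > 0" by (simp add: M_def)
  obtain W1 p C2 where es: "entropy_structure (Hfun a \<Lambda>) (Ffun a \<Lambda>) W1 M \<Lambda> p A C2"
    using degenerate_coefficient.entropy_structure_exists[OF dc M] by blast
  obtain v' where v': "v' \<in> borel_measurable borel" "AE z in lborel. z \<in> E \<longrightarrow> u z = v' z"
    using borel_representative[OF Eb um] by blast
  have gm: "g \<in> borel_measurable (lebesgue_on E)" using g unfolding weak_space_grad_L2loc_def by blast
  obtain G' where G': "G' \<in> borel_measurable borel" "AE z in lborel. z \<in> E \<longrightarrow> g z = G' z"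
    using borel_representative[OF Eb gm] by blast
  \<comment> \<open>Clamping changes \<open>v'\<close> only on a null set of the cylinder, where the
    almost everywhere bounds on \<open>u\<close> fail, and gives bounds at every point.\<close>
  define v where "v z = (if z \<in> E then max 0 (min M (v' z)) else 0)" for z
  define G where "G z = (if z \<in> E then G' z else 0)" for z
  have uv: "AE z in lborel. z \<in> E \<longrightarrow> u z = v z"
    using v'(2) ae_E[OF M0] ae_E[OF u0] by eventually_elim (auto simp: v_def M_def)
  have gG: "AE z in lborel. z \<in> E \<longrightarrow> g z = G z" using G'(2) by eventually_elim (simp add: G_def)
  have vb: "v \<in> borel_measurable borel" "G \<in> borel_measurable borel"
    using v'(1) G'(1) unfolding v_def[abs_def] G_def[abs_def] by measurable
  \<comment> \<open>Two radii strictly between \<open>\<epsilon> * r\<close> and \<open>r\<close>: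
    the closed ball of radius \<open>R\<close> still lies in the given open ball, the iteration
    shrinks from \<open>R\<close> to \<open>r0\<close>, and the closed ball of radius
    \<open>\<epsilon> * r\<close>, compact as \<open>vanishing_slices\<close> requires, fits into
    the ball of radius \<open>r0\<close>.\<close>
  define R where "R = (1 + \<epsilon>) / 2 * r"
  define r0 where "r0 = (\<epsilon> * r + R) / 2"
  have R: "0 < R" "R < r" "\<epsilon> * r < r0" "r0 < R" "0 < r0" "0 < \<epsilon> * r"
    using r(1) \<epsilon> by (auto simp: R_def r0_def field_simps add_pos_pos)
  have RO: "cball x0 R \<subseteq> ball x0 r" using R by auto
  have init': "AE x in lborel. x \<in> ball x0 r \<longrightarrow> u (x, 0) = 0"
    using init by (simp add: AE_restrict_space_iff AE_completion_iff)
  have ws: "weak_solution (Hfun a \<Lambda>) (Ffun a \<Lambda>) W1 M \<Lambda> p A C2 \<Omega> T u v g G x0 R"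
  proof (intro weak_solution.intro weak_solution_axioms.intro es \<Omega> T R uc vb)
    show "cball x0 R \<subseteq> \<Omega>" using RO r(2) by blast
    show "AE x in lborel. x \<in> cball x0 R \<longrightarrow> u (x, 0) = 0" using init' by eventually_elim (use RO in blast)
    show "weak_space_grad_L2loc (\<Omega> \<times> {0<..<T}) u g" using g unfolding E_def .
    show "AE z in lborel. z \<in> \<Omega> \<times> {0<..<T} \<longrightarrow> u z = v z" using uv unfolding E_def .
    show "AE z in lborel. z \<in> \<Omega> \<times> {0<..<T} \<longrightarrow> g z = G z" using gG unfolding E_def .
    show "v z = 0" "G z = 0" if "z \<notin> \<Omega> \<times> {0<..<T}" for z
      using that unfolding v_def G_def E_def by (simp_all only: if_False)
    show "0 \<le> v z" "v z \<le> M" for z using M by (auto simp: v_def)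
  qed (use ineq in \<open>auto simp only: E_def\<close>)
  interpret ls: local_solution "Hfun a \<Lambda>" "Ffun a \<Lambda>" W1 M \<Lambda> p A C2 v G x0 R T "16 * A"
    by (rule weak_solution.local_solution[OF ws])
  obtain s where s: "0 < s" "s < T" and Z: "ls.Z r0 s = 0" using ls.Z_eventually_zero[OF R(5,4)] by blast
  have "AE z in lborel. ennreal (ls.h z powr (1 + \<Lambda>)) * indicator (ball x0 r0 \<times> {0<..<s}) z = 0"
    using Z unfolding ls.Z_def ls.h_def[symmetric] by (subst (asm) nn_integral_0_iff_AE) auto
  then have "AE z in lborel. z \<in> ball x0 r0 \<times> {0<..<s} \<longrightarrow> u z = 0"
    using uv
  proof eventually_elim
    case (elim z)
    show ?case
    proof
      assume z: "z \<in> ball x0 r0 \<times> {0<..<s}"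
      have "fst z \<in> \<Omega>" using z R r(2) by auto
      then have "z \<in> E" using z s by (cases z) (auto simp: E_def)
      then have uz: "u z = v z" using elim by blast
      have "ennreal (ls.h z powr (1 + \<Lambda>)) = 0" using elim(1) z by (simp only: indicator_simps mult_1_right)
      then have "ls.h z powr (1 + \<Lambda>) \<le> 0" by (simp only: ennreal_eq_0_iff)
      with powr_ge_zero[of "ls.h z" "1 + \<Lambda>"] have "ls.h z powr (1 + \<Lambda>) = 0" by linarith
      then have "ls.h z = 0" by simp
      then have "v z = 0" using ls.H_pos[of "v z"] ls.v_bounds[of z] by (auto simp: ls.h_def less_le)
      then show "u z = 0" using uz by simp
    qed
  qed
  from AE_slices[OF this]
  have slices: "AE \<sigma> in lborel. \<sigma> \<in> {0<..<s} \<longrightarrow> (AE x in lborel. x \<in> cball x0 (\<epsilon> * r) \<longrightarrow> u (x, \<sigma>) = 0)"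
  proof eventually_elim
    case (elim \<sigma>)
    show ?case
    proof
      assume "\<sigma> \<in> {0<..<s}"
      with elim show "AE x in lborel. x \<in> cball x0 (\<epsilon> * r) \<longrightarrow> u (x, \<sigma>) = 0"
        using R(3) by (auto elim!: eventually_mono)
    qed
  qed
  show ?thesis
  proof (rule that[OF s(1)])
    show "s \<le> T" using s by simp
    fix t assume t: "t \<in> {0..s}"
    have "cball x0 (\<epsilon> * r) \<subseteq> \<Omega>" using R r(2) by (auto simp: subset_iff)
    from vanishing_slices[OF uc \<Omega> compact_cball this s(1) _ t slices] s
    have "AE x in lborel. x \<in> cball x0 (\<epsilon> * r) \<longrightarrow> u (x, t) = 0" by simp
    then have "AE x in lborel. x \<in> ball x0 (\<epsilon> * r) \<longrightarrow> u (x, t) = 0" by eventually_elim auto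
    then show "AE x in lebesgue_on (ball x0 (\<epsilon> * r)). u (x, t) = 0"
      by (simp add: AE_restrict_space_iff AE_completion_iff)
  qed
qed

theorem theorem5p1:
  fixes a :: "real \<Rightarrow> real" and \<Lambda> T :: real
    and \<Omega> :: "(real ^ 'n) set" and u :: "(real ^ 'n) \<times> real \<Rightarrow> real"
  assumes a_cont: "continuous_on {0..} a"
    and a_zero: "a 0 = 0"
    and a_pos: "\<forall>s>0. a s > 0"
    and I_finite: "\<forall>s>0. set_integrable lborel {s..} (\<lambda>v. 1 / (v * a v))"
    and limsup_infinity: "Limsup at_top (\<lambda>s. ereal (a s * tailI a s)) < \<infinity>"
    and limsup_zero: "Limsup (at_right 0) (\<lambda>s. ereal (a s * tailI a s)) < \<infinity>"
    and almost_decreasing: "\<exists>c>0. \<exists>\<mu>>0. \<forall>s v. 0 < s \<and> s < v \<longrightarrow>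
          a s * tailI a s powr \<mu> \<ge> c * (a v * tailI a v powr \<mu>)"
    and \<Lambda>_pos: "0 < \<Lambda>"
    and \<Lambda>_less: "ereal \<Lambda> < 1 / max (SUP s\<in>{0<..}. ereal (a s * tailI a s)) 0"
    and \<Omega>_domain: "open \<Omega>" "connected \<Omega>" "\<Omega> \<noteq> {}"
    and T_pos: "T > 0"
    and u_sol: "pos_bdd_weak_solution (Ffun a \<Lambda>) (Hfun a \<Lambda>) \<Omega> T u"
  shows "\<forall>x0 r \<epsilon>. r > 0 \<and> ball x0 r \<subseteq> \<Omega> \<and> 0 < \<epsilon> \<and> \<epsilon> < 1 \<longrightarrow>
    (\<exists>s. 0 < s \<and> s \<le> T \<and>
      ((AE x in lebesgue_on (ball x0 r). u (x, 0) = 0) \<longrightarrow>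
       (\<forall>t\<in>{0..s}. AE x in lebesgue_on (ball x0 (\<epsilon> * r)). u (x, t) = 0)))"
proof (intro allI impI, elim conjE)
  fix x0 :: "real ^ 'n" and r \<epsilon> :: real
  assume r: "r > 0" "ball x0 r \<subseteq> \<Omega>" "0 < \<epsilon>" "\<epsilon> < 1"
  obtain c \<mu> where c: "c > 0" "\<mu> > 0"
    "\<forall>s v. 0 < s \<and> s < v \<longrightarrow> a s * tailI a s powr \<mu> \<ge> c * (a v * tailI a v powr \<mu>)"
    using almost_decreasing by blast
  obtain A where dc: "degenerate_coefficient a \<Lambda> A c \<mu>"
    by (rule degenerate_coefficient_of_sup[OF a_cont a_pos I_finite c \<Lambda>_pos \<Lambda>_less])
  show "\<exists>s. 0 < s \<and> s \<le> T \<and>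
      ((AE x in lebesgue_on (ball x0 r). u (x, 0) = 0) \<longrightarrow>
       (\<forall>t\<in>{0..s}. AE x in lebesgue_on (ball x0 (\<epsilon> * r)). u (x, t) = 0))"
  \<comment> \<open>The witness \<open>s\<close> is chosen outside the implication. If the initial
    slice does not vanish on the ball, the implication is void and \<open>T\<close> serves.\<close>
  proof (cases "AE x in lebesgue_on (ball x0 r). u (x, 0) = 0")
    case True
    show ?thesis
    proof (rule finite_propagation[OF dc \<Omega>_domain(1) T_pos u_sol r True])
      fix s assume s: "0 < s" "s \<le> T"
        and zero: "\<And>t. t \<in> {0..s} \<Longrightarrow> AE x in lebesgue_on (ball x0 (\<epsilon> * r)). u (x, t) = 0"
      show ?thesis by (rule exI[of _ s], intro conjI impI ballI s zero)
    qed
  next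
    case False
    then show ?thesis using T_pos by (intro exI[of _ T]) simp
  qed
qed

end
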